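(* Let $n = xy2^\alpha$, where $x,y\ge 1$ are odd integers and $\alpha\ge 1$ is an integer. Write the binary representation of $y$ as $y = 2^{i_1}+2^{i_2}+\cdots+2^{i_j}$ with $i_1>i_2>\cdots>i_j=0$. Then for every integer $q$ with $0\le q\le n-i_1-2xj$, the hypercube $Q_n$ has an edge decomposition into $x2^{i_1+\alpha+j-2+q}$ cycles, each of length $y2^{n-i_1-j-q+1}$.
   Context: $Q_n$ denotes the $n$-dimensional hypercube: its vertex set is $\{0,1\}^n$ and two vertices are adjacent iff they differ in exactly one coordinate. An edge decomposition of a graph $G$ into subgraphs $G_1,\dots,G_k$ means that $G_1,\dots,G_k$ are pairwise edge-disjoint and their union is $G$. The length of a cycle is its number of edges. *)

theory Defs
  imports Main
begin

datatype 'a graph = Graph (verts: "'a set") (edges: "'a set set")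

definition wf_graph :: "'a graph \<Rightarrow> bool" where
  "wf_graph G \<longleftrightarrow> (\<forall>e\<in>edges G. e \<subseteq> verts G \<and> card e = 2)"

definition subgraph :: "'a graph \<Rightarrow> 'a graph \<Rightarrow> bool" where
  "subgraph H G \<longleftrightarrow> wf_graph H \<and> verts H \<subseteq> verts G \<and> edges H \<subseteq> edges G"

definition edge_decomposition :: "'a graph \<Rightarrow> nat \<Rightarrow> (nat \<Rightarrow> 'a graph) \<Rightarrow> bool" where
  "edge_decomposition G k H \<longleftrightarrow>
     (\<forall>c<k. subgraph (H c) G) \<and>
     (\<forall>c<k. \<forall>d<k. c \<noteq> d \<longrightarrow> edges (H c) \<inter> edges (H d) = {}) \<and>
     (\<Union>c<k. verts (H c)) = verts G \<and>
     (\<Union>c<k. edges (H c)) = edges G"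

definition cycle_graph :: "nat \<Rightarrow> 'a graph \<Rightarrow> bool" where
  "cycle_graph l C \<longleftrightarrow> 3 \<le> l \<and>
     (\<exists>vs. distinct vs \<and> length vs = l \<and> verts C = set vs \<and>
        edges C = {{vs ! m, vs ! (Suc m mod l)} | m. m < l})"

text \<open>A vertex in \<open>{0,1}\<^sup>n\<close> is represented by a Boolean list of length \<open>n\<close>.\<close>

definition hypercube :: "nat \<Rightarrow> bool list graph" where
  "hypercube n = Graph {v. length v = n}
     {{u, v} | u v. length u = n \<and> length v = n \<and> card {m. m < n \<and> u ! m \<noteq> v ! m} = 1}"

end

theory Submission
  imports Defs
begin

text \<open>Since \<open>y = 2^i\<^sub>1 + \<dots> + 2^i\<^sub>j\<close>, the cube \<open>Q\<^sub>n\<close> is a product of cubes \<open>Q\<^bsub>n\<^sub>k\<^esub>\<close> of dimensions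
\<open>n\<^sub>k = x * 2^(\<alpha> + i\<^sub>k)\<close>, to be treated one after the other.

The basic tool is a winding argument. Let \<open>D\<close> be an \<open>m\<close>-cycle and \<open>G\<close> a \<open>b\<close>-cycle, \<open>S\<close> a set of vertices of \<open>D\<close>
and \<open>s\<close> a divisor of \<open>b\<close>. Give the vertices along \<open>D\<close> a height that changes by \<open>\<plusminus>1\<close> exactly at the vertices
of \<open>S\<close> and gains \<open>s\<close> in each round. Following the heights, the copies of \<open>D\<close> together with the copies of \<open>G\<close> at the
vertices of \<open>S\<close> split into \<open>s\<close> cycles of length \<open>(m + |S|) * (b div s)\<close>, one for each residue modulo \<open>s\<close>.

For \<open>S = D\<close> and \<open>s = 2\<close> these are Hamilton cycles of \<open>D \<times> G\<close>; with an explicit decomposition of the product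
of two edge-disjoint Hamilton cycles by a cycle into three Hamilton cycles, all even-dimensional cubes have Hamilton
decompositions. Products of \<open>Q\<^bsub>2x\<^esub>\<close> by repeated doubling then give, for all \<open>2x \<le> L \<le> 2x * 2^t\<close>, decompositions
of the cube of dimension \<open>2x * 2^t\<close> into 2-factors made of cycles of length \<open>2^L\<close>, together with a vertex colouring with
\<open>2^(L - 2x)\<close> colours in which every cycle sees all colours equally often.

Finally let \<open>M = 2^i\<^sub>1\<close> and colour the first cube with \<open>M\<close> colours. Each cycle of the first cube is combined in turn with cycles
of the \<open>k\<close>-th cube, for \<open>k = 2, \<dots>, j\<close>, taking for \<open>S\<close> the vertices whose colours lie in a window of \<open>2^i\<^sub>k\<close> colours that
has not been used before. This multiplies the cycle lengths by powers of 2, and the remaining factor grows from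
\<open>M = 2^i\<^sub>1\<close> through \<open>2^i\<^sub>1 + 2^i\<^sub>2\<close> and so on up to \<open>y\<close>. The freedom in the choice of the exponents \<open>L\<close> produces every admissible \<open>q\<close>.\<close>

section \<open>Cycles as edge sets\<close>

text \<open>Why windows. With \<open>N = x * 2^(\<alpha> - 1)\<close> the first cube has
  \<open>N * M\<close> 2-factors, but the k-th only \<open>N * B\<close>, where
  \<open>B = 2^(i k)\<close> divides \<open>M\<close>. Each 2-factor of the k-th cube is therefore
  shared by \<open>M div B\<close> 2-factors of the first, and these must divide the vertices of the
  first cube among themselves: hence a colouring in which one cycle may claim \<open>B\<close> of
  \<open>M\<close> colours, with windows rotated along with the index of the 2-factor. As the
  exponents decrease, each window starts at a multiple of its size, and \<open>y - M < M\<close>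
  leaves room for all of them. Where the bound on \<open>q\<close> comes from. The cycle lengths
  \<open>2^(L k)\<close> in the blocks satisfy \<open>L 1 + ... + L j = n - q\<close>. Each
  \<open>L k\<close> is at least \<open>2 * x\<close>, because the doubling starts with the Hamilton
  cycles of the cube of dimension \<open>2 * x\<close>, and \<open>L 1\<close> needs
  \<open>i 1\<close> more, so that its \<open>2^(L 1 - 2 * x)\<close> colours can be merged into
  \<open>M\<close>. The least possible sum is \<open>2 * x * j + i 1\<close>; the largest, with
  Hamilton cycles throughout, belongs to \<open>q = 0\<close>.\<close>

text \<open>A cycle of length \<open>l\<close> is parametrised by an \<open>l\<close>-periodic map on the integers, which avoids wrapping indices around.\<close>

definition cycle_map :: "nat \<Rightarrow> (int \<Rightarrow> 'a) \<Rightarrow> bool" where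
  "cycle_map l d \<longleftrightarrow> 3 \<le> l \<and> (\<forall>i j. d i = d j \<longleftrightarrow> i mod int l = j mod int l)"

definition cyc :: "nat \<Rightarrow> 'a set set \<Rightarrow> bool" where
  "cyc l K \<longleftrightarrow> (\<exists>d. cycle_map l d \<and> K = range (\<lambda>i. {d i, d (i + 1)}))"

lemma cycle_map_eq: "cycle_map l d \<Longrightarrow> d i = d j \<longleftrightarrow> i mod int l = j mod int l"
  by (simp add: cycle_map_def)

lemma cycle_map_period: "cycle_map l d \<Longrightarrow> d (i + k * int l) = d i"
  by (simp add: cycle_map_eq)

lemma cycle_map_shift_eq: "cycle_map l d \<Longrightarrow> d i = d j \<Longrightarrow> d (i + k) = d (j + k)"
  unfolding cycle_map_eq by (rule mod_add_cong) auto

lemma cycle_map_range: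
  assumes "cycle_map l d"
  shows "range d = d ` {0..<int l}" "inj_on d {0..<int l}"
proof -
  have l: "l \<ge> 3" using assms by (simp add: cycle_map_def)
  have "d i \<in> d ` {0..<int l}" for i
  proof (rule image_eqI)
    show "d i = d (i mod int l)" using assms by (simp add: cycle_map_eq)
  qed (use l in auto)
  then show "range d = d ` {0..<int l}" by auto
  show "inj_on d {0..<int l}" using assms by (auto simp: inj_on_def cycle_map_eq)
qed

lemma cycle_map_card: "cycle_map l d \<Longrightarrow> card (range d) = l" "cycle_map l d \<Longrightarrow> finite (range d)"
  by (simp_all add: cycle_map_range card_image)

lemma cycle_map_succ:
  assumes "cycle_map l d" shows "d i \<noteq> d (i + 1)" "d (i - 1) \<noteq> d i" "d (i - 1) \<noteq> d (i + 1)"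
proof -
  have l: "int l \<ge> 3" using assms by (simp add: cycle_map_def)
  have *: "\<not> int l dvd 1" "\<not> int l dvd 2" using l zdvd_imp_le by fastforce+
  show "d i \<noteq> d (i + 1)" "d (i - 1) \<noteq> d i" "d (i - 1) \<noteq> d (i + 1)"
    using * dvd_minus_iff[of "int l" 1] dvd_minus_iff[of "int l" 2]
    by (auto simp: cycle_map_eq[OF assms] mod_eq_dvd_iff)
qed

lemma cycle_map_edges_Union: "\<Union>(range (\<lambda>i::int. {d i, d (i + 1)})) = range d"
  by auto

lemma cycle_map_neighbours:
  assumes "cycle_map l d"
  shows "{d i, u} \<in> range (\<lambda>i. {d i, d (i + 1)}) \<longleftrightarrow> u = d (i + 1) \<or> u = d (i - 1)"
proof
  assume "{d i, u} \<in> range (\<lambda>i. {d i, d (i + 1)})"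
  then obtain k where k: "{d i, u} = {d k, d (k + 1)}" by auto
  then consider "d i = d k" "u = d (k + 1)" | "d i = d (k + 1)" "u = d k"
    by (auto simp: doubleton_eq_iff)
  then show "u = d (i + 1) \<or> u = d (i - 1)"
  proof cases
    case 1 then show ?thesis using cycle_map_shift_eq[OF assms, of i k 1] by simp
  next
    case 2
    then show ?thesis using cycle_map_shift_eq[OF assms, of i "k + 1" "-1"] by simp
  qed
next
  assume "u = d (i + 1) \<or> u = d (i - 1)"
  then show "{d i, u} \<in> range (\<lambda>i. {d i, d (i + 1)})"
    using rangeI[of "\<lambda>i. {d i, d (i + 1)}" i] rangeI[of "\<lambda>i. {d i, d (i + 1)}" "i - 1"]
    by (auto simp: insert_commute)
qed

lemma cyc_length: "cyc l K \<Longrightarrow> 3 \<le> l"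
  by (auto simp: cyc_def cycle_map_def)

lemma cyc_card_Union: "cyc l K \<Longrightarrow> card (\<Union>K) = l" "cyc l K \<Longrightarrow> finite (\<Union>K)"
  unfolding cyc_def using cycle_map_card by (metis cycle_map_edges_Union)+

lemma cyc_finite: "cyc l K \<Longrightarrow> finite K"
  using cyc_card_Union(2) finite_UnionD by blast

lemma cyc_nonempty: "cyc l K \<Longrightarrow> K \<noteq> {}"
  by (auto simp: cyc_def)

lemma cyc_edge_card: "cyc l K \<Longrightarrow> e \<in> K \<Longrightarrow> card e = 2"
  unfolding cyc_def using cycle_map_succ(1) by fastforce

lemma cyc_card:
  assumes "cyc l K" shows "card K = l"
proof -
  obtain d where d: "cycle_map l d" and K: "K = range (\<lambda>i. {d i, d (i + 1)})"
    using assms by (auto simp: cyc_def)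
  have l: "l \<ge> 3" using assms cyc_length by blast
  let ?e = "\<lambda>i. {d i, d (i + 1)}"
  have "?e i \<in> ?e ` {0..<int l}" for i
  proof (rule image_eqI)
    have "d i = d (i mod int l)" "d (i + 1) = d (i mod int l + 1)" using d by (simp_all add: cycle_map_eq mod_add_left_eq)
    then show "?e i = ?e (i mod int l)" by simp
  qed (use l in auto)
  then have "K = ?e ` {0..<int l}" unfolding K by auto
  moreover have "inj_on ?e {0..<int l}"
  proof (rule inj_onI)
    fix i j assume ij: "i \<in> {0..<int l}" "j \<in> {0..<int l}" and e: "?e i = ?e j"
    show "i = j"
    proof (cases "d i = d j")
      case True then show ?thesis using ij d by (auto simp: cycle_map_eq)
    next
      \<comment> \<open>Equal edges traversed in opposite directions would give
        \<open>d (j + 2) = d j\<close>, impossible as \<open>l\<close> is at least 3.\<close>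
      case False
      then have "d i = d (j + 1)" "d (i + 1) = d j" using e by (auto simp: doubleton_eq_iff)
      then have "d (j + 1 + 1) = d j" using cycle_map_shift_eq[OF d, of i "j + 1" 1] by simp
      then have False using cycle_map_succ(3)[OF d, of "j + 1"] by simp
      then show ?thesis ..
    qed
  qed
  ultimately show ?thesis by (simp add: card_image)
qed

lemma cyc_image:
  assumes "cyc l K" "inj_on f (\<Union>K)"
  shows "cyc l ((`) f ` K)"
proof -
  obtain d where d: "cycle_map l d" and K: "K = range (\<lambda>i. {d i, d (i + 1)})"
    using assms by (auto simp: cyc_def)
  have "inj_on f (range d)" using assms(2) unfolding K cycle_map_edges_Union .
  then have "cycle_map l (f \<circ> d)" using d by (simp add: cycle_map_def inj_on_eq_iff)
  moreover have "(`) f ` K = range (\<lambda>i. {(f \<circ> d) i, (f \<circ> d) (i + 1)})"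
    unfolding K image_image by simp
  ultimately show ?thesis unfolding cyc_def by (intro exI[of _ "f \<circ> d"] conjI)
qed

lemma cycle_map_shift:
  assumes "cycle_map l d" shows "cycle_map l (\<lambda>i. d (i + k))"
    "range (\<lambda>i. {d (i + k), d (i + k + 1)}) = range (\<lambda>i. {d i, d (i + 1)})"
proof -
  have "(i + k) mod int l = (j + k) mod int l \<longleftrightarrow> i mod int l = j mod int l" for i j
    by (simp add: mod_eq_dvd_iff)
  then show "cycle_map l (\<lambda>i. d (i + k))" using assms by (simp add: cycle_map_def)
  show "range (\<lambda>i. {d (i + k), d (i + k + 1)}) = range (\<lambda>i. {d i, d (i + 1)})"
  proof (intro equalityI subsetI)
    fix e assume "e \<in> range (\<lambda>i. {d i, d (i + 1)})"
    then obtain i where "e = {d i, d (i + 1)}" by auto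
    then have "e = {d (i - k + k), d (i - k + k + 1)}" by simp
    then show "e \<in> range (\<lambda>i. {d (i + k), d (i + k + 1)})" by blast
  qed auto
qed

lemma cycle_map_reflect:
  assumes "cycle_map l d" shows "cycle_map l (\<lambda>i. d (- i))"
    "range (\<lambda>i. {d (- i), d (- (i + 1))}) = range (\<lambda>i. {d i, d (i + 1)})"
proof -
  have "(- i) mod int l = (- j) mod int l \<longleftrightarrow> i mod int l = j mod int l" for i j
    by (metis mod_minus_eq minus_minus)
  then show "cycle_map l (\<lambda>i. d (- i))" using assms by (simp add: cycle_map_def)
  show "range (\<lambda>i. {d (- i), d (- (i + 1))}) = range (\<lambda>i. {d i, d (i + 1)})"
  proof (intro equalityI subsetI)
    fix e assume "e \<in> range (\<lambda>i. {d i, d (i + 1)})"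
    then obtain i where "e = {d i, d (i + 1)}" by auto
    then have "e = {d (- (-i - 1)), d (- (-i - 1 + 1))}" by (simp add: insert_commute add.commute)
    then show "e \<in> range (\<lambda>i. {d (- i), d (- (i + 1))})" by blast
  next
    fix e assume "e \<in> range (\<lambda>i. {d (- i), d (- (i + 1))})"
    then obtain i where "e = {d (- i), d (- (i + 1))}" by auto
    moreover have "- (i + 1) = -i - 1" "-i = -i - 1 + 1" by simp_all
    ultimately have "e = {d (-i - 1), d (-i - 1 + 1)}" by (metis insert_commute)
    then show "e \<in> range (\<lambda>i. {d i, d (i + 1)})" by blast
  qed
qed

text \<open>Shifting and reflecting a parametrisation lets any edge come first, in either direction.
  \<open>triple_product\<close> uses this to number both Hamilton cycles from the sides of a bent
  square.\<close>

lemma cyc_start: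
  assumes "cyc l K" "{x, y} \<in> K"
  obtains d where "cycle_map l d" "K = range (\<lambda>i. {d i, d (i + 1)})" "d 0 = x" "d 1 = y"
proof -
  obtain d where d: "cycle_map l d" and K: "K = range (\<lambda>i. {d i, d (i + 1)})"
    using assms by (auto simp: cyc_def)
  then obtain i where i: "{x, y} = {d i, d (i + 1)}" using assms by auto
  then consider "x = d i" "y = d (i + 1)" | "x = d (i + 1)" "y = d i"
    by (auto simp: doubleton_eq_iff)
  then show ?thesis
  proof cases
    case 1
    show ?thesis
      by (rule that[of "\<lambda>k. d (k + i)"]) (use 1 cycle_map_shift[OF d, of i] K in \<open>auto simp: add_ac\<close>)
  next
    case 2
    let ?d = "\<lambda>k. d (- k)"
    let ?D = "\<lambda>k. ?d (k + (-i-1))"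
    have "cycle_map l ?D" "range (\<lambda>k. {?D k, ?D (k + 1)}) = K"
      using cycle_map_shift[OF cycle_map_reflect(1)[OF d], of "-i-1"] cycle_map_reflect(2)[OF d] K
      by (simp_all add: add_ac)
    moreover have "?D 0 = x" "?D 1 = y" using 2 by (simp_all add: add.commute)
    ultimately show ?thesis using that[of ?D] by blast
  qed
qed

text \<open>A connected finite graph in which all degrees are 2 is a cycle: a longest path closes up.\<close>

lemma cyc_intro:
  assumes fin: "finite V" and ne: "V \<noteq> {}"
    and inV: "\<And>u v. {u, v} \<in> K \<Longrightarrow> u \<in> V"
    and two: "\<And>e. e \<in> K \<Longrightarrow> \<exists>u v. e = {u, v}"
    and deg: "\<And>v. v \<in> V \<Longrightarrow> \<exists>x y. x \<noteq> y \<and> x \<noteq> v \<and> y \<noteq> v \<and> (\<forall>u. {v, u} \<in> K \<longleftrightarrow> u = x \<or> u = y)"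
    and conn: "\<And>u v. u \<in> V \<Longrightarrow> v \<in> V \<Longrightarrow> (\<lambda>a b. {a, b} \<in> K)\<^sup>*\<^sup>* u v"
  shows "cyc (card V) K" "\<Union>K = V"
proof -
  define path where "path vs \<longleftrightarrow> distinct vs \<and> set vs \<subseteq> V \<and> vs \<noteq> [] \<and>
    (\<forall>i. Suc i < length vs \<longrightarrow> {vs ! i, vs ! Suc i} \<in> K)" for vs
  obtain v0 where "v0 \<in> V" using ne by auto
  then have "path [v0]" by (auto simp: path_def)
  moreover have "\<forall>vs. path vs \<longrightarrow> length vs < Suc (card V)"
    unfolding path_def using fin by (metis card_mono distinct_card less_Suc_eq_le)
  ultimately obtain vs where vs: "path vs" and max: "\<And>ws. path ws \<Longrightarrow> length ws \<le> length vs"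
    using ex_has_greatest_nat[of path "[v0]" length "Suc (card V)"] by blast
  define n where "n = length vs"
  have n0: "n > 0" and dist: "distinct vs" and sub: "set vs \<subseteq> V"
    and step: "\<And>i. Suc i < n \<Longrightarrow> {vs ! i, vs ! Suc i} \<in> K"
    using vs by (auto simp: path_def n_def)
  have eq: "vs ! i = vs ! k \<longleftrightarrow> i = k" if "i < n" "k < n" for i k
    using that dist by (simp add: n_def nth_eq_iff_index_eq)
  have inset: "vs ! i \<in> V" if "i < n" for i using that sub by (auto simp: n_def)
  \<comment> \<open>Maximality: a neighbour of the last vertex outside the path would extend
    it.\<close>
  have ends: "z \<in> set vs" if "{vs ! (n - 1), z} \<in> K" for z
  proof (rule ccontr)
    assume z: "z \<notin> set vs"
    have "z \<in> V" using that inV by (metis insert_commute)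
    have "path (vs @ [z])" unfolding path_def
    proof (intro conjI allI impI)
      fix i assume "Suc i < length (vs @ [z])"
      then consider "Suc i < n" | "Suc i = n" by (auto simp: n_def less_Suc_eq)
      then show "{(vs @ [z]) ! i, (vs @ [z]) ! Suc i} \<in> K"
      proof cases
        case 2
        then have "i = n - 1" "(vs @ [z]) ! i = vs ! i" "(vs @ [z]) ! Suc i = z" by (auto simp: nth_append n_def)
        then show ?thesis using that by simp
      qed (use step in \<open>simp add: nth_append n_def\<close>)
    qed (use z \<open>z \<in> V\<close> dist sub in auto)
    then show False using max by fastforce
  qed
  have three: False if "v \<in> V" "{v, a} \<in> K" "{v, b} \<in> K" "{v, c} \<in> K" "a \<noteq> b" "a \<noteq> c" "b \<noteq> c" for v a b c
    using deg[OF that(1)] that by auto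
  have other: "\<exists>z. z \<noteq> w \<and> {v, z} \<in> K \<and> z \<noteq> v" if "v \<in> V" for v w using deg[OF that] by metis
  \<comment> \<open>A neighbour of the end vertex other than its predecessor. For
    \<open>n = 1\<close> truncated subtraction turns \<open>n - 2\<close> into \<open>n - 1\<close>,
    which is harmless because \<open>z\<close> differs from the end vertex anyway.\<close>
  obtain z where z: "z \<noteq> vs ! (n - 2)" "{vs ! (n - 1), z} \<in> K" "z \<noteq> vs ! (n - 1)"
    using other inset n0 by (metis diff_less zero_less_one)
  then obtain k where k: "k < n" "z = vs ! k" using ends by (metis in_set_conv_nth n_def)
  have "k \<noteq> n - 1" "k \<noteq> n - 2" using z k by auto
  then have kn: "k + 2 < n" using k by linarith
  \<comment> \<open>An inner vertex already has its two neighbours on the path and cannot have the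
    end vertex as a third one.\<close>
  have "k = 0"
  proof (rule ccontr)
    assume "k \<noteq> 0"
    show False
    proof (rule three[of "vs ! k" "vs ! (n - 1)" "vs ! Suc k" "vs ! (k - 1)"])
      show "{vs ! k, vs ! (n - 1)} \<in> K" using z k by (simp add: insert_commute)
      show "{vs ! k, vs ! Suc k} \<in> K" using step kn by simp
      show "{vs ! k, vs ! (k - 1)} \<in> K" using step[of "k - 1"] \<open>k \<noteq> 0\<close> k by (simp add: insert_commute)
    qed (use kn eq inset k \<open>k \<noteq> 0\<close> in auto)
  qed
  then have n3: "n \<ge> 3" and close: "{vs ! (n - 1), vs ! 0} \<in> K" using kn z k by auto
  define d where "d i = vs ! nat (i mod int n)" for i
  have d: "cycle_map n d"
    unfolding cycle_map_def d_def using n3 by (auto simp: eq nat_less_iff nat_eq_iff)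
  have dK: "{d i, d (i + 1)} \<in> K" for i
  proof (cases "i mod int n = int n - 1")
    case True
    then have "(i + 1) mod int n = 0" by (metis add_diff_cancel diff_add_cancel mod_add_left_eq mod_self)
    then show ?thesis using True close n0 by (simp add: d_def nat_diff_distrib)
  next
    case False
    then have lt: "i mod int n + 1 < int n" using n0 by (smt (verit) of_nat_0_less_iff pos_mod_bound)
    have ge: "0 \<le> i mod int n" using n0 by simp
    then have "(i + 1) mod int n = i mod int n + 1" using lt
      by (metis add_nonneg_nonneg mod_add_left_eq mod_pos_pos_trivial zero_le_one)
    then show ?thesis using step[of "nat (i mod int n)"] lt ge
      by (simp add: d_def nat_add_distrib)
  qed
  have dV: "d i \<in> V" for i using dK inV by blast
  have nb: "u = d (i + 1) \<or> u = d (i - 1)" if "{d i, u} \<in> K" for i u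
  proof (rule ccontr)
    assume *: "\<not> ?thesis"
    have "{d i, d (i + 1)} \<in> K" "{d i, d (i - 1)} \<in> K" using dK[of i] dK[of "i - 1"] by (auto simp: insert_commute)
    then show False using three[OF dV that, of "d (i + 1)" "d (i - 1)"] * cycle_map_succ[OF d] by metis
  qed
  \<comment> \<open>No edge leaves the closed path, since its vertices have used up their degree;
    connectedness makes it everything.\<close>
  have "v \<in> range d" if "v \<in> V" for v
  proof -
    have "(\<lambda>a b. {a, b} \<in> K)\<^sup>*\<^sup>* (d 0) v" using conn dV that by blast
    then show ?thesis
    proof induction
      case (step y z)
      then obtain i where "y = d i" by auto
      then show ?case using nb step by blast
    qed auto
  qed
  then have V: "V = range d" using dV by auto
  have K: "K = range (\<lambda>i. {d i, d (i + 1)})"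
  proof (intro equalityI subsetI)
    fix e assume e: "e \<in> K"
    then obtain u v where uv: "e = {u, v}" using two by blast
    then have "u \<in> V" using inV e by blast
    then obtain i where i: "u = d i" using V by auto
    then have "v = d (i + 1) \<or> v = d (i - 1)" using nb e uv by blast
    then show "e \<in> range (\<lambda>i. {d i, d (i + 1)})" using cycle_map_neighbours[OF d] uv i by blast
  qed (use dK in auto)
  show "\<Union>K = V" using K V by auto
  have "card V = n" using V cycle_map_card(1)[OF d] by simp
  then show "cyc (card V) K" using K d by (auto simp: cyc_def)
qed

lemma cyc_cycle_graph:
  assumes "cyc l K" shows "cycle_graph l (Graph (\<Union>K) K)"
proof -
  obtain d where d: "cycle_map l d" and K: "K = range (\<lambda>i. {d i, d (i + 1)})"
    using assms by (auto simp: cyc_def)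
  have l: "l \<ge> 3" using assms cyc_length by blast
  define vs where "vs = map (\<lambda>k. d (int k)) [0..<l]"
  have "distinct vs" unfolding vs_def distinct_map using d
    by (auto simp: inj_on_def cycle_map_eq)
  moreover have r: "d i = vs ! nat (i mod int l)" for i
    using l d by (simp add: vs_def nat_less_iff cycle_map_eq)
  have "\<Union>K = set vs"
  proof -
    have "\<Union>K = range d" unfolding K by (rule cycle_map_edges_Union)
    also have "\<dots> = d ` {0..<int l}" using d by (rule cycle_map_range(1))
    also have "\<dots> = d ` int ` {0..<l}" by (simp add: image_int_atLeastLessThan)
    finally show ?thesis by (simp add: vs_def image_image)
  qed
  moreover have "K = {{vs ! m, vs ! (Suc m mod length vs)} | m. m < length vs}"
  proof (intro equalityI subsetI)
    fix e assume "e \<in> K"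
    then obtain i where i: "e = {d i, d (i + 1)}" using K by auto
    let ?m = "nat (i mod int l)"
    have m: "?m < l" using l by (simp add: nat_less_iff)
    have "int (Suc ?m mod l) = (i + 1) mod int l" using l
      by (simp add: zmod_int mod_add_left_eq add.commute mod_add_right_eq)
    then have "nat ((i + 1) mod int l) = Suc ?m mod l" by (metis nat_int)
    moreover have "length vs = l" by (simp add: vs_def)
    ultimately have "e = {vs ! ?m, vs ! (Suc ?m mod length vs)}" using i r[of i] r[of "i + 1"] by simp
    moreover have "?m < length vs" using m by (simp add: vs_def)
    ultimately show "e \<in> {{vs ! m, vs ! (Suc m mod length vs)} | m. m < length vs}" by blast
  next
    fix e assume "e \<in> {{vs ! m, vs ! (Suc m mod length vs)} | m. m < length vs}"
    then obtain m where m: "m < l" "e = {vs ! m, vs ! (Suc m mod l)}" by (auto simp: vs_def)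
    have "vs ! m = d (int m)" using m by (simp add: vs_def)
    moreover have "vs ! (Suc m mod l) = d (int m + 1)" using m l d
      by (simp add: vs_def cycle_map_eq zmod_int add.commute)
    ultimately show "e \<in> K" using m K by auto
  qed
  moreover have "length vs = l" by (simp add: vs_def)
  ultimately show ?thesis using l unfolding cycle_graph_def by (intro conjI exI[of _ vs]) simp_all
qed

section \<open>Edge sets of Cartesian products\<close>

definition prod_edges :: "'a set \<Rightarrow> 'a set set \<Rightarrow> 'b set \<Rightarrow> 'b set set \<Rightarrow> ('a \<times> 'b) set set" where
  "prod_edges V E W F = {e \<times> {w} | e w. e \<in> E \<and> w \<in> W} \<union> {{v} \<times> f | v f. v \<in> V \<and> f \<in> F}"

lemma prod_edges_Union:
  "prod_edges V (\<Union>i\<in>I. E i) W (\<Union>i\<in>I. F i) = (\<Union>i\<in>I. prod_edges V (E i) W (F i))"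
  unfolding prod_edges_def by blast

lemma prod_edges_Un: "prod_edges V (E \<union> E') W (F \<union> F') = prod_edges V E W F \<union> prod_edges V E' W F'"
  unfolding prod_edges_def by blast

text \<open>Horizontal and vertical edges differ in their first projection: two points against at
  most one.\<close>

lemma times_edge_neq:
  assumes "card e = 2" shows "e \<times> {w} \<noteq> {v} \<times> f"
proof
  assume *: "e \<times> {w} = {v} \<times> f"
  have "fst ` (e \<times> {w}) = e" "fst ` ({v} \<times> f) \<subseteq> {v}" by force+
  then have "card e \<le> card {v}" unfolding * by (intro card_mono) auto
  then show False using assms by simp
qed

lemma prod_edges_disjoint:
  assumes "E \<inter> E' = {}" "F \<inter> F' = {}"
    and E: "\<And>e. e \<in> E \<union> E' \<Longrightarrow> card e = 2" and F: "\<And>f. f \<in> F \<union> F' \<Longrightarrow> card f = 2"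
  shows "prod_edges V E W F \<inter> prod_edges V' E' W' F' = {}"
proof (rule ccontr)
  assume "prod_edges V E W F \<inter> prod_edges V' E' W' F' \<noteq> {}"
  then obtain x where x: "x \<in> prod_edges V E W F" "x \<in> prod_edges V' E' W' F'" by blast
  from x show False unfolding prod_edges_def
  proof (elim UnE CollectE exE conjE)
    fix e w e' w' assume e: "x = e \<times> {w}" "e \<in> E" "x = e' \<times> {w'}" "e' \<in> E'"
    then have "e \<noteq> {}" using E[of e] by auto
    then have "e = e'" using e by (auto simp: times_eq_iff)
    then show False using e assms(1) by blast
  next
    fix v f v' f' assume e: "x = {v} \<times> f" "f \<in> F" "x = {v'} \<times> f'" "f' \<in> F'"
    then have "f = f'" by (auto simp: times_eq_iff)
    then show False using e assms(2) by blast
  next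
    fix e w v f assume e: "x = e \<times> {w}" "e \<in> E" "x = {v} \<times> f"
    then show False using times_edge_neq[of e w v f] E[of e] by simp
  next
    fix e w v f assume e: "x = e \<times> {w}" "e \<in> E'" "x = {v} \<times> f"
    then show False using times_edge_neq[of e w v f] E[of e] by simp
  qed
qed

lemma card_prod_edges:
  assumes "finite V" "finite W" "finite E" "finite F" "\<And>e. e \<in> E \<Longrightarrow> card e = 2" "\<And>f. f \<in> F \<Longrightarrow> card f = 2"
  shows "card (prod_edges V E W F) = card E * card W + card V * card F"
proof -
  have 1: "prod_edges V E W F = prod_edges V E W {} \<union> prod_edges V {} W F" unfolding prod_edges_def by blast
  have d: "prod_edges V E W {} \<inter> prod_edges V {} W F = {}"
    by (rule prod_edges_disjoint) (use assms in auto)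
  have e: "prod_edges V E W {} = (\<lambda>(e, w). e \<times> {w}) ` (E \<times> W)" unfolding prod_edges_def by auto
  have f: "prod_edges V {} W F = (\<lambda>(v, f). {v} \<times> f) ` (V \<times> F)" unfolding prod_edges_def by auto
  have ie: "inj_on (\<lambda>(e, w). e \<times> {w}) (E \<times> W)"
  proof (rule inj_onI, clarify)
    fix e w e' w' assume "e \<in> E" "e \<times> {w} = e' \<times> {w'}"
    moreover have "e \<noteq> {}" using assms(5)[OF \<open>e \<in> E\<close>] by auto
    ultimately show "e = e' \<and> w = w'" by (auto simp: times_eq_iff)
  qed
  have if': "inj_on (\<lambda>(v, f). {v} \<times> f) (V \<times> F)"
  proof (rule inj_onI, clarify)
    fix v f v' f' assume "f \<in> F" "{v} \<times> f = {v'} \<times> f'"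
    moreover have "f \<noteq> {}" using assms(6)[OF \<open>f \<in> F\<close>] by auto
    ultimately show "v = v' \<and> f = f'" by (auto simp: times_eq_iff)
  qed
  have "card (prod_edges V E W {}) = card E * card W" unfolding e using ie by (simp add: card_image card_cartesian_product)
  moreover have "card (prod_edges V {} W F) = card V * card F" unfolding f using if' by (simp add: card_image card_cartesian_product)
  moreover have "finite (prod_edges V E W {})" "finite (prod_edges V {} W F)" unfolding e f using assms by auto
  ultimately show ?thesis using 1 d by (simp add: card_Un_disjoint)
qed

lemma prod_edges_subset:
  assumes "e \<in> prod_edges V E W F" "\<And>e. e \<in> E \<Longrightarrow> e \<subseteq> V" "\<And>f. f \<in> F \<Longrightarrow> f \<subseteq> W"
  shows "e \<subseteq> V \<times> W"
  using assms unfolding prod_edges_def by blast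

lemma image_edges_inj:
  assumes "inj_on f X" "\<And>e. e \<in> A \<Longrightarrow> e \<subseteq> X"
  shows "inj_on ((`) f) A"
  using assms by (meson inj_onI inj_on_image_eq_iff)

lemma prod_edges_mono:
  assumes "V \<subseteq> V'" "E \<subseteq> E'" "W \<subseteq> W'" "F \<subseteq> F'"
  shows "prod_edges V E W F \<subseteq> prod_edges V' E' W' F'"
  unfolding prod_edges_def
proof (rule Un_mono)
  show "{e \<times> {w} | e w. e \<in> E \<and> w \<in> W} \<subseteq> {e \<times> {w} | e w. e \<in> E' \<and> w \<in> W'}" using assms(2,3) by blast
  show "{{v} \<times> f | v f. v \<in> V \<and> f \<in> F} \<subseteq> {{v} \<times> f | v f. v \<in> V' \<and> f \<in> F'}" using assms(1,4) by blast
qed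

section \<open>Winding cycles on a torus\<close>

text \<open>Counts the rows in which a winding cycle meets a column, and later the colour classes of
  a numbering taken modulo \<open>s\<close>.\<close>

lemma card_residue_class:
  fixes r :: int
  assumes "s > 0" "s dvd b"
  shows "card {w \<in> {0..<int b}. int s dvd w - r} = b div s"
proof -
  obtain n where n: "b = s * n" using assms by auto
  have "{w \<in> {0..<int b}. int s dvd w - r} = (\<lambda>k. r mod int s + int s * int k) ` {..<n}" (is "?A = ?B")
  proof (intro equalityI subsetI)
    fix w assume w: "w \<in> ?A"
    then have eq: "w mod int s = r mod int s" by (simp add: mod_eq_dvd_iff)
    have "w div int s < int n"
    proof (rule ccontr)
      assume "\<not> w div int s < int n"
      then have "int s * int n \<le> int s * (w div int s)" by (simp add: mult_left_mono)
      also have "\<dots> \<le> w" using assms minus_mod_eq_mult_div[of w "int s"] pos_mod_sign[of "int s" w] by linarith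
      finally show False using w n by simp
    qed
    moreover have "w div int s \<ge> 0" using w assms by (simp add: pos_imp_zdiv_nonneg_iff)
    ultimately have "nat (w div int s) < n" "int (nat (w div int s)) = w div int s" by auto
    moreover have "w = r mod int s + int s * (w div int s)" using eq by (metis mod_mult_div_eq)
    ultimately show "w \<in> ?B" by (metis (mono_tags, lifting) image_eqI lessThan_iff)
  next
    fix w assume "w \<in> ?B"
    then obtain k where k: "k < n" "w = r mod int s + int s * int k" by auto
    have "int s * int k + int s \<le> int s * int n" using k(1)
      by (metis Suc_leI mult_Suc_right mult_le_mono2 add.commute of_nat_add of_nat_le_iff of_nat_mult)
    moreover have "0 \<le> r mod int s" "r mod int s < int s" using assms by simp_all
    moreover have "0 \<le> int s * int k" by simp
    ultimately have "0 \<le> w" "w < int b" unfolding k(2) n by (simp_all del: zero_le_mult_iff)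
    moreover have "int s dvd w - r" unfolding k(2) by (simp add: mod_eq_dvd_iff[symmetric])
    ultimately show "w \<in> ?A" by simp
  qed
  moreover have "inj_on (\<lambda>k. r mod int s + int s * int k) {..<n}" using assms by (auto simp: inj_on_def)
  ultimately show ?thesis using n assms by (simp add: card_image)
qed

text \<open>\<open>E\<close> is the height along the cycle \<open>d\<close>. The cycle \<open>K c\<close> uses the horizontal edge from \<open>d i\<close> in the rows congruent to
\<open>c + E i\<close>, and at a vertex where the height changes the vertical edges between the two rows concerned.\<close>

locale twist =
  fixes m b s :: nat and d :: "int \<Rightarrow> 'a" and g :: "int \<Rightarrow> 'b" and E :: "int \<Rightarrow> int"
  assumes d: "cycle_map m d" and g: "cycle_map b g" and s: "s \<ge> 2" "s dvd b"
    and period: "\<And>i. E (i + int m) = E i + int s"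
    and steps: "\<And>i. E i - E (i - 1) \<in> {-1, 0, 1}"
begin

definition turns :: "'a set" where
  "turns = {d i | i. E i \<noteq> E (i - 1)}"

definition hor :: "int \<Rightarrow> ('a \<times> 'b) set set" where
  "hor c = {{(d i, g w), (d (i + 1), g w)} | i w. int s dvd w - c - E i}"

text \<open>The two heights at a turn differ by one, so \<open>min\<close> is the lower row, from
  which the edge goes up.\<close>

definition ver :: "int \<Rightarrow> ('a \<times> 'b) set set" where
  "ver c = {{(d i, g w), (d i, g (w + 1))} | i w. E i \<noteq> E (i - 1) \<and> int s dvd w - c - min (E (i - 1)) (E i)}"

definition K :: "int \<Rightarrow> ('a \<times> 'b) set set" where
  "K c = hor c \<union> ver c"

definition V :: "int \<Rightarrow> ('a \<times> 'b) set" where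
  "V c = {(d i, g w) | i w. int s dvd w - c - E i \<or> int s dvd w - c - E (i - 1)}"

lemma period_mult: "E (i + k * int m) = E i + k * int s"
proof -
  have *: "E (i + int n * int m) = E i + int n * int s" for i n
  proof (induction n)
    case (Suc n)
    have "i + int (Suc n) * int m = i + int n * int m + int m" by (simp add: algebra_simps)
    then show ?case using period[of "i + int n * int m"] Suc by (simp add: algebra_simps)
  qed simp
  show ?thesis
  proof (cases "k \<ge> 0")
    case True then show ?thesis using *[of i "nat k"] by simp
  next
    case False then show ?thesis using *[of "i + k * int m" "nat (- k)"] by (simp add: algebra_simps)
  qed
qed

lemma d_eqE:
  assumes "d i = d j"
  obtains k where "i = j + k * int m" "E i = E j + k * int s" "E (i - 1) = E (j - 1) + k * int s"
proof -
  have "int m dvd i - j" using assms d by (simp add: cycle_map_eq mod_eq_dvd_iff)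
  then obtain k where "i = j + k * int m" by (metis dvd_def diff_eq_eq mult.commute add.commute)
  moreover from this have "i - 1 = j - 1 + k * int m" by simp
  ultimately show ?thesis using that period_mult by metis
qed

lemma g_eq_dvd: "g w = g w' \<Longrightarrow> int s dvd w - w'"
  using s(2) cycle_map_eq[OF g] by (metis dvd_trans mod_eq_dvd_iff of_nat_dvd_iff)

lemma dvd_cong:
  assumes "int s dvd x - y" shows "int s dvd x \<longleftrightarrow> int s dvd y"
  using dvd_diff_right_iff[of "int s" x "x - y"] dvd_add_left_iff[of "int s" "x - y" y] assms by simp

text \<open>The heights are not periodic, but a round along \<open>d\<close> changes them by
  \<open>s\<close>, and a round along \<open>g\<close> changes the row by \<open>b\<close>, a
  multiple of \<open>s\<close>. Both are invisible modulo \<open>s\<close>, so the conditions in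
  \<open>hor\<close>, \<open>ver\<close> and \<open>V\<close> depend on the vertices only and not on
  the chosen parameters.\<close>

lemma label_cong:
  assumes "d i = d j" "g w = g w'"
  shows "int s dvd w - c - E i \<longleftrightarrow> int s dvd w' - c - E j"
    "int s dvd w - c - E (i - 1) \<longleftrightarrow> int s dvd w' - c - E (j - 1)"
    "int s dvd w - c - min (E (i - 1)) (E i) \<longleftrightarrow> int s dvd w' - c - min (E (j - 1)) (E j)"
    "E i \<noteq> E (i - 1) \<longleftrightarrow> E j \<noteq> E (j - 1)"
proof -
  obtain k where k: "E i = E j + k * int s" "E (i - 1) = E (j - 1) + k * int s"
    using d_eqE[OF assms(1)] by metis
  have w: "int s dvd w - w'" using g_eq_dvd assms(2) by blast
  show "E i \<noteq> E (i - 1) \<longleftrightarrow> E j \<noteq> E (j - 1)" using k by simp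
  have *: "int s dvd w - c - (x + k * int s) \<longleftrightarrow> int s dvd w' - c - x" for x
  proof (rule dvd_cong)
    have "w - c - (x + k * int s) - (w' - c - x) = (w - w') - k * int s" by simp
    then show "int s dvd w - c - (x + k * int s) - (w' - c - x)" using w by (metis dvd_diff dvd_triv_right)
  qed
  have "min (E (i - 1)) (E i) = min (E (j - 1)) (E j) + k * int s" unfolding k by (simp add: min_def)
  then show "int s dvd w - c - E i \<longleftrightarrow> int s dvd w' - c - E j"
    "int s dvd w - c - E (i - 1) \<longleftrightarrow> int s dvd w' - c - E (j - 1)"
    "int s dvd w - c - min (E (i - 1)) (E i) \<longleftrightarrow> int s dvd w' - c - min (E (j - 1)) (E j)"
    using * k by metis+
qed

text \<open>Degrees, connectivity and disjointness are all read off from this list. The left and the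
  lower edge are parametrised by their other end, which explains \<open>E (i - 1)\<close> and
  \<open>w - 1\<close> there.\<close>

lemma K_neighbours:
  "{(d i, g w), u} \<in> K c \<longleftrightarrow>
     u = (d (i + 1), g w) \<and> int s dvd w - c - E i \<or>
     u = (d (i - 1), g w) \<and> int s dvd w - c - E (i - 1) \<or>
     E i \<noteq> E (i - 1) \<and> (u = (d i, g (w + 1)) \<and> int s dvd w - c - min (E (i - 1)) (E i) \<or>
       u = (d i, g (w - 1)) \<and> int s dvd w - 1 - c - min (E (i - 1)) (E i))" (is "?L \<longleftrightarrow> ?R")
proof
  assume ?L
  then consider "{(d i, g w), u} \<in> hor c" | "{(d i, g w), u} \<in> ver c" by (auto simp: K_def)
  then show ?R
  proof cases
    case 1
    then obtain j v where e: "{(d i, g w), u} = {(d j, g v), (d (j + 1), g v)}"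
      and dv: "int s dvd v - c - E j" by (auto simp: hor_def)
    then consider "d i = d j" "g w = g v" "u = (d (j + 1), g v)" | "d i = d (j + 1)" "g w = g v" "u = (d j, g v)"
      by (auto simp: doubleton_eq_iff)
    then show ?R
    proof cases
      case 1
      then have "d (i + 1) = d (j + 1)" using cycle_map_shift_eq[OF d] by blast
      then show ?thesis using 1 dv label_cong(1) by metis
    next
      case 2
      then have "d (i - 1) = d j" using cycle_map_shift_eq[OF d, of i "j + 1" "-1"] by simp
      then show ?thesis using 2 dv label_cong(1)[of "i - 1" j w v c] by simp
    qed
  next
    case 2
    then obtain j v where e: "{(d i, g w), u} = {(d j, g v), (d j, g (v + 1))}"
      and ne: "E j \<noteq> E (j - 1)" and dv: "int s dvd v - c - min (E (j - 1)) (E j)" by (auto simp: ver_def)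
    then consider "d i = d j" "g w = g v" "u = (d j, g (v + 1))" | "d i = d j" "g w = g (v + 1)" "u = (d j, g v)"
      by (auto simp: doubleton_eq_iff)
    then show ?R
    proof cases
      case 1
      then have "g (w + 1) = g (v + 1)" using cycle_map_shift_eq[OF g] by blast
      then show ?thesis using 1 dv ne label_cong(3)[of i j w v c] label_cong(4)[of i j w v] by simp
    next
      case 2
      then have "g (w - 1) = g v" using cycle_map_shift_eq[OF g, of w "v + 1" "-1"] by simp
      then show ?thesis using 2 dv ne label_cong(3)[of i j "w - 1" v c] label_cong(4)[of i j w "v + 1"] by simp
    qed
  qed
next
  have h: "{(d i, g w), (d (i + 1), g w)} \<in> K c" if "int s dvd w - c - E i" for i w
    using that by (auto simp: K_def hor_def)
  have v: "{(d i, g w), (d i, g (w + 1))} \<in> K c" if "E i \<noteq> E (i - 1)" "int s dvd w - c - min (E (i - 1)) (E i)" for i w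
    using that by (auto simp: K_def ver_def)
  assume ?R
  then show ?L using h[of w i] h[of w "i - 1"] v[of i w] v[of i "w - 1"] by (auto simp: insert_commute)
qed

lemma V_iff: "(d i, g w) \<in> V c \<longleftrightarrow> int s dvd w - c - E i \<or> int s dvd w - c - E (i - 1)"
proof
  assume "(d i, g w) \<in> V c"
  then obtain j v where "d i = d j" "g w = g v" "int s dvd v - c - E j \<or> int s dvd v - c - E (j - 1)"
    by (auto simp: V_def)
  then show "int s dvd w - c - E i \<or> int s dvd w - c - E (i - 1)" using label_cong by metis
qed (auto simp: V_def)

text \<open>Consecutive rows lie in different classes because \<open>s\<close> is at least 2. Hence
  at a turn a vertex of the cycle is either on the arriving or on the leaving row, never on
  both.\<close>

lemma not_both:
  assumes "E i \<noteq> E (i - 1)" shows "\<not> (int s dvd w - c - E i \<and> int s dvd w - c - E (i - 1))"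
proof
  assume "int s dvd w - c - E i \<and> int s dvd w - c - E (i - 1)"
  then have "int s dvd (w - c - E (i - 1)) - (w - c - E i)" by (metis dvd_diff)
  then have "int s dvd E i - E (i - 1)" by simp
  moreover have "E i - E (i - 1) = 1 \<or> E i - E (i - 1) = -1" using steps[of i] assms by auto
  ultimately have "int s dvd 1" by (metis dvd_minus_iff)
  then show False using s by simp
qed

lemma V_finite: "finite (V c)"
proof (rule finite_subset)
  show "V c \<subseteq> range d \<times> range g" by (auto simp: V_def)
qed (rule finite_cartesian_product[OF cycle_map_card(2)[OF d] cycle_map_card(2)[OF g]])

lemma V_nonempty: "V c \<noteq> {}"
proof -
  have "(d 0, g (c + E 0)) \<in> V c" by (simp add: V_iff)
  then show ?thesis by blast
qed

abbreviation adj :: "int \<Rightarrow> 'a \<times> 'b \<Rightarrow> 'a \<times> 'b \<Rightarrow> bool" where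
  "adj c \<equiv> \<lambda>u v. {u, v} \<in> K c"

lemma adj_sym: "(adj c)\<^sup>*\<^sup>* u v \<Longrightarrow> (adj c)\<^sup>*\<^sup>* v u"
  by (rule sympD[OF symp_rtranclp]) (simp add: symp_def insert_commute)

lemma spine_step: "(adj c)\<^sup>*\<^sup>* (d i, g (c + E i)) (d (i + 1), g (c + E (i + 1)))"
proof -
  let ?v = "(d (i + 1), g (c + E i))"
  have 1: "adj c (d i, g (c + E i)) ?v" by (simp add: K_neighbours)
  have 2: "(adj c)\<^sup>*\<^sup>* ?v (d (i + 1), g (c + E (i + 1)))"
  proof (cases "E (i + 1) = E i")
    case False
    then consider "E (i + 1) = E i + 1" | "E (i + 1) = E i - 1" using steps[of "i + 1"] by auto
    then have "adj c ?v (d (i + 1), g (c + E (i + 1)))"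
    proof cases
      case 1
      then have "c + E (i + 1) = c + E i + 1" by simp
      then have "g (c + E (i + 1)) = g (c + E i + 1)" by (rule arg_cong)
      then show ?thesis using 1 K_neighbours[of "i + 1" "c + E i" "(d (i + 1), g (c + E i + 1))" c] by simp
    next
      case 2
      then have "c + E (i + 1) = c + E i - 1" by simp
      then have "g (c + E (i + 1)) = g (c + E i - 1)" by (rule arg_cong)
      then show ?thesis using 2 K_neighbours[of "i + 1" "c + E i" "(d (i + 1), g (c + E i - 1))" c] by simp
    qed
    then show ?thesis by blast
  qed simp
  show ?thesis using converse_rtranclp_into_rtranclp[of "adj c", OF 1 2] .
qed

lemma spine: "(adj c)\<^sup>*\<^sup>* (d i, g (c + E i)) (d j, g (c + E j))"
proof -
  have *: "(adj c)\<^sup>*\<^sup>* (d i, g (c + E i)) (d (i + int n), g (c + E (i + int n)))" for i n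
  proof (induction n)
    case (Suc n)
    moreover have "i + int (Suc n) = i + int n + 1" by simp
    ultimately show ?case using spine_step[of c "i + int n"] by (metis (no_types, lifting) rtranclp_trans)
  qed simp
  show ?thesis
  proof (cases "i \<le> j")
    case True then show ?thesis using *[of i "nat (j - i)"] by simp
  next
    case False then show ?thesis using *[of j "nat (i - j)"] adj_sym by simp
  qed
qed

text \<open>Walking along \<open>d\<close> at the prescribed heights, \<open>k\<close> rounds climb
  by \<open>k * s\<close>, so in every column the walk meets all rows of the class on which it
  leaves. A vertex on an arriving row only is one horizontal edge away from the walk.\<close>

lemma V_connected:
  assumes "u \<in> V c" shows "(adj c)\<^sup>*\<^sup>* (d 0, g (c + E 0)) u"
proof -
  obtain i w where u: "u = (d i, g w)" and iw: "int s dvd w - c - E i \<or> int s dvd w - c - E (i - 1)"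
    using assms by (auto simp: V_def)
  have *: "(adj c)\<^sup>*\<^sup>* (d 0, g (c + E 0)) (d i, g w)" if dv: "int s dvd w - c - E i" for i
  proof -
    obtain k where k: "w - c - E i = int s * k" using dv unfolding dvd_def by blast
    have "c + E (i + k * int m) = w" using k by (simp add: period_mult algebra_simps)
    moreover have "d (i + k * int m) = d i" using d by (rule cycle_map_period)
    ultimately show ?thesis using spine[of c 0 "i + k * int m"] by simp
  qed
  show ?thesis
  proof (cases "int s dvd w - c - E i")
    case True
    then show ?thesis unfolding u by (rule *)
  next
    case False
    then have f: "int s dvd w - c - E (i - 1)" using iw by blast
    have "adj c (d (i - 1), g w) (d i, g w)" using f K_neighbours[of "i - 1" w "(d i, g w)" c] by simp
    then show ?thesis unfolding u by (rule rtranclp.rtrancl_into_rtrancl[OF *[OF f]])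
  qed
qed

text \<open>All degrees are two: away from the turns the arriving and the leaving row coincide and
  contribute two horizontal edges; at a turn they are different rows, and a vertex has one
  horizontal edge and the vertical edge that leads to the other row.\<close>

lemma cyc_K: "cyc (card (V c)) (K c)" "\<Union>(K c) = V c"
proof -
  have a: "u \<in> V c" if e: "{u, v} \<in> K c" for u v
  proof -
    have "fst u \<in> range d" "snd u \<in> range g" using e by (auto simp: K_def hor_def ver_def doubleton_eq_iff)
    then obtain i w where u: "u = (d i, g w)" by (metis imageE prod.collapse)
    consider (0) "E i = E (i - 1)" | (up) "E i = E (i - 1) + 1" | (down) "E i = E (i - 1) - 1"
      using steps[of i] by auto
    then have "int s dvd w - c - E i \<or> int s dvd w - c - E (i - 1)"
    proof cases
      case up
      have eq: "w - 1 - c - E (i - 1) = w - c - E i" "min (E (i - 1)) (E i) = E (i - 1)" using up by auto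
      show ?thesis using e unfolding u K_neighbours eq by auto
    next
      case down
      have eq: "w - 1 - c - E i = w - c - E (i - 1)" "min (E (i - 1)) (E i) = E i" using down by auto
      show ?thesis using e unfolding u K_neighbours eq by auto
    qed (use e in \<open>auto simp: u K_neighbours\<close>)
    then show ?thesis using u V_iff by blast
  qed
  have b: "\<exists>x y. x \<noteq> y \<and> x \<noteq> v \<and> y \<noteq> v \<and> (\<forall>u. {v, u} \<in> K c \<longleftrightarrow> u = x \<or> u = y)" if "v \<in> V c" for v
  proof -
    obtain i w where v: "v = (d i, g w)" and iw: "int s dvd w - c - E i \<or> int s dvd w - c - E (i - 1)"
      using \<open>v \<in> V c\<close> by (auto simp: V_def)
    have ds: "d i \<noteq> d (i + 1)" "d (i - 1) \<noteq> d i" "d (i - 1) \<noteq> d (i + 1)" using cycle_map_succ[OF d] by blast+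
    have gs: "g w \<noteq> g (w + 1)" "g (w - 1) \<noteq> g w" "g (w - 1) \<noteq> g (w + 1)" using cycle_map_succ[OF g] by blast+
    consider (0) "E i = E (i - 1)" | (up) "E i = E (i - 1) + 1" | (down) "E i = E (i - 1) - 1"
      using steps[of i] by auto
    then show ?thesis
    proof cases
      case 0
      then show ?thesis using ds iw unfolding v K_neighbours
        by (intro exI[of _ "(d (i + 1), g w)"] exI[of _ "(d (i - 1), g w)"]) auto
    next
      case up
      have eq: "w - 1 - c - E (i - 1) = w - c - E i" "min (E (i - 1)) (E i) = E (i - 1)" using up by auto
      show ?thesis
      proof (cases "int s dvd w - c - E i")
        case True
        then have "\<not> int s dvd w - c - E (i - 1)" using not_both[of i w c] up by auto
        then show ?thesis using True ds gs up unfolding v K_neighbours eq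
          by (intro exI[of _ "(d (i + 1), g w)"] exI[of _ "(d i, g (w - 1))"]) auto
      next
        case False
        then show ?thesis using iw ds gs up unfolding v K_neighbours eq
          by (intro exI[of _ "(d (i - 1), g w)"] exI[of _ "(d i, g (w + 1))"]) auto
      qed
    next
      case down
      have eq: "w - 1 - c - E i = w - c - E (i - 1)" "min (E (i - 1)) (E i) = E i" using down by auto
      show ?thesis
      proof (cases "int s dvd w - c - E i")
        case True
        then have "\<not> int s dvd w - c - E (i - 1)" using not_both[of i w c] down by auto
        then show ?thesis using True ds gs down unfolding v K_neighbours eq
          by (intro exI[of _ "(d (i + 1), g w)"] exI[of _ "(d i, g (w + 1))"]) auto
      next
        case False
        then show ?thesis using iw ds gs down unfolding v K_neighbours eq
          by (intro exI[of _ "(d (i - 1), g w)"] exI[of _ "(d i, g (w - 1))"]) auto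
      qed
    qed
  qed
  have c: "\<exists>u v. e = {u, v}" if "e \<in> K c" for e using that by (auto simp: K_def hor_def ver_def)
  have d: "(adj c)\<^sup>*\<^sup>* u v" if uv: "u \<in> V c" "v \<in> V c" for u v
    by (rule rtranclp_trans[OF adj_sym[OF V_connected[OF uv(1)]] V_connected[OF uv(2)]])
  show "cyc (card (V c)) (K c)" "\<Union>(K c) = V c"
    by (rule cyc_intro[of "V c" "K c", OF V_finite V_nonempty a c b d]; assumption)+
qed

lemma class_unique:
  fixes c c' :: nat
  assumes "int s dvd z - int c - x" "int s dvd z - int c' - x" "c < s" "c' < s"
  shows "c = c'"
proof -
  have "int s dvd (z - int c' - x) - (z - int c - x)" using assms by (metis dvd_diff)
  then have "int c mod int s = int c' mod int s" by (simp add: mod_eq_dvd_iff)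
  then show ?thesis using assms by simp
qed

lemma class_exists: "\<exists>c<s. int s dvd z - int c - x"
proof (intro exI[of _ "nat ((z - x) mod int s)"] conjI)
  show "nat ((z - x) mod int s) < s" using s by (simp add: nat_less_iff)
  have "int (nat ((z - x) mod int s)) = (z - x) mod int s" using s by simp
  then have "z - int (nat ((z - x) mod int s)) - x = (z - x) - (z - x) mod int s" by simp
  then show "int s dvd z - int (nat ((z - x) mod int s)) - x" by (metis dvd_minus_mod)
qed

lemma K_disjoint:
  assumes "c < s" "c' < s" "c \<noteq> c'" shows "K (int c) \<inter> K (int c') = {}"
proof (rule ccontr)
  assume "K (int c) \<inter> K (int c') \<noteq> {}"
  then obtain e where e: "e \<in> K (int c)" "e \<in> K (int c')" by auto
  obtain i w u where u: "e = {(d i, g w), u}" using e(1) by (auto simp: K_def hor_def ver_def)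
  have ds: "d i \<noteq> d (i + 1)" "d (i - 1) \<noteq> d i" "d (i - 1) \<noteq> d (i + 1)" using cycle_map_succ[OF d] by blast+
  have gs: "g w \<noteq> g (w + 1)" "g (w - 1) \<noteq> g w" "g (w - 1) \<noteq> g (w + 1)" using cycle_map_succ[OF g] by blast+
  show False using e ds gs assms class_unique[of _ c _ c'] unfolding u K_neighbours by auto
qed

lemma K_Union: "(\<Union>c<s. K (int c)) = {e \<times> {w} | e w. e \<in> range (\<lambda>i. {d i, d (i + 1)}) \<and> w \<in> range g}
    \<union> {{v} \<times> f | v f. v \<in> turns \<and> f \<in> range (\<lambda>i. {g i, g (i + 1)})}" (is "?L = ?R")
proof (intro equalityI subsetI)
  fix e assume "e \<in> ?L"
  then obtain c where "e \<in> hor (int c) \<or> e \<in> ver (int c)" by (auto simp: K_def)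
  then show "e \<in> ?R"
  proof
    assume "e \<in> hor (int c)"
    then obtain i w where "e = {d i, d (i + 1)} \<times> {g w}" by (auto simp: hor_def)
    then show ?thesis by (intro UnI1 CollectI exI conjI) (assumption, auto)
  next
    assume "e \<in> ver (int c)"
    then obtain i w where "e = {d i} \<times> {g w, g (w + 1)}" "d i \<in> turns" by (auto simp: ver_def turns_def)
    then show ?thesis by (intro UnI2 CollectI exI conjI) (assumption, auto)
  qed
next
  fix e assume e: "e \<in> ?R"
  have "(\<exists>i w. e = {d i, d (i + 1)} \<times> {g w}) \<or> (\<exists>i w. e = {d i} \<times> {g w, g (w + 1)} \<and> E i \<noteq> E (i - 1))"
    using e
  proof (elim UnE CollectE exE conjE rangeE)
    fix v f i w assume "v \<in> turns" "e = {v} \<times> f" "f = {g w, g (w + 1)}"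
    then show ?thesis unfolding turns_def by blast
  qed blast
  then consider (1) i w where "e = {d i, d (i + 1)} \<times> {g w}"
    | (2) i w where "e = {d i} \<times> {g w, g (w + 1)}" "E i \<noteq> E (i - 1)"
    by metis
  then show "e \<in> ?L"
  proof cases
    case 1
    obtain c where "c < s" "int s dvd w - int c - E i" using class_exists by blast
    then have "c < s \<and> e \<in> hor (int c)" using 1 unfolding hor_def by auto
    then show ?thesis unfolding K_def by blast
  next
    case 2
    obtain c where "c < s" "int s dvd w - int c - min (E (i - 1)) (E i)" using class_exists by blast
    then have "c < s \<and> e \<in> ver (int c)" using 2 unfolding ver_def by auto
    then show ?thesis unfolding K_def by blast
  qed
qed

lemma turns_iff: "d i \<in> turns \<longleftrightarrow> E i \<noteq> E (i - 1)"
proof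
  assume "d i \<in> turns"
  then obtain j where "d i = d j" "E j \<noteq> E (j - 1)" unfolding turns_def by blast
  then show "E i \<noteq> E (i - 1)" using label_cong(4)[of i j 0 0] by simp
qed (auto simp: turns_def)

lemma V_unique:
  assumes "u \<in> range d" "u \<notin> turns" "v \<in> range g"
  shows "\<exists>!c. c < s \<and> (u, v) \<in> V (int c)"
proof -
  obtain i w where u: "u = d i" "v = g w" using assms by auto
  then have "E (i - 1) = E i" using assms turns_iff by auto
  then show ?thesis using u class_exists[of w "E i"] class_unique V_iff by metis
qed

text \<open>The classes of the arriving and the leaving row differ by one. For even \<open>s\<close>
  parity makes sense modulo \<open>s\<close>, so one of the two cycles through the vertex has even
  and the other odd index.\<close>

lemma V_unique_parity:
  assumes "u \<in> turns" "v \<in> range g" "even s"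
  shows "\<exists>!c. c < s \<and> (even c \<longleftrightarrow> p) \<and> (u, v) \<in> V (int c)"
proof -
  obtain i w where u: "u = d i" "v = g w" and ne: "E i \<noteq> E (i - 1)" using assms by (auto simp: turns_def)
  obtain c where c: "c < s" "int s dvd w - int c - E i" using class_exists by blast
  obtain c' where c': "c' < s" "int s dvd w - int c' - E (i - 1)" using class_exists by blast
  have "even (int s)" using assms by simp
  then have "even (w - int c - E i)" "even (w - int c' - E (i - 1))" using c c' by (meson dvd_trans)+
  moreover have "odd x" if "x \<in> {-1, 0, 1}" "x \<noteq> 0" for x :: int using that by auto
  then have "odd (E i - E (i - 1))" using steps[of i] ne by (metis right_minus_eq)
  ultimately have par: "even c \<longleftrightarrow> odd c'" by auto
  have V: "x < s \<and> (u, v) \<in> V (int x) \<longleftrightarrow> x = c \<or> x = c'" for x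
    using u V_iff c c' class_unique by metis
  show ?thesis
  proof (cases "even c \<longleftrightarrow> p")
    case True then show ?thesis using V par by metis
  next
    case False then show ?thesis using V par by metis
  qed
qed

text \<open>A column meets one residue class of rows, a turning column two disjoint ones, and each
  class has \<open>b div s\<close> rows. The set \<open>T\<close> will be a colour class.\<close>

lemma card_V:
  assumes "T \<subseteq> range d"
  shows "card (V c \<inter> T \<times> UNIV) = (card T + card (T \<inter> turns)) * (b div s)"
proof -
  have finT: "finite T" using assms cycle_map_card(2)[OF d] finite_subset by blast
  define W where "W u = {v. (u, v) \<in> V c}" for u
  have cls: "card {g w | w. int s dvd w - r} = b div s" for r
  proof -
    have "{g w | w. int s dvd w - r} = g ` {w \<in> {0..<int b}. int s dvd w - r}"
    proof (intro equalityI subsetI)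
      fix v assume "v \<in> {g w | w. int s dvd w - r}"
      then obtain w where w: "v = g w" "int s dvd w - r" by auto
      have "g w = g (w mod int b)" using g by (simp add: cycle_map_eq)
      moreover have "int s dvd (w mod int b) - r"
      proof -
        have "int s dvd w - w mod int b" using s by (meson dvd_minus_mod dvd_trans of_nat_dvd_iff)
        then show ?thesis using w(2) dvd_diff[of "int s" "w - r" "w - w mod int b"] by simp
      qed
      moreover have "w mod int b \<in> {0..<int b}" using g by (simp add: cycle_map_def)
      ultimately show "v \<in> g ` {w \<in> {0..<int b}. int s dvd w - r}" using w by blast
    qed auto
    moreover have "inj_on g {w \<in> {0..<int b}. int s dvd w - r}"
      using cycle_map_range(2)[OF g] by (rule inj_on_subset) auto
    ultimately show ?thesis using card_residue_class s by (simp add: card_image)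
  qed
  have finW: "finite {g w | w. int s dvd w - r}" for r
    using cycle_map_card(2)[OF g] by (rule finite_subset[rotated]) auto
  have cW: "card (W u) = (if u \<in> turns then 2 else 1) * (b div s)" if uT: "u \<in> T" for u
  proof -
    obtain i where u: "u = d i" using uT assms by blast
    have W: "W u = {g w | w. int s dvd w - (c + E i)} \<union> {g w | w. int s dvd w - (c + E (i - 1))}" (is "_ = ?A \<union> ?B")
    proof (intro equalityI subsetI)
      fix v assume "v \<in> W u"
      moreover from this obtain w where w: "v = g w" by (auto simp: W_def V_def)
      ultimately have "int s dvd w - (c + E i) \<or> int s dvd w - (c + E (i - 1))"
        by (simp add: W_def u V_iff diff_diff_eq)
      then show "v \<in> ?A \<union> ?B" using w by blast
    qed (auto simp: W_def u V_iff diff_diff_eq)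
    show ?thesis
    proof (cases "u \<in> turns")
      case True
      then have ne: "E i \<noteq> E (i - 1)" using u turns_iff by simp
      have "?A \<inter> ?B = {}"
      proof (rule ccontr)
        assume "?A \<inter> ?B \<noteq> {}"
        then obtain v where v: "v \<in> ?A" "v \<in> ?B" by blast
        obtain w where w1: "v = g w" "int s dvd w - (c + E i)" using v(1) by (elim CollectE exE conjE)
        obtain w' where w2: "v = g w'" "int s dvd w' - (c + E (i - 1))" using v(2) by (elim CollectE exE conjE)
        have w: "g w = g w'" "int s dvd w - c - E i" "int s dvd w' - c - E (i - 1)"
          using w1 w2 by (simp_all only: diff_diff_eq)
        have "int s dvd w - c - E (i - 1)" using label_cong(2)[OF refl w(1), of c i] w(3) by blast
        then show False using not_both[OF ne] w by blast
      qed
      then show ?thesis using True W cls finW by (simp add: card_Un_disjoint)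
    next
      case False
      then show ?thesis using W u turns_iff cls by simp
    qed
  qed
  have "V c \<inter> T \<times> UNIV = Sigma T W" by (auto simp: W_def)
  moreover have "finite (W u)" for u
    by (rule finite_subset[OF _ cycle_map_card(2)[OF g]]) (auto simp: W_def V_def)
  ultimately have "card (V c \<inter> T \<times> UNIV) = (\<Sum>u\<in>T. card (W u))"
    using finT by (simp add: card_SigmaI)
  also have "\<dots> = (\<Sum>u\<in>T. (if u \<in> turns then 2 else 1) * (b div s))" using cW by simp
  also have "\<dots> = (\<Sum>u\<in>T. (b div s)) + (\<Sum>u\<in>T. if u \<in> turns then b div s else 0)"
    unfolding sum.distrib[symmetric] by (rule sum.cong) auto
  also have "\<dots> = card T * (b div s) + card (T \<inter> turns) * (b div s)"
    using finT by (simp add: sum.If_cases)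
  finally show ?thesis by (simp add: add_mult_distrib)
qed

lemma card_V_total: "card (V c) = (m + card turns) * (b div s)"
proof -
  have "V c \<inter> range d \<times> UNIV = V c" "range d \<inter> turns = turns" by (auto simp: V_def turns_def)
  then show ?thesis using card_V[of "range d" c] cycle_map_card(1)[OF d] by simp
qed

end

text \<open>The height goes up at the first \<open>(card S + s) div 2\<close> vertices of \<open>S\<close> and down at the others.\<close>

lemma prefix_profile:
  fixes d :: "int \<Rightarrow> 'a"
  assumes d: "cycle_map m d" and S: "S \<subseteq> range d" and s: "s \<le> card S" "even (card S + s)"
  obtains E :: "int \<Rightarrow> int" where
    "\<And>i. E (i + int m) = E i + int s"
    "\<And>i. E i - E (i - 1) \<in> {-1, 0, 1}"
    "\<And>i. E i \<noteq> E (i - 1) \<longleftrightarrow> d i \<in> S"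
    "S = range d \<Longrightarrow> 1 \<le> s \<Longrightarrow> s < m \<Longrightarrow> \<exists>i. E i = E (i - 1) + 1 \<and> E (i + 1) = E i - 1"
proof -
  have m: "int m > 0" using d by (simp add: cycle_map_def)
  \<comment> \<open>With \<open>p\<close> ascents and \<open>card S - p\<close> descents the net
    gain of a round is \<open>2 * p - card S = s\<close>.\<close>
  define p where "p = (card S + s) div 2"
  have p: "2 * p = card S + s" using s by (simp add: p_def)
  define f :: "int \<Rightarrow> int" where "f k = (if k \<le> int p then k else 2 * int p - k)" for k
  define cnt where "cnt i = int (card {k \<in> {0..i}. d k \<in> S})" for i :: int
  have cnt0: "cnt (-1) = 0" by (simp add: cnt_def)
  have cntS: "cnt i = cnt (i - 1) + (if d i \<in> S then 1 else 0)" if "i \<ge> 0" for i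
  proof -
    have "{k \<in> {0..i}. d k \<in> S} = {k \<in> {0..i - 1}. d k \<in> S} \<union> (if d i \<in> S then {i} else {})"
      using that by (auto simp: order_le_less)
    moreover have "finite {k \<in> {0..i - 1}. d k \<in> S}" by (rule finite_subset[of _ "{0..i - 1}"]) auto
    ultimately show ?thesis by (simp add: cnt_def)
  qed
  have cntm: "cnt (int m - 1) = int (card S)"
  proof -
    have "S = d ` {k \<in> {0..int m - 1}. d k \<in> S}"
    proof (intro equalityI subsetI)
      fix v assume v: "v \<in> S"
      then have "v \<in> d ` {0..<int m}" using S cycle_map_range(1)[OF d] by auto
      then show "v \<in> d ` {k \<in> {0..int m - 1}. d k \<in> S}" using v by auto
    qed auto
    moreover have "inj_on d {k \<in> {0..int m - 1}. d k \<in> S}"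
      using cycle_map_range(2)[OF d] by (rule inj_on_subset) auto
    ultimately show ?thesis unfolding cnt_def by (metis card_image)
  qed
  \<comment> \<open>Inside a round the height is the tent function \<open>f\<close> of the number of
    vertices of \<open>S\<close> passed so far; every completed round adds \<open>s\<close>.\<close>
  define E where "E i = f (cnt (i mod int m)) + int s * (i div int m)" for i
  have f0: "f 0 = 0" and fS: "f (int (card S)) = int s"
    using p s by (auto simp: f_def)
  \<comment> \<open>The formula also holds at the start of a round: there the count drops from
    \<open>card S\<close> to \<open>cnt (-1) = 0\<close>, and \<open>f (card S) = s\<close> is
    exactly the contribution of the completed round.\<close>
  have Ered: "E i - E (i - 1) = f (cnt (i mod int m)) - f (cnt (i mod int m - 1))" for i
  proof (cases "i mod int m = 0")
    case True
    then obtain q where "i = int m * q" by auto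
    then have q: "i = q * int m" by simp
    have "(i - 1) mod int m = int m - 1" "(i - 1) div int m = q - 1"
      if True
    proof -
      have "i - 1 = int m * (q - 1) + (int m - 1)" unfolding q by (simp add: algebra_simps)
      then show "(i - 1) mod int m = int m - 1" "(i - 1) div int m = q - 1"
        using int_mod_pos_eq[of "i - 1" "int m" "q - 1" "int m - 1"] int_div_pos_eq[of "i - 1" "int m" "q - 1" "int m - 1"] m by auto
    qed
    then have "E (i - 1) = f (cnt (int m - 1)) + int s * (q - 1)" by (simp only: E_def simp_thms)
    moreover have "i div int m = q" using q m by simp
    then have "E i = f (cnt 0) + int s * q" using True by (simp only: E_def)
    ultimately show ?thesis using True cntm cnt0 f0 fS by (simp add: algebra_simps)
  next
    case False
    have ge: "i mod int m \<ge> 1" using m False pos_mod_sign[of "int m" i] by linarith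
    have lt: "i mod int m < int m" using m by simp
    have "i - 1 = int m * (i div int m) + (i mod int m - 1)"
      using mult_div_mod_eq[of "int m" i] by simp
    then have "(i - 1) mod int m = i mod int m - 1" "(i - 1) div int m = i div int m"
      using ge lt int_mod_pos_eq[of "i - 1" "int m" "i div int m" "i mod int m - 1"]
        int_div_pos_eq[of "i - 1" "int m" "i div int m" "i mod int m - 1"] by auto
    then show ?thesis by (simp add: E_def)
  qed
  have fstep: "f (k + 1) - f k = (if k < int p then 1 else -1)" for k by (auto simp: f_def)
  have Estep: "E i - E (i - 1) = (if d i \<in> S then (if cnt (i mod int m - 1) < int p then 1 else -1) else 0)" for i
  proof -
    have "d (i mod int m) = d i" using d by (simp add: cycle_map_eq)
    then have "cnt (i mod int m) = cnt (i mod int m - 1) + (if d i \<in> S then 1 else 0)"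
      using cntS[of "i mod int m"] m by simp
    then show ?thesis unfolding Ered using fstep[of "cnt (i mod int m - 1)"] by simp
  qed
  show ?thesis
  proof
    show "E (i + int m) = E i + int s" for i
    proof -
      have "(i + int m) div int m = i div int m + 1" using m by (simp add: div_add_self2)
      then show ?thesis by (simp add: E_def distrib_left)
    qed
    show "E i - E (i - 1) \<in> {-1, 0, 1}" for i unfolding Estep by simp
    show "E i \<noteq> E (i - 1) \<longleftrightarrow> d i \<in> S" for i using Estep[of i] by (auto split: if_splits)
    assume all: "S = range d" "1 \<le> s" "s < m"
    have "card S = m" using all d cycle_map_card(1) by blast
    then have p': "1 \<le> p" "p < m" using p all by auto
    \<comment> \<open>Every column is a turn here, so the last ascent is at \<open>p - 1\<close> and
      the first descent at \<open>p\<close>; a descent exists because \<open>s < m\<close>.\<close>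
    have cnt: "cnt (int k - 1) = int k" if "k \<le> m" for k
    proof -
      have "{k' \<in> {0..int k - 1}. d k' \<in> S} = {0..int k - 1}" using all by auto
      then show ?thesis by (simp add: cnt_def)
    qed
    have "E (int p - 1) - E (int p - 1 - 1) = 1"
    proof -
      have "(int p - 1) mod int m = int p - 1" using p' by (simp add: mod_pos_pos_trivial)
      moreover have "cnt (int p - 1 - 1) < int p" using cnt[of "p - 1"] p' by (simp add: of_nat_diff)
      ultimately show ?thesis unfolding Estep using all by simp
    qed
    moreover have "E (int p) - E (int p - 1) = -1"
    proof -
      have "int p mod int m = int p" using p' by (simp add: mod_pos_pos_trivial)
      moreover have "cnt (int p - 1) = int p" using cnt[of p] p' by simp
      ultimately show ?thesis unfolding Estep using all by simp
    qed
    ultimately show "\<exists>i. E i = E (i - 1) + 1 \<and> E (i + 1) = E i - 1"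
      by (intro exI[of _ "int p - 1"]) simp
  qed
qed

text \<open>Three consecutive edges of \<open>F\<close> that are closed to a square by an edge of \<open>H\<close>: this is the configuration that the
decomposition into three Hamilton cycles needs. It is reproduced by every product construction.\<close>

definition bent_square :: "'a set set \<Rightarrow> 'a set set \<Rightarrow> bool" where
  "bent_square F H \<longleftrightarrow> (\<exists>p q r t. p \<noteq> r \<and> q \<noteq> t \<and> {p, q} \<in> F \<and> {q, r} \<in> F \<and> {r, t} \<in> F \<and> {t, p} \<in> H)"

text \<open>The properties of winding cycles that are needed later, freed of parametrisations. In
  \<open>prod_edges S D (\<Union>G) G\<close> the first argument is \<open>S\<close> and not
  \<open>\<Union>D\<close>: there is a copy of \<open>D\<close> in every row, but a copy of
  \<open>G\<close> only over the vertices of \<open>S\<close>.\<close>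

definition twisted :: "nat \<Rightarrow> nat \<Rightarrow> 'a set \<Rightarrow> 'a set set \<Rightarrow> 'b set set \<Rightarrow> nat \<Rightarrow> (nat \<Rightarrow> ('a \<times> 'b) set set) \<Rightarrow> bool" where
  "twisted m b S D G s K \<longleftrightarrow>
     (\<forall>c. cyc ((m + card S) * (b div s)) (K c)) \<and> (\<forall>c. \<Union>(K c) \<subseteq> \<Union>D \<times> \<Union>G) \<and>
     (\<forall>c<s. \<forall>c'<s. c \<noteq> c' \<longrightarrow> K c \<inter> K c' = {}) \<and> (\<Union>c<s. K c) = prod_edges S D (\<Union>G) G \<and>
     (\<forall>u\<in>\<Union>D. \<forall>v\<in>\<Union>G. u \<notin> S \<longrightarrow> (\<exists>!c. c < s \<and> (u, v) \<in> \<Union>(K c))) \<and>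
     (\<forall>u\<in>S. \<forall>v\<in>\<Union>G. \<forall>p. even s \<longrightarrow> (\<exists>!c. c < s \<and> (even c \<longleftrightarrow> p) \<and> (u, v) \<in> \<Union>(K c))) \<and>
     (\<forall>c. \<forall>T\<subseteq>\<Union>D. card (\<Union>(K c) \<inter> T \<times> UNIV) = (card T + card (T \<inter> S)) * (b div s)) \<and>
     (S = \<Union>D \<longrightarrow> s = 2 \<longrightarrow> 4 \<le> m \<longrightarrow> bent_square (K 0) (K 1))"

lemma twistedD:
  assumes "twisted m b S D G s K"
  shows "cyc ((m + card S) * (b div s)) (K c)" "\<Union>(K c) \<subseteq> \<Union>D \<times> \<Union>G"
    "c < s \<Longrightarrow> c' < s \<Longrightarrow> c \<noteq> c' \<Longrightarrow> K c \<inter> K c' = {}" "(\<Union>c<s. K c) = prod_edges S D (\<Union>G) G"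
    "u \<in> \<Union>D \<Longrightarrow> v \<in> \<Union>G \<Longrightarrow> u \<notin> S \<Longrightarrow> \<exists>!c. c < s \<and> (u, v) \<in> \<Union>(K c)"
    "u \<in> S \<Longrightarrow> v \<in> \<Union>G \<Longrightarrow> even s \<Longrightarrow> \<exists>!c. c < s \<and> (even c \<longleftrightarrow> p) \<and> (u, v) \<in> \<Union>(K c)"
    "T \<subseteq> \<Union>D \<Longrightarrow> card (\<Union>(K c) \<inter> T \<times> UNIV) = (card T + card (T \<inter> S)) * (b div s)"
    "S = \<Union>D \<Longrightarrow> s = 2 \<Longrightarrow> 4 \<le> m \<Longrightarrow> bent_square (K 0) (K 1)"
proof -
  note 1 = assms[unfolded twisted_def]
  note 2 = conjunct2[OF 1] note 3 = conjunct2[OF 2] note 4 = conjunct2[OF 3] note 5 = conjunct2[OF 4]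
  note 6 = conjunct2[OF 5] note 7 = conjunct2[OF 6]
  show "cyc ((m + card S) * (b div s)) (K c)" by (rule spec[OF conjunct1[OF 1]])
  show "\<Union>(K c) \<subseteq> \<Union>D \<times> \<Union>G" by (rule spec[OF conjunct1[OF 2]])
  show "c < s \<Longrightarrow> c' < s \<Longrightarrow> c \<noteq> c' \<Longrightarrow> K c \<inter> K c' = {}" using conjunct1[OF 3] by simp
  show "(\<Union>c<s. K c) = prod_edges S D (\<Union>G) G" by (rule conjunct1[OF 4])
  show "\<exists>!c. c < s \<and> (u, v) \<in> \<Union>(K c)" if "u \<in> \<Union>D" "v \<in> \<Union>G" "u \<notin> S"
    by (rule mp[OF bspec[OF bspec[OF conjunct1[OF 5] that(1)] that(2)] that(3)])
  show "\<exists>!c. c < s \<and> (even c \<longleftrightarrow> p) \<and> (u, v) \<in> \<Union>(K c)" if "u \<in> S" "v \<in> \<Union>G" "even s"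
    by (rule mp[OF spec[OF bspec[OF bspec[OF conjunct1[OF 6] that(1)] that(2)]] that(3)])
  show "T \<subseteq> \<Union>D \<Longrightarrow> card (\<Union>(K c) \<inter> T \<times> UNIV) = (card T + card (T \<inter> S)) * (b div s)" using conjunct1[OF 7] by simp
  show "S = \<Union>D \<Longrightarrow> s = 2 \<Longrightarrow> 4 \<le> m \<Longrightarrow> bent_square (K 0) (K 1)" using conjunct2[OF 7] by simp
qed

text \<open>The conditions \<open>s \<le> card S\<close> and \<open>even (card S + s)\<close> are
  what \<open>card S\<close> steps of size one need in order to gain exactly
  \<open>s\<close>.\<close>

lemma twisted_product:
  fixes D :: "'a set set" and G :: "'b set set"
  assumes D: "cyc m D" and G: "cyc b G" and S: "S \<subseteq> \<Union>D"
    and s: "2 \<le> s" "s dvd b" "s \<le> card S" "even (card S + s)"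
  shows "\<exists>K. twisted m b S D G s K"
proof -
  obtain d where d: "cycle_map m d" and D': "D = range (\<lambda>i. {d i, d (i + 1)})"
    using D by (auto simp: cyc_def)
  obtain g where g: "cycle_map b g" and G': "G = range (\<lambda>i. {g i, g (i + 1)})"
    using G by (auto simp: cyc_def)
  have UD: "\<Union>D = range d" and UG: "\<Union>G = range g" unfolding D' G' by (rule cycle_map_edges_Union)+
  obtain E :: "int \<Rightarrow> int" where E: "\<And>i. E (i + int m) = E i + int s" "\<And>i. E i - E (i - 1) \<in> {-1, 0, 1}"
    "\<And>i. E i \<noteq> E (i - 1) \<longleftrightarrow> d i \<in> S"
    "S = range d \<Longrightarrow> 1 \<le> s \<Longrightarrow> s < m \<Longrightarrow> \<exists>i. E i = E (i - 1) + 1 \<and> E (i + 1) = E i - 1"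
    using prefix_profile[OF d S[unfolded UD] s(3,4)] by metis
  interpret twist m b s d g E by unfold_locales (use d g s E in auto)
  have turns: "turns = S" using S UD E(3) unfolding turns_def by auto
  have "twisted m b S D G s (\<lambda>c. K (int c))" unfolding twisted_def
  proof (intro conjI allI ballI impI)
    show "cyc ((m + card S) * (b div s)) (K (int c))" for c
      using cyc_K(1)[of "int c"] unfolding card_V_total turns .
    show "\<Union>(K (int c)) \<subseteq> \<Union>D \<times> \<Union>G" for c unfolding cyc_K(2) UD UG V_def by auto
    show "K (int c) \<inter> K (int c') = {}" if "c < s" "c' < s" "c \<noteq> c'" for c c' using K_disjoint that .
    show "(\<Union>c<s. K (int c)) = prod_edges S D (\<Union>G) G"
      using K_Union unfolding turns prod_edges_def D'[symmetric] G'[symmetric] UG .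
    show "\<exists>!c. c < s \<and> (u, v) \<in> \<Union>(K (int c))" if "u \<in> \<Union>D" "v \<in> \<Union>G" "u \<notin> S" for u v
      using V_unique that unfolding cyc_K(2) turns UD UG by blast
    show "\<exists>!c. c < s \<and> (even c \<longleftrightarrow> p) \<and> (u, v) \<in> \<Union>(K (int c))" if "u \<in> S" "v \<in> \<Union>G" "even s" for u v p
      using V_unique_parity[of u v p] that unfolding cyc_K(2) turns UD UG by blast
    show "card (\<Union>(K (int c)) \<inter> T \<times> UNIV) = (card T + card (T \<inter> S)) * (b div s)" if "T \<subseteq> \<Union>D" for c T
      using card_V that unfolding cyc_K(2) turns UD .
    assume all: "S = \<Union>D" "s = 2" "4 \<le> m"
    then obtain i where i: "E i = E (i - 1) + 1" "E (i + 1) = E i - 1" using E(4) UD by auto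
    have h: "{(d i, g w), (d (i + 1), g w)} \<in> K c" if "int s dvd w - c - E i" for i w c
      using that by (auto simp: K_def hor_def)
    have v: "{(d i, g w), (d i, g (w + 1))} \<in> K c"
      if "E i \<noteq> E (i - 1)" "int s dvd w - c - min (E (i - 1)) (E i)" for i w c
      using that by (auto simp: K_def ver_def)
    \<comment> \<open>At a peak of the heights both columns \<open>i\<close> and
      \<open>i + 1\<close> turn between the rows \<open>w\<close> and \<open>w + 1\<close>. These
      two vertical edges and the edge between them in row \<open>w + 1\<close> lie in cycle 0,
      whereas row \<open>w\<close> has the other residue modulo 2, so the fourth side lies in cycle
      1.\<close>
    define w where "w = E (i - 1)"
    have 1: "{(d i, g w), (d i, g (w + 1))} \<in> K (int 0)"
      by (rule v) (use i in \<open>auto simp: w_def\<close>)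
    have 2: "{(d i, g (w + 1)), (d (i + 1), g (w + 1))} \<in> K (int 0)"
      by (rule h) (use i in \<open>auto simp: w_def\<close>)
    have 3: "{(d (i + 1), g w), (d (i + 1), g (w + 1))} \<in> K (int 0)"
      by (rule v) (use i in \<open>auto simp: w_def\<close>)
    have 4: "{(d i, g w), (d (i + 1), g w)} \<in> K (int 1)"
      by (rule h) (use i all(2) in \<open>auto simp: w_def\<close>)
    show "bent_square (K (int 0)) (K (int 1))" unfolding bent_square_def
      by (rule exI[of _ "(d i, g w)"], rule exI[of _ "(d i, g (w + 1))"],
          rule exI[of _ "(d (i + 1), g (w + 1))"], rule exI[of _ "(d (i + 1), g w)"])
        (use 1 2 3 4 cycle_map_succ[OF d] cycle_map_succ[OF g] in \<open>simp add: insert_commute\<close>)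
  qed
  then show ?thesis by blast
qed

section \<open>The product of two Hamilton cycles by a cycle\<close>

text \<open>Converts a degree count into the degree condition of \<open>cyc_intro\<close>. The fifth
  candidate will be the other end of the chord, \<open>3 - i\<close>, which is meaningful in columns
  0 and 3 only; its distinctness is therefore required only if it is present.\<close>

lemma two_of_five:
  assumes "distinct [v, x1, x2, x3, x4]" "b5 \<Longrightarrow> x5 \<notin> {v, x1, x2, x3, x4}"
    and "of_bool b1 + of_bool b2 + of_bool b3 + of_bool b4 + of_bool b5 = (2 :: nat)"
  shows "\<exists>x y. x \<noteq> y \<and> x \<noteq> v \<and> y \<noteq> v \<and> (\<forall>u. (b1 \<and> u = x1 \<or> b2 \<and> u = x2 \<or> b3 \<and> u = x3 \<or> b4 \<and> u = x4 \<or> b5 \<and> u = x5)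
     \<longleftrightarrow> u = x \<or> u = y)"
proof -
  consider "b1" "b2" "\<not> b3" "\<not> b4" "\<not> b5" | "b1" "b3" "\<not> b2" "\<not> b4" "\<not> b5" | "b1" "b4" "\<not> b2" "\<not> b3" "\<not> b5"
    | "b1" "b5" "\<not> b2" "\<not> b3" "\<not> b4" | "b2" "b3" "\<not> b1" "\<not> b4" "\<not> b5" | "b2" "b4" "\<not> b1" "\<not> b3" "\<not> b5"
    | "b2" "b5" "\<not> b1" "\<not> b3" "\<not> b4" | "b3" "b4" "\<not> b1" "\<not> b2" "\<not> b5" | "b3" "b5" "\<not> b1" "\<not> b2" "\<not> b4"
    | "b4" "b5" "\<not> b1" "\<not> b2" "\<not> b3"
    using assms(3) by (cases b1; cases b2; cases b3; cases b4; cases b5) simp_all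
  then show ?thesis
  proof cases
    case 1 then show ?thesis using assms(1,2) by (intro exI[of _ x1] exI[of _ x2]) auto
  next
    case 2 then show ?thesis using assms(1,2) by (intro exI[of _ x1] exI[of _ x3]) auto
  next
    case 3 then show ?thesis using assms(1,2) by (intro exI[of _ x1] exI[of _ x4]) auto
  next
    case 4 then show ?thesis using assms(1,2) by (intro exI[of _ x1] exI[of _ x5]) auto
  next
    case 5 then show ?thesis using assms(1,2) by (intro exI[of _ x2] exI[of _ x3]) auto
  next
    case 6 then show ?thesis using assms(1,2) by (intro exI[of _ x2] exI[of _ x4]) auto
  next
    case 7 then show ?thesis using assms(1,2) by (intro exI[of _ x2] exI[of _ x5]) auto
  next
    case 8 then show ?thesis using assms(1,2) by (intro exI[of _ x3] exI[of _ x4]) auto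
  next
    case 9 then show ?thesis using assms(1,2) by (intro exI[of _ x3] exI[of _ x5]) auto
  next
    case 10 then show ?thesis using assms(1,2) by (intro exI[of _ x4] exI[of _ x5]) auto
  qed
qed

definition next_mod :: "nat \<Rightarrow> nat \<Rightarrow> nat" where
  "next_mod n i = (if Suc i = n then 0 else Suc i)"

definition prev_mod :: "nat \<Rightarrow> nat \<Rightarrow> nat" where
  "prev_mod n i = (if i = 0 then n - 1 else i - 1)"

text \<open>Columns \<open>0, \<dots>, N - 1\<close> are the vertices along the first Hamilton cycle \<open>F\<close>, numbered such that the second one \<open>H\<close> contains
the edge between columns 3 and 0. Of \<open>H\<close>, only the copies of this edge are available to the red and the blue cycle; the
rest of \<open>H\<close>, numbered along \<open>H\<close> from column 0 to column 3, belongs to the yellow cycle, which zigzags through the copies of this path.\<close>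

locale chord_grid =
  fixes N a :: nat
  assumes N: "even N" "6 \<le> N" and a: "even a" "4 \<le> a"
begin

abbreviation "nx \<equiv> next_mod N"
abbreviation "pv \<equiv> prev_mod N"
abbreviation "up \<equiv> next_mod a"
abbreviation "dn \<equiv> prev_mod a"

definition layer :: "(nat \<Rightarrow> nat \<Rightarrow> bool) \<Rightarrow> (nat \<Rightarrow> nat \<Rightarrow> bool) \<Rightarrow> (nat \<Rightarrow> bool) \<Rightarrow> (nat \<times> nat) set set" where
  "layer H V C = {{(i, t), (nx i, t)} | i t. i < N \<and> t < a \<and> H i t}
    \<union> {{(i, t), (i, up t)} | i t. i < N \<and> t < a \<and> V i t}
    \<union> {{(3, t), (0, t)} | t. t < a \<and> C t}"

lemma mod_simps [simp]:
  "i < N \<Longrightarrow> nx i < N" "i < N \<Longrightarrow> pv i < N" "t < a \<Longrightarrow> up t < a" "t < a \<Longrightarrow> dn t < a"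
  "i < N \<Longrightarrow> pv (nx i) = i" "i < N \<Longrightarrow> nx (pv i) = i" "t < a \<Longrightarrow> dn (up t) = t" "t < a \<Longrightarrow> up (dn t) = t"
  using N a by (auto simp: next_mod_def prev_mod_def)

lemma layer_neighbours:
  assumes "i < N" "t < a"
  shows "{(i, t), u} \<in> layer H V C \<longleftrightarrow> H i t \<and> u = (nx i, t) \<or> H (pv i) t \<and> u = (pv i, t) \<or>
    V i t \<and> u = (i, up t) \<or> V i (dn t) \<and> u = (i, dn t) \<or>
    (C t \<and> (i = 0 \<or> i = 3)) \<and> u = (3 - i, t)" (is "?L \<longleftrightarrow> ?R")
proof
  assume ?L
  then consider (h) j r where "{(i, t), u} = {(j, r), (nx j, r)}" "j < N" "r < a" "H j r"
    | (v) j r where "{(i, t), u} = {(j, r), (j, up r)}" "j < N" "r < a" "V j r"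
    | (c) r where "{(i, t), u} = {(3, r), (0, r)}" "C r"
    unfolding layer_def Un_iff mem_Collect_eq by metis
  then show ?R
  proof cases
    case h then show ?thesis by (auto simp: doubleton_eq_iff)
  next
    case v then show ?thesis by (auto simp: doubleton_eq_iff)
  next
    case c then show ?thesis by (auto simp: doubleton_eq_iff)
  qed
next
  have h: "{(i, t), (nx i, t)} \<in> layer H V C" if "i < N" "t < a" "H i t" for i t using that unfolding layer_def by blast
  have v: "{(i, t), (i, up t)} \<in> layer H V C" if "i < N" "t < a" "V i t" for i t using that unfolding layer_def by blast
  have c: "{(3, t), (0, t)} \<in> layer H V C" if "t < a" "C t" for t using that unfolding layer_def by blast
  assume ?R
  then show ?L
    using h[of i t] h[of "pv i" t] v[of i t] v[of i "dn t"] c[of t] assms by (auto simp: insert_commute)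
qed

lemma layer_cyc:
  assumes deg: "\<And>i t. i < N \<Longrightarrow> t < a \<Longrightarrow> of_bool (H i t) + of_bool (H (pv i) t) + of_bool (V i t) + of_bool (V i (dn t))
      + of_bool (C t \<and> (i = 0 \<or> i = 3)) = (2 :: nat)"
    and conn: "\<And>i t. i < N \<Longrightarrow> t < a \<Longrightarrow> (\<lambda>u v. {u, v} \<in> layer H V C)\<^sup>*\<^sup>* o1 (i, t)"
  shows "cyc (N * a) (layer H V C)" "\<Union>(layer H V C) = {..<N} \<times> {..<a}"
proof -
  let ?V = "{..<N} \<times> {..<a}"
  have sym: "(\<lambda>u v. {u, v} \<in> layer H V C)\<^sup>*\<^sup>* x y \<Longrightarrow> (\<lambda>u v. {u, v} \<in> layer H V C)\<^sup>*\<^sup>* y x" for x y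
    by (rule sympD[OF symp_rtranclp]) (simp add: symp_def insert_commute)
  have V: "u \<in> ?V" if "{u, v} \<in> layer H V C" for u v
    using that N a unfolding layer_def by (auto simp: doubleton_eq_iff)
  have two: "\<exists>u v. e = {u, v}" if "e \<in> layer H V C" for e using that unfolding layer_def by blast
  have d: "\<exists>x y. x \<noteq> y \<and> x \<noteq> v \<and> y \<noteq> v \<and> (\<forall>u. {v, u} \<in> layer H V C \<longleftrightarrow> u = x \<or> u = y)" if "v \<in> ?V" for v
  proof -
    obtain i t where v: "v = (i, t)" "i < N" "t < a" using \<open>v \<in> ?V\<close> by auto
    show ?thesis unfolding v(1) layer_neighbours[OF v(2,3)]
    proof (rule two_of_five)
      show "distinct [(i, t), (nx i, t), (pv i, t), (i, up t), (i, dn t)]"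
        using v N a by (auto simp: next_mod_def prev_mod_def)
      show "(3 - i, t) \<notin> {(i, t), (nx i, t), (pv i, t), (i, up t), (i, dn t)}" if "C t \<and> (i = 0 \<or> i = 3)"
        using that v N a by (auto simp: next_mod_def prev_mod_def)
    qed (rule deg[OF v(2,3)])
  qed
  have c: "(\<lambda>u v. {u, v} \<in> layer H V C)\<^sup>*\<^sup>* u v" if uv: "u \<in> ?V" "v \<in> ?V" for u v
  proof -
    obtain i t j r where "u = (i, t)" "v = (j, r)" by (metis prod.collapse)
    then show ?thesis using uv by (auto intro: rtranclp_trans[OF sym[OF conn] conn])
  qed
  have "?V \<noteq> {}" using N a by (auto simp: lessThan_empty_iff)
  then have "cyc (card ?V) (layer H V C)" "\<Union>(layer H V C) = ?V"
    using cyc_intro[OF _ _ V two d c] by auto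
  then show "cyc (N * a) (layer H V C)" "\<Union>(layer H V C) = ?V" by (simp_all add: card_cartesian_product)
qed

text \<open>Which horizontal (\<open>RH\<close>) and vertical (\<open>RV\<close>) edges of the grid are red. From column 4 on this is a brick pattern;
the exceptions in columns 0 to 2 join the pieces to a single red and a single blue cycle.\<close>

definition "RH i t \<longleftrightarrow> (if i = 0 then t \<noteq> 2 \<and> t \<noteq> 3 else if i = 1 then t \<noteq> 1 \<and> t \<noteq> 2
  else if i = 2 then t = 1 \<or> t = 2 else even (i + t))" for i t :: nat

definition "RV i t \<longleftrightarrow> (if i = 0 then t = 2 else if i = 1 then t = 1 \<or> t = 2
  else if i = 2 then even t else if i = 3 then odd t \<and> t \<noteq> 1 else odd t)" for i t :: nat

text \<open>Removing the chord from \<open>H\<close> leaves a path with ends in columns 0 and 3. The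
  yellow cycle runs through a copy of it in every row and changes rows at alternating ends.\<close>

definition "YV i t \<longleftrightarrow> i = 0 \<and> odd t \<or> i = 3 \<and> even t" for i t :: nat

definition "red = layer RH RV even"
definition "BH i t \<longleftrightarrow> \<not> RH i t"
definition "BV i t \<longleftrightarrow> \<not> RV i t \<and> \<not> YV i t"

definition "blue = layer BH BV odd"

lemma dn_simps:
  assumes "t < a" shows "even (dn t) \<longleftrightarrow> odd t" "dn t = 1 \<longleftrightarrow> t = 2" "dn t = 2 \<longleftrightarrow> t = 3" "dn t = Suc 0 \<longleftrightarrow> t = 2"
  using a assms by (auto simp: prev_mod_def)

lemma up_parity: "t < a \<Longrightarrow> even (up t) \<longleftrightarrow> odd t"
  using a by (auto simp: next_mod_def)

lemma column_cases:
  assumes "i < N"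
  obtains "i = 0" "pv i = N - 1" | "i = 1" "pv i = 0" | "i = 2" "pv i = 1" | "i = 3" "pv i = 2" | "4 \<le> i" "pv i = i - 1"
proof -
  consider "i = 0" | "i = 1" | "i = 2" | "i = 3" | "4 \<le> i" by linarith
  then show ?thesis using that by cases (auto simp: prev_mod_def)
qed

text \<open>Five kinds of columns suffice, as the pattern depends on parities only from column 4 on.
  It fits together at the wrap from column \<open>N - 1\<close> to column 0 because \<open>N\<close>
  is even, and from row \<open>a - 1\<close> to row 0 because \<open>a\<close> is even.\<close>

lemma red_degree:
  assumes "i < N" "t < a"
  shows "of_bool (RH i t) + of_bool (RH (pv i) t) + of_bool (RV i t) + of_bool (RV i (dn t))
      + of_bool (even t \<and> (i = 0 \<or> i = 3)) = (2 :: nat)"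
  using \<open>i < N\<close>
proof (cases rule: column_cases)
  case 5
  then show ?thesis using dn_simps[OF assms(2)] by (auto simp: RH_def RV_def)
qed (use N dn_simps[OF assms(2)] in \<open>auto simp: RH_def RV_def\<close>)

lemma blue_degree:
  assumes "i < N" "t < a"
  shows "of_bool (BH i t) + of_bool (BH (pv i) t) + of_bool (BV i t) + of_bool (BV i (dn t))
      + of_bool (odd t \<and> (i = 0 \<or> i = 3)) = (2 :: nat)"
  using \<open>i < N\<close>
proof (cases rule: column_cases)
  case 5
  then show ?thesis using dn_simps[OF assms(2)] by (auto simp: BH_def BV_def RH_def RV_def YV_def)
qed (use N dn_simps[OF assms(2)] in \<open>auto simp: BH_def BV_def RH_def RV_def YV_def\<close>)

end

locale layer_conn = chord_grid +
  fixes H V :: "nat \<Rightarrow> nat \<Rightarrow> bool" and C :: "nat \<Rightarrow> bool"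
begin

definition "conn u v \<longleftrightarrow> (\<lambda>u v. {u, v} \<in> layer H V C)\<^sup>*\<^sup>* u v"

lemma conn_refl [simp]: "conn u u" by (simp add: conn_def)

lemma conn_sym: "conn u v \<Longrightarrow> conn v u"
  unfolding conn_def by (rule sympD[OF symp_rtranclp]) (simp add: symp_def insert_commute)

lemma conn_trans [trans]: "conn u v \<Longrightarrow> conn v w \<Longrightarrow> conn u w"
  unfolding conn_def by (rule rtranclp_trans)

lemma conn_trans': "conn u v \<Longrightarrow> conn w v \<Longrightarrow> conn u w"
  by (rule conn_trans[OF _ conn_sym])

lemma connH: "i < N \<Longrightarrow> t < a \<Longrightarrow> H i t \<Longrightarrow> nx i = j \<Longrightarrow> conn (i, t) (j, t)"
  unfolding conn_def by (rule r_into_rtranclp) (auto simp: layer_neighbours)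

lemma connV: "i < N \<Longrightarrow> t < a \<Longrightarrow> V i t \<Longrightarrow> up t = r \<Longrightarrow> conn (i, t) (i, r)"
  unfolding conn_def by (rule r_into_rtranclp) (auto simp: layer_neighbours)

lemma connC: "t < a \<Longrightarrow> C t \<Longrightarrow> conn (3, t) (0, t)"
  unfolding conn_def by (rule r_into_rtranclp) (use N in \<open>auto simp: layer_neighbours\<close>)

text \<open>The zigzag through the brick pattern that connects columns 3 and 0 the long way round.\<close>

lemma outer:
  assumes t: "t < a" "even t \<longleftrightarrow> p"
    and Ho: "\<And>i t. 3 \<le> i \<Longrightarrow> t < a \<Longrightarrow> H i t \<longleftrightarrow> (even (i + t) \<longleftrightarrow> \<not> p)"
    and Vo: "\<And>i t. 4 \<le> i \<Longrightarrow> t < a \<Longrightarrow> V i t \<longleftrightarrow> (even t \<longleftrightarrow> p)"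
  shows "4 \<le> i \<Longrightarrow> i < N \<Longrightarrow> conn (3, t) (i, t) \<and> conn (3, t) (i, up t)" "conn (3, t) (0, t)"
proof -
  have *: "4 + k < N \<Longrightarrow> conn (3, t) (4 + k, t) \<and> conn (3, t) (4 + k, up t)" for k
  proof (induction k)
    case 0
    have "conn (3, t) (4, t)" by (rule connH) (use N t Ho[of 3 t] in \<open>auto simp: next_mod_def\<close>)
    moreover have "conn (4, t) (4, up t)" by (rule connV) (use N t Vo[of 4 t] in auto)
    ultimately show ?case using conn_trans by auto
  next
    case (Suc k)
    then have IH: "conn (3, t) (4 + k, t)" "conn (3, t) (4 + k, up t)" by auto
    have v: "conn (4 + Suc k, t) (4 + Suc k, up t)" by (rule connV) (use Suc.prems t Vo[of "4 + Suc k" t] in auto)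
    have nx: "nx (4 + k) = 4 + Suc k" using Suc.prems by (auto simp: next_mod_def)
    show ?case
    proof (cases "even k")
      case True
      have "conn (4 + k, up t) (4 + Suc k, up t)"
        by (rule connH[OF _ _ _ nx]) (use True Suc.prems t up_parity[of t] Ho[of "4 + k" "up t"] in auto)
      then show ?thesis using IH v conn_trans conn_sym by blast
    next
      case False
      have "conn (4 + k, t) (4 + Suc k, t)"
        by (rule connH[OF _ _ _ nx]) (use False Suc.prems t Ho[of "4 + k" t] in auto)
      then show ?thesis using IH v conn_trans conn_sym by blast
    qed
  qed
  show "4 \<le> i \<Longrightarrow> i < N \<Longrightarrow> conn (3, t) (i, t) \<and> conn (3, t) (i, up t)" using *[of "i - 4"] by simp
  have "conn (3, t) (N - 1, t)" using *[of "N - 1 - 4"] N by simp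
  also have "conn (N - 1, t) (0, t)" by (rule connH) (use N t Ho[of "N - 1" t] in \<open>auto simp: next_mod_def\<close>)
  finally show "conn (3, t) (0, t)" .
qed

end

context chord_grid
begin

text \<open>After the degree count only connectivity is open. The zigzags \<open>out\<close> start
  in the odd rows and cover two rows each; they have to be linked with one another near columns 0 to
  3. The walk \<open>base\<close> does this in the exceptional rows 0 to 3, and \<open>P\<close>
  repeats one link for each later pair of rows.\<close>

lemma red_cyc: "cyc (N * a) red" "\<Union>red = {..<N} \<times> {..<a}"
proof -
  interpret layer_conn N a RH RV even by unfold_locales
  have out: "conn (3, t) (0, t)" "4 \<le> i \<Longrightarrow> i < N \<Longrightarrow> conn (3, t) (i, t) \<and> conn (3, t) (i, up t)"
    if "t < a" "odd t" for t i
    using outer[of t False] that by (auto simp: RH_def RV_def)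
  have base: "conn (0, 1) (1, 1)" "conn (1, 1) (1, 2)" "conn (1, 2) (1, 3)" "conn (1, 3) (2, 3)" "conn (2, 2) (2, 3)"
    "conn (2, 2) (3, 2)" "conn (3, 2) (0, 2)" "conn (0, 2) (0, 3)"
    "conn (2, 1) (3, 1)" "conn (2, 0) (2, 1)" "conn (1, 0) (2, 0)" "conn (0, 0) (1, 0)" "conn (3, 0) (0, 0)"
    using N a by (auto intro!: connH connV connC simp: RH_def RV_def next_mod_def)
  have B: "conn (0, 1) (i, t)" if "i < 4" "t < 4" for i t
  proof -
    have *: "conn (0, 1) (3, 1)" "conn (0, 3) (3, 3)" using out(1)[of 1] out(1)[of 3] a conn_sym by auto
    have b11: "conn (0, 1) (1, 1)" by (rule base(1))
    have b12: "conn (0, 1) (1, 2)" by (rule conn_trans[OF b11 base(2)])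
    have b13: "conn (0, 1) (1, 3)" by (rule conn_trans[OF b12 base(3)])
    have b23: "conn (0, 1) (2, 3)" by (rule conn_trans[OF b13 base(4)])
    have b22: "conn (0, 1) (2, 2)" by (rule conn_trans'[OF b23 base(5)])
    have b32: "conn (0, 1) (3, 2)" by (rule conn_trans[OF b22 base(6)])
    have b02: "conn (0, 1) (0, 2)" by (rule conn_trans[OF b32 base(7)])
    have b03: "conn (0, 1) (0, 3)" by (rule conn_trans[OF b02 base(8)])
    have b33: "conn (0, 1) (3, 3)" by (rule conn_trans[OF b03 *(2)])
    have b21: "conn (0, 1) (2, 1)" by (rule conn_trans'[OF *(1) base(9)])
    have b20: "conn (0, 1) (2, 0)" by (rule conn_trans'[OF b21 base(10)])
    have b10: "conn (0, 1) (1, 0)" by (rule conn_trans'[OF b20 base(11)])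
    have b00: "conn (0, 1) (0, 0)" by (rule conn_trans'[OF b10 base(12)])
    have b30: "conn (0, 1) (3, 0)" by (rule conn_trans'[OF b00 base(13)])
    have "i \<in> {0, 1, 2, 3}" "t \<in> {0, 1, 2, 3}" using that by auto
    then show ?thesis using b11 b12 b13 b23 b22 b32 b02 b03 b33 b21 b20 b10 b00 b30 *(1) by (elim insertE) simp_all
  qed
  have P: "conn (0, r + 2) (1, r + 2)" "conn (1, r + 2) (2, r + 2)" "conn (2, r + 1) (2, r + 2)" "conn (1, r + 1) (2, r + 1)"
    "conn (0, r + 1) (1, r + 1)" "conn (3, r + 1) (0, r + 1)" "conn (3, r) (3, r + 1)" if "r + 2 < a" "3 \<le> r" "odd r" for r
    using that N by (auto intro!: connH connV connC simp: RH_def RV_def next_mod_def)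
  have Q: "\<forall>i<4. conn (0, 1) (i, 2 * k) \<and> conn (0, 1) (i, 2 * k + 1)" if "2 * k + 1 < a" for k
    using that
  proof (induction k)
    case 0 show ?case using B by auto
  next
    case (Suc k)
    show ?case
    proof (cases "k = 0")
      case True
      then show ?thesis using B by auto
    next
      case False
      define r where "r = 2 * k + 1"
      have r: "r + 2 < a" "3 \<le> r" "odd r" "2 * Suc k = r + 1" "2 * Suc k + 1 = r + 2" using Suc.prems False by (auto simp: r_def)
      have "conn (0, 1) (3, r)" using Suc r_def by simp
      then have 1: "conn (0, 1) (3, r + 1)" by (rule conn_trans[OF _ P(7)[OF r(1-3)]])
      have 2: "conn (0, 1) (0, r + 1)" by (rule conn_trans[OF 1 P(6)[OF r(1-3)]])
      have 3: "conn (0, 1) (1, r + 1)" by (rule conn_trans[OF 2 P(5)[OF r(1-3)]])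
      have 4: "conn (0, 1) (2, r + 1)" by (rule conn_trans[OF 3 P(4)[OF r(1-3)]])
      have 5: "conn (0, 1) (2, r + 2)" by (rule conn_trans[OF 4 P(3)[OF r(1-3)]])
      have 6: "conn (0, 1) (1, r + 2)" by (rule conn_trans'[OF 5 P(2)[OF r(1-3)]])
      have 7: "conn (0, 1) (0, r + 2)" by (rule conn_trans'[OF 6 P(1)[OF r(1-3)]])
      have 8: "conn (0, 1) (3, r + 2)" by (rule conn_trans'[OF 7 out(1)]) (use r in auto)
      have "conn (0, 1) (i, r + 1) \<and> conn (0, 1) (i, r + 2)" if "i < 4" for i
      proof -
        have "i \<in> {0, 1, 2, 3}" using that by auto
        then show ?thesis using 1 2 3 4 5 6 7 8 by (elim insertE) simp_all
      qed
      then show ?thesis unfolding r(4,5) by simp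
    qed
  qed
  have inner: "conn (0, 1) (i, t)" if "i < 4" "t < a" for i t
  proof (cases "even t")
    case True
    then obtain k where "t = 2 * k" by auto
    moreover from this have "2 * k + 1 < a" using that a by presburger
    ultimately show ?thesis using Q that by blast
  next
    case False
    then obtain k where "t = 2 * k + 1" by (metis oddE)
    then show ?thesis using Q that by blast
  qed
  have all: "conn (0, 1) (i, t)" if "i < N" "t < a" for i t
  proof (cases "i < 4")
    case False
    show ?thesis
    proof (cases "odd t")
      case True
      then show ?thesis using inner[of 3 t] out(2)[of t i] that False conn_trans by auto
    next
      case False
      then have "odd (dn t)" "dn t < a" using dn_simps that by auto
      then show ?thesis using inner[of 3 "dn t"] out(2)[of "dn t" i] that \<open>\<not> i < 4\<close> conn_trans by auto
    qed
  qed (use inner that in auto)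
  show "cyc (N * a) red" "\<Union>red = {..<N} \<times> {..<a}"
    unfolding red_def using layer_cyc[OF red_degree all[unfolded conn_def]] by blast+
qed

lemma blue_cyc: "cyc (N * a) blue" "\<Union>blue = {..<N} \<times> {..<a}"
proof -
  interpret layer_conn N a BH BV odd by unfold_locales
  have out: "conn (3, t) (0, t)" "4 \<le> i \<Longrightarrow> i < N \<Longrightarrow> conn (3, t) (i, t) \<and> conn (3, t) (i, up t)"
    if "t < a" "even t" for t i
    using outer[of t True] that by (auto simp: BH_def BV_def RH_def RV_def YV_def)
  \<comment> \<open>Row \<open>up 3\<close> is 4 in general, but 0 if \<open>a = 4\<close>; working
    with \<open>up 3\<close> covers both cases.\<close>
  have u3: "up 3 \<noteq> 1" "up 3 \<noteq> 2" "even (up 3)" "up 3 < a" using a by (auto simp: next_mod_def)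
  have base: "conn (0, 0) (0, 1)" "conn (3, 1) (0, 1)" "conn (3, 1) (3, 2)" "conn (0, 2) (1, 2)" "conn (1, 2) (2, 2)" "conn (2, 1) (2, 2)"
    "conn (1, 1) (2, 1)" "conn (1, 0) (1, 1)" "conn (0, 3) (1, 3)" "conn (3, 3) (0, 3)" "conn (2, 3) (3, 3)"
    "conn (2, 0) (3, 0)"
    using N a by (auto intro!: connH connV connC simp: BH_def BV_def RH_def RV_def YV_def next_mod_def)
  have base': "conn (2, 3) (2, up 3)" "conn (2, up 3) (3, up 3)"
    by (rule connV, use N a in \<open>auto simp: BV_def RV_def YV_def\<close>)
      (rule connH, use N a u3 in \<open>auto simp: BH_def RH_def next_mod_def[of N]\<close>)
  \<comment> \<open>From row 3 on, all vertical edges of column 1 are blue, so this column is joined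
    upwards across the wrap to row 0. It is therefore left out of the induction \<open>Q\<close>
    over pairs of rows.\<close>
  have col: "conn (1, 3 + k) (1, 0)" if "3 + k < a" for k
    using that
  proof (induction "a - (3 + k)" arbitrary: k rule: less_induct)
    case less
    have v: "conn (1, 3 + k) (1, up (3 + k))" by (rule connV) (use N less.prems in \<open>auto simp: BH_def BV_def RV_def YV_def\<close>)
    show ?case
    proof (cases "Suc (3 + k) = a")
      case True then show ?thesis using v by (simp add: next_mod_def)
    next
      case False
      then have "conn (1, 3 + Suc k) (1, 0)" using less.hyps[of "Suc k"] less.prems by simp
      moreover have "up (3 + k) = 3 + Suc k" using False by (simp add: next_mod_def)
      ultimately show ?thesis using conn_trans[OF v, of "(1, 0)"] by simp
    qed
  qed
  have B: "conn (0, 0) (i, t)" if "i < 4" "t < 4" for i t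
  proof -
    have *: "conn (0, 0) (3, 0)" "conn (0, 2) (3, 2)" "conn (1, 3) (1, 0)" using out(1)[of 0] out(1)[of 2] col[of 0] a conn_sym by auto
    have b01: "conn (0, 0) (0, 1)" by (rule base(1))
    have b31: "conn (0, 0) (3, 1)" by (rule conn_trans'[OF b01 base(2)])
    have b32: "conn (0, 0) (3, 2)" by (rule conn_trans[OF b31 base(3)])
    have b02: "conn (0, 0) (0, 2)" by (rule conn_trans'[OF b32 *(2)])
    have b12: "conn (0, 0) (1, 2)" by (rule conn_trans[OF b02 base(4)])
    have b22: "conn (0, 0) (2, 2)" by (rule conn_trans[OF b12 base(5)])
    have b21: "conn (0, 0) (2, 1)" by (rule conn_trans'[OF b22 base(6)])
    have b11: "conn (0, 0) (1, 1)" by (rule conn_trans'[OF b21 base(7)])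
    have b10: "conn (0, 0) (1, 0)" by (rule conn_trans'[OF b11 base(8)])
    have b13: "conn (0, 0) (1, 3)" by (rule conn_trans'[OF b10 *(3)])
    have b03: "conn (0, 0) (0, 3)" by (rule conn_trans'[OF b13 base(9)])
    have b33: "conn (0, 0) (3, 3)" by (rule conn_trans'[OF b03 base(10)])
    have b23: "conn (0, 0) (2, 3)" by (rule conn_trans'[OF b33 base(11)])
    have b20: "conn (0, 0) (2, 0)" by (rule conn_trans'[OF *(1) base(12)])
    have "i \<in> {0, 1, 2, 3}" "t \<in> {0, 1, 2, 3}" using that by auto
    then show ?thesis using b01 b31 b32 b02 b12 b22 b21 b11 b10 b13 b03 b33 b23 b20 *(1) by (elim insertE) simp_all
  qed
  have P: "conn (0, t) (0, t + 1)" "conn (3, t + 1) (0, t + 1)" "conn (2, t + 1) (3, t + 1)"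
     "conn (2, t) (3, t)" if "t < a" "4 \<le> t" "even t" "t + 1 < a" for t
    using that N by (auto intro!: connH connV connC simp: BH_def BV_def RH_def RV_def YV_def next_mod_def)
  have P2: "conn (2, t + 1) (2, t + 2)" "conn (2, t + 2) (3, t + 2)" if "4 \<le> t" "even t" "t + 2 < a" for t
    using that N by (auto intro!: connH connV connC simp: BH_def BV_def RH_def RV_def YV_def next_mod_def)
  have Q: "\<forall>i\<in>{0,2,3}. conn (0, 0) (i, 2 * k) \<and> conn (0, 0) (i, 2 * k + 1)" if "2 * k + 1 < a" for k
    using that
  proof (induction k)
    case 0 show ?case using B by auto
  next
    case (Suc k)
    define t where "t = 2 * Suc k"
    show ?case
    proof (cases "k = 0")
      case True
      then show ?thesis using B by auto
    next
      case False
      have t: "t < a" "4 \<le> t" "even t" "t + 1 < a" using Suc.prems False by (auto simp: t_def)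
      \<comment> \<open>The new pair of rows is entered through column 2 from the row below: for
        \<open>t = 4\<close> this is row 3, covered by \<open>base'\<close>, afterwards
        \<open>P2\<close> applies.\<close>
      have s: "conn (0, 0) (3, t)"
      proof (cases "k = 1")
        case True
        then have "up 3 = t" using t by (auto simp: next_mod_def t_def)
        then have "conn (2, 3) (2, t)" "conn (2, t) (3, t)" using base' by simp_all
        then show ?thesis using conn_trans[OF conn_trans[OF B[of 2 3]]] by simp
      next
        case f: False
        have t': "t = 2 * k + 2" "4 \<le> 2 * k" using False f by (auto simp: t_def)
        then have "conn (2, 2 * k + 1) (2, t)" "conn (2, t) (3, t)" using P2[of "2 * k"] t by simp_all
        moreover have "conn (0, 0) (2, 2 * k + 1)" using Suc t t' by simp
        ultimately show ?thesis using conn_trans by metis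
      qed
      then have 1: "conn (0, 0) (2, t)" "conn (0, 0) (0, t)"
        using conn_trans[OF s conn_sym[OF P(4)[OF t]]] conn_trans[OF s out(1)[OF t(1,3)]] by blast+
      have 2: "conn (0, 0) (0, t + 1)" using conn_trans[OF 1(2) P(1)[OF t]] .
      have 3: "conn (0, 0) (3, t + 1)" using conn_trans[OF 2 conn_sym[OF P(2)[OF t]]] .
      have 4: "conn (0, 0) (2, t + 1)" using conn_trans[OF 3 conn_sym[OF P(3)[OF t]]] .
      note 1 2 3 4
      then show ?thesis using s 1 2 3 4 unfolding t_def[symmetric] by blast
    qed
  qed
  have c1: "conn (0, 0) (1, t)" if "t < a" for t
  proof (cases "t < 4")
    case False
    then have "conn (1, t) (1, 0)" using col[of "t - 3"] that by simp
    then show ?thesis using conn_trans[OF B[of 1 0] conn_sym] by simp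
  qed (use B in auto)
  have inner: "conn (0, 0) (i, t)" if "i < 4" "t < a" for i t
  proof (cases "i = 1")
    case False
    then have i: "i \<in> {0, 2, 3}" using that by auto
    show ?thesis
    proof (cases "even t")
      case True
      then obtain k where "t = 2 * k" by auto
      moreover from this have "2 * k + 1 < a" using that a by presburger
      ultimately show ?thesis using Q i by blast
    next
      case False
      then obtain k where "t = 2 * k + 1" by (metis oddE)
      then show ?thesis using Q i that by blast
    qed
  qed (use c1 that in auto)
  have all: "conn (0, 0) (i, t)" if "i < N" "t < a" for i t
  proof (cases "i < 4")
    case False
    show ?thesis
    proof (cases "even t")
      case True
      then show ?thesis using inner[of 3 t] out(2)[of t i] that False conn_trans by auto
    next
      case False
      then have "even (dn t)" "dn t < a" using dn_simps that by auto
      then show ?thesis using inner[of 3 "dn t"] out(2)[of "dn t" i] that \<open>\<not> i < 4\<close> conn_trans by auto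
    qed
  qed (use inner that in auto)
  show "cyc (N * a) blue" "\<Union>blue = {..<N} \<times> {..<a}"
    unfolding blue_def using layer_cyc[OF blue_degree all[unfolded conn_def]] by blast+
qed

definition yellow :: "(nat \<times> nat) set set" where
  "yellow = {{(j, t), (Suc j, t)} | j t. Suc j < N \<and> t < a} \<union>
     {{(0, t), (0, up t)} | t. t < a \<and> odd t} \<union> {{(N - 1, t), (N - 1, up t)} | t. t < a \<and> even t}"

lemma yellow_neighbours:
  assumes "i < N" "t < a"
  shows "{(i, t), u} \<in> yellow \<longleftrightarrow> Suc i < N \<and> u = (Suc i, t) \<or> 0 < i \<and> u = (i - 1, t) \<or>
    (i = 0 \<and> odd t \<or> i = N - 1 \<and> even t) \<and> u = (i, up t) \<or> (i = 0 \<and> even t \<or> i = N - 1 \<and> odd t) \<and> u = (i, dn t) \<or>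
    False \<and> u = u" (is "?L \<longleftrightarrow> ?R")
proof
  assume ?L
  then consider (h) j r where "{(i, t), u} = {(j, r), (Suc j, r)}" "Suc j < N" "r < a"
    | (v) r where "{(i, t), u} = {(0, r), (0, up r)}" "r < a" "odd r"
    | (w) r where "{(i, t), u} = {(N - 1, r), (N - 1, up r)}" "r < a" "even r"
    unfolding yellow_def Un_iff mem_Collect_eq by metis
  then show ?R
  proof cases
    case h then show ?thesis by (auto simp: doubleton_eq_iff)
  next
    case v then show ?thesis using up_parity by (auto simp: doubleton_eq_iff)
  next
    case w then show ?thesis using up_parity by (auto simp: doubleton_eq_iff)
  qed
next
  have h: "{(j, t), (Suc j, t)} \<in> yellow" if "Suc j < N" "t < a" for j t using that unfolding yellow_def by blast
  have v: "{(0, t), (0, up t)} \<in> yellow" if "t < a" "odd t" for t using that unfolding yellow_def by blast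
  have w: "{(N - 1, t), (N - 1, up t)} \<in> yellow" if "t < a" "even t" for t using that unfolding yellow_def by blast
  assume ?R
  then consider "Suc i < N" "u = (Suc i, t)" | "0 < i" "u = (i - 1, t)" | "i = 0" "odd t" "u = (i, up t)"
    | "i = N - 1" "even t" "u = (i, up t)" | "i = 0" "even t" "u = (i, dn t)" | "i = N - 1" "odd t" "u = (i, dn t)" by blast
  then show ?L
  proof cases
    case 2 then show ?thesis using h[of "i - 1" t] assms by (simp add: insert_commute)
  next
    case 5 then show ?thesis using v[of "dn t"] assms dn_simps(1)[of t] by (simp add: insert_commute)
  next
    case 6 then show ?thesis using w[of "dn t"] assms dn_simps(1)[of t] by (simp add: insert_commute)
  qed (use h v w assms in auto)
qed

lemma yellow_cyc: "cyc (N * a) yellow" "\<Union>yellow = {..<N} \<times> {..<a}"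
proof -
  let ?V = "{..<N} \<times> {..<a}"
  let ?c = "(\<lambda>u v. {u, v} \<in> yellow)\<^sup>*\<^sup>*"
  have sym: "?c x y \<Longrightarrow> ?c y x" for x y
    by (rule sympD[OF symp_rtranclp]) (simp add: symp_def insert_commute)
  have V: "u \<in> ?V" if "{u, v} \<in> yellow" for u v
    using that N a unfolding yellow_def by (auto simp: doubleton_eq_iff)
  have two: "\<exists>u v. e = {u, v}" if "e \<in> yellow" for e using that unfolding yellow_def by blast
  have d: "\<exists>x y. x \<noteq> y \<and> x \<noteq> v \<and> y \<noteq> v \<and> (\<forall>u. {v, u} \<in> yellow \<longleftrightarrow> u = x \<or> u = y)" if "v \<in> ?V" for v
  proof -
    obtain i t where v: "v = (i, t)" "i < N" "t < a" using \<open>v \<in> ?V\<close> by auto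
    consider (first) "i = 0" | (last) "i = N - 1" | (mid) "0 < i" "Suc i < N" using v by linarith
    then show ?thesis
    proof cases
      case first
      show ?thesis
      proof (cases "even t")
        case True
        then show ?thesis unfolding v(1) yellow_neighbours[OF v(2,3)] using first N a v
          by (intro exI[of _ "(1, t)"] exI[of _ "(0, dn t)"]) (auto simp: prev_mod_def)
      next
        case False
        then show ?thesis unfolding v(1) yellow_neighbours[OF v(2,3)] using first N a v
          by (intro exI[of _ "(1, t)"] exI[of _ "(0, up t)"]) (auto simp: next_mod_def)
      qed
    next
      case last
      show ?thesis
      proof (cases "even t")
        case True
        then show ?thesis unfolding v(1) yellow_neighbours[OF v(2,3)] using last N a v
          by (intro exI[of _ "(N - 2, t)"] exI[of _ "(N - 1, up t)"]) (auto simp: next_mod_def)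
      next
        case False
        then show ?thesis unfolding v(1) yellow_neighbours[OF v(2,3)] using last N a v
          by (intro exI[of _ "(N - 2, t)"] exI[of _ "(N - 1, dn t)"]) (auto simp: prev_mod_def)
      qed
    next
      case mid
      then show ?thesis unfolding v(1) yellow_neighbours[OF v(2,3)]
        by (intro exI[of _ "(Suc i, t)"] exI[of _ "(i - 1, t)"]) auto
    qed
  qed
  have row: "?c (0, t) (i, t)" if "i < N" "t < a" for i t
    using that
  proof (induction i)
    case (Suc i)
    have "{(i, t), (Suc i, t)} \<in> yellow" using Suc by (simp add: yellow_neighbours)
    then show ?case using Suc by (auto intro: rtranclp.rtrancl_into_rtrancl)
  qed simp
  have level: "?c (0, 0) (0, t)" if "t < a" for t
    using that
  proof (induction t)
    case (Suc t)
    then have IH: "?c (0, 0) (0, t)" and up: "up t = Suc t" by (auto simp: next_mod_def)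
    show ?case
    proof (cases "even t")
      case True
      have e: "{(N - 1, t), (N - 1, Suc t)} \<in> yellow"
        using True Suc.prems N yellow_neighbours[of "N - 1" t] up by simp
      have "?c (0, t) (N - 1, t)" "?c (N - 1, Suc t) (0, Suc t)" using row sym N Suc.prems by auto
      then show ?thesis using IH e by (metis (no_types, lifting) rtranclp.rtrancl_into_rtrancl rtranclp_trans)
    next
      case False
      have "{(0, t), (0, Suc t)} \<in> yellow"
        using False Suc.prems N yellow_neighbours[of 0 t] up by simp
      then show ?thesis using IH by (metis (no_types, lifting) rtranclp.rtrancl_into_rtrancl)
    qed
  qed simp
  have all: "?c (0, 0) v" if "v \<in> ?V" for v
    using that level row by (auto intro: rtranclp_trans)
  have c: "?c u v" if "u \<in> ?V" "v \<in> ?V" for u v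
    using rtranclp_trans[OF sym[OF all] all] that by blast
  have "?V \<noteq> {}" using N a by (auto simp: lessThan_empty_iff)
  then have "cyc (card ?V) yellow" "\<Union>yellow = ?V"
    using cyc_intro[OF _ _ V two d c] by auto
  then show "cyc (N * a) yellow" "\<Union>yellow = ?V" by (simp_all add: card_cartesian_product)
qed

end

section \<open>Transport of the grid cycles to a product of given cycles\<close>

lemma Collect1_cong: "(\<And>t. P t \<Longrightarrow> u t = v t) \<Longrightarrow> {u t | t. P t} = {v t | t. P t}"
  by (rule Collect_cong) metis

lemma Collect2_cong: "(\<And>i t. P i t \<Longrightarrow> u i t = v i t) \<Longrightarrow> {u i t | i t. P i t} = {v i t | i t. P i t}"
  by (rule Collect_cong) metis

lemma image_Collect1: "f ` {u t | t. P t} = {f (u t) | t. P t}"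
  by blast

lemma image_Collect2: "f ` {u i t | i t. P i t} = {f (u i t) | i t. P i t}"
  by blast

lemma Collect_split_Times:
  "{(u i, t) | i t. i < N \<and> t < a \<and> Q i t} \<union> {(u i, t) | i t. i < N \<and> t < a \<and> \<not> Q i t} = u ` {..<N :: nat} \<times> {..<a :: nat}"
  by auto

lemma Collect_split3_Times:
  "{(u i, t) | i t. i < N \<and> t < a \<and> Q i t} \<union> {(u i, t) | i t. i < N \<and> t < a \<and> \<not> Q i t \<and> \<not> Q' i t}
    \<union> {(u i, t) | i t. i < N \<and> t < a \<and> Q' i t} = u ` {..<N :: nat} \<times> {..<a :: nat}"
  by (auto, blast)

lemma image_Times_Collect: "(\<lambda>(x, t). u x (v t)) ` (A \<times> T) = {u x y | x y. x \<in> A \<and> y \<in> v ` T}"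
  by auto

lemma bent_square_image:
  assumes "bent_square F H" "inj_on f (\<Union>F)"
  shows "bent_square ((`) f ` F) ((`) f ` H)"
proof -
  obtain p q r t where s: "p \<noteq> r" "q \<noteq> t" "{p, q} \<in> F" "{q, r} \<in> F" "{r, t} \<in> F" "{t, p} \<in> H"
    using assms(1) by (auto simp: bent_square_def)
  have "f p \<noteq> f r" using inj_onD[OF assms(2), of p r] s by (metis UnionI insertI1 insert_commute)
  moreover have "f q \<noteq> f t" using inj_onD[OF assms(2), of q t] s by (metis UnionI insertI1 insert_commute)
  moreover have im: "{f x, f y} \<in> (`) f ` A" if "{x, y} \<in> A" for x y A
    using imageI[OF that, of "(`) f"] by simp
  ultimately show ?thesis unfolding bent_square_def
    by (intro exI[of _ "f p"] exI[of _ "f q"] exI[of _ "f r"] exI[of _ "f t"] conjI im s(3-6))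
qed

context chord_grid
begin

text \<open>In the square between columns 2 and 3 and rows 3 and \<open>up 3\<close>, the edge in
  column 3 is red and the other three are blue. This passes the invariant on to the next
  dimension.\<close>

lemma bent_square_blue_red: "bent_square blue red"
  unfolding bent_square_def
proof (intro exI conjI)
  have u: "up 3 < a" "up 3 \<noteq> 3" "up 3 \<noteq> 1" "up 3 \<noteq> 2" using a by (auto simp: next_mod_def)
  have lt: "2 < N" "3 < N" "3 < a" using N a by auto
  have nx2: "nx 2 = 3" using N by (simp add: next_mod_def)
  show "(3 :: nat, 3 :: nat) \<noteq> (2, up 3)" "(2 :: nat, 3 :: nat) \<noteq> (3, up 3)" by auto
  have 1: "{(2, 3), (3, 3)} \<in> blue" unfolding blue_def layer_neighbours[OF lt(1,3)] nx2
    by (auto simp: BH_def RH_def)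
  then show "{(3, 3), (2, 3)} \<in> blue" by (simp add: insert_commute)
  show "{(2, 3), (2, up 3)} \<in> blue" unfolding blue_def layer_neighbours[OF lt(1,3)]
    by (auto simp: BV_def RV_def YV_def)
  show "{(2, up 3), (3, up 3)} \<in> blue" unfolding blue_def layer_neighbours[OF lt(1) u(1)] nx2
    using u by (auto simp: BH_def RH_def)
  have "{(3, 3), (3, up 3)} \<in> red" unfolding red_def layer_neighbours[OF lt(2,3)]
    by (auto simp: RV_def)
  then show "{(3, up 3), (3, 3)} \<in> red" by (simp add: insert_commute)
qed

end

text \<open>Disjointness of the three cycles follows from their union by counting edges.\<close>

lemma triple_product:
  fixes C :: "'b set set" and F H :: "'a set set"
  assumes C: "cyc a C" and F: "cyc N F" and H: "cyc N H" and V: "\<Union>F = \<Union>H" and FH: "F \<inter> H = {}"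
    and sq: "bent_square F H" and N: "even N" "6 \<le> N" and a: "even a" "4 \<le> a"
  obtains R B Y :: "('a \<times> 'b) set set" where
    "cyc (N * a) R" "cyc (N * a) B" "cyc (N * a) Y"
    "\<Union>R = \<Union>F \<times> \<Union>C" "\<Union>B = \<Union>F \<times> \<Union>C" "\<Union>Y = \<Union>F \<times> \<Union>C"
    "R \<inter> B = {}" "R \<inter> Y = {}" "B \<inter> Y = {}"
    "R \<union> B \<union> Y = prod_edges (\<Union>F) (F \<union> H) (\<Union>C) C"
    "bent_square B R"
proof -
  interpret chord_grid N a by unfold_locales (use N a in auto)
  obtain p q r t where s: "p \<noteq> r" "q \<noteq> t" "{p, q} \<in> F" "{q, r} \<in> F" "{r, t} \<in> F" "{t, p} \<in> H"
    using sq by (auto simp: bent_square_def)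
  obtain d where d: "cycle_map N d" and F': "F = range (\<lambda>i. {d i, d (i + 1)})" and d01: "d 0 = p" "d 1 = q"
    using cyc_start[OF F s(3)] by blast
  \<comment> \<open>The other neighbour of \<open>q\<close> along \<open>F\<close>. In this way
    \<open>p\<close>, \<open>q\<close>, \<open>r\<close>, \<open>t\<close> become the columns 0 to
    3.\<close>
  have d2: "d 2 = r" using cycle_map_neighbours[OF d, of 1 r] s d01 F' by auto
  have d3: "d 3 = t" using cycle_map_neighbours[OF d, of 2 t] s d01 d2 F' by auto
  obtain h' where h': "cycle_map N h'" "H = range (\<lambda>i. {h' i, h' (i + 1)})" "h' 0 = t" "h' 1 = p"
    using cyc_start[OF H s(6)] by blast
  \<comment> \<open>After the shift the chord \<open>{t, p}\<close> is the closing edge of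
    \<open>h\<close>, from position \<open>N - 1\<close> to position 0, and the other edges of
    \<open>H\<close> form the path of the yellow cycle.\<close>
  define h where "h i = h' (i + 1)" for i
  have h: "cycle_map N h" and H': "H = range (\<lambda>i. {h i, h (i + 1)})"
    using cycle_map_shift[OF h'(1), of 1] h'(2) unfolding h_def by auto
  have h0: "h 0 = d 0" using h'(4) d01 by (simp add: h_def)
  have hN: "h (int (N - 1)) = d 3"
    using cycle_map_period[OF h'(1), of 0 1] h'(3) d3 N by (simp add: h_def of_nat_diff)
  obtain g where g: "cycle_map a g" and C': "C = range (\<lambda>i. {g i, g (i + 1)})"
    using C by (auto simp: cyc_def)
  have inj_nat: "inj_on (\<lambda>i. x (int i)) {..<n}" if "cycle_map n x" for n and x :: "int \<Rightarrow> 'c"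
    using that by (auto simp: inj_on_def cycle_map_eq)
  have range_nat: "range x = (\<lambda>i. x (int i)) ` {..<n}" if "cycle_map n x" for n and x :: "int \<Rightarrow> 'c"
    using cycle_map_range(1)[OF that] by (auto simp: image_iff) (metis atLeastLessThan_iff lessThan_iff nat_less_iff int_nat_eq)
  have next_nat: "x (int (next_mod n i)) = x (int i + 1)" if "cycle_map n x" "i < n" for n i and x :: "int \<Rightarrow> 'c"
    using that cycle_map_period[OF that(1), of 0 1] by (auto simp: next_mod_def add.commute)
  \<comment> \<open>Red and blue number the columns along \<open>F\<close>, yellow numbers them
    along \<open>H\<close>. To compare them, all three are described by pairs of an edge or a vertex
    of the first factor and a row; the union of the cycles becomes a union of such index
    sets.\<close>
  define lay :: "('a set \<times> nat) set \<Rightarrow> ('a \<times> nat) set \<Rightarrow> ('a \<times> 'b) set set" where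
    "lay P Q = (\<lambda>(e, t). e \<times> {g (int t)}) ` P \<union> (\<lambda>(v, t). {v} \<times> {g (int t), g (int t + 1)}) ` Q" for P Q
  define hP where "hP U = {({d (int i), d (int i + 1)}, t) | i t. i < N \<and> t < a \<and> U i t}" for U :: "nat \<Rightarrow> nat \<Rightarrow> bool"
  define cP where "cP U = {({d 3, d 0}, t) | t. t < a \<and> U t}" for U :: "nat \<Rightarrow> bool"
  define vQ where "vQ U = {(d (int i), t) | i t. i < N \<and> t < a \<and> U i t}" for U :: "nat \<Rightarrow> nat \<Rightarrow> bool"
  define yP where "yP = {({h (int j), h (int j + 1)}, t) | j t. Suc j < N \<and> t < a}"
  define \<phi> where "\<phi> = (\<lambda>(i, t). (d (int i), g (int t)))"
  define \<psi> where "\<psi> = (\<lambda>(i, t). (h (int i), g (int t)))"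
  have \<phi>_inj: "inj_on \<phi> ({..<N} \<times> {..<a})"
    using inj_nat[OF d] inj_nat[OF g] by (auto simp: \<phi>_def inj_on_def)
  have \<psi>_inj: "inj_on \<psi> ({..<N} \<times> {..<a})"
    using inj_nat[OF h] inj_nat[OF g] by (auto simp: \<psi>_def inj_on_def)
  have UF: "\<Union>F = range d" and UH: "\<Union>H = range h" and UC: "\<Union>C = range g"
    unfolding F' H' C' by (rule cycle_map_edges_Union)+
  have \<phi>_img: "\<phi> ` ({..<N} \<times> {..<a}) = \<Union>F \<times> \<Union>C"
    unfolding UF UC range_nat[OF d] range_nat[OF g] by (force simp: \<phi>_def)
  have \<psi>_img: "\<psi> ` ({..<N} \<times> {..<a}) = \<Union>F \<times> \<Union>C"
    unfolding V UH UC range_nat[OF h] range_nat[OF g] by (force simp: \<psi>_def)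
  have layer_image: "(`) \<phi> ` layer U W X = lay (hP U \<union> cP X) (vQ W)" for U W X
  proof -
    have 1: "(`) \<phi> ` {{(i, t), (nx i, t)} | i t. i < N \<and> t < a \<and> U i t} = (\<lambda>(e, t). e \<times> {g (int t)}) ` hP U"
    proof -
      have eq: "\<phi> ` {(i, t), (nx i, t)} = {d (int i), d (int i + 1)} \<times> {g (int t)}" if "i < N" for i t
        using next_nat[OF d that] by (auto simp: \<phi>_def)
      have "(`) \<phi> ` {{(i, t), (nx i, t)} | i t. i < N \<and> t < a \<and> U i t}
         = {\<phi> ` {(i, t), (nx i, t)} | i t. i < N \<and> t < a \<and> U i t}" by (rule image_Collect2)
      also have "\<dots> = {{d (int i), d (int i + 1)} \<times> {g (int t)} | i t. i < N \<and> t < a \<and> U i t}"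
        by (rule Collect2_cong, rule eq) simp
      also have "\<dots> = (\<lambda>(e, t). e \<times> {g (int t)}) ` hP U" unfolding hP_def image_Collect2 by simp
      finally show ?thesis .
    qed
    have 2: "(`) \<phi> ` {{(i, t), (i, up t)} | i t. i < N \<and> t < a \<and> W i t} = (\<lambda>(v, t). {v} \<times> {g (int t), g (int t + 1)}) ` vQ W"
    proof -
      have eq: "\<phi> ` {(i, t), (i, up t)} = {d (int i)} \<times> {g (int t), g (int t + 1)}" if "t < a" for i t
        using next_nat[OF g that] by (auto simp: \<phi>_def)
      have "(`) \<phi> ` {{(i, t), (i, up t)} | i t. i < N \<and> t < a \<and> W i t}
         = {\<phi> ` {(i, t), (i, up t)} | i t. i < N \<and> t < a \<and> W i t}" by (rule image_Collect2)
      also have "\<dots> = {{d (int i)} \<times> {g (int t), g (int t + 1)} | i t. i < N \<and> t < a \<and> W i t}"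
        by (rule Collect2_cong, rule eq) simp
      also have "\<dots> = (\<lambda>(v, t). {v} \<times> {g (int t), g (int t + 1)}) ` vQ W" unfolding vQ_def image_Collect2 by simp
      finally show ?thesis .
    qed
    have 3: "(`) \<phi> ` {{(3, t), (0, t)} | t. t < a \<and> X t} = (\<lambda>(e, t). e \<times> {g (int t)}) ` cP X"
    proof -
      have eq: "\<phi> ` {(3, t), (0, t)} = {d 3, d 0} \<times> {g (int t)}" for t by (auto simp: \<phi>_def)
      show ?thesis unfolding cP_def image_Collect1 eq by simp
    qed
    show ?thesis unfolding layer_def lay_def image_Un 1 2 3 by blast
  qed
  have yellow_image: "(`) \<psi> ` yellow = lay yP (vQ YV)"
  proof -
    have 1: "(`) \<psi> ` {{(j, t), (Suc j, t)} | j t. Suc j < N \<and> t < a} = (\<lambda>(e, t). e \<times> {g (int t)}) ` yP"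
    proof -
      have eq: "\<psi> ` {(j, t), (Suc j, t)} = {h (int j), h (int j + 1)} \<times> {g (int t)}" for j t
        by (auto simp: \<psi>_def add.commute)
      show ?thesis unfolding yP_def image_Collect2 eq by simp
    qed
    have 2: "(`) \<psi> ` {{(0, t), (0, up t)} | t. t < a \<and> odd t} \<union> (`) \<psi> ` {{(N - 1, t), (N - 1, up t)} | t. t < a \<and> even t}
       = (\<lambda>(v, t). {v} \<times> {g (int t), g (int t + 1)}) ` vQ YV"
    proof -
      have eq0: "\<psi> ` {(0, t), (0, up t)} = {d 0} \<times> {g (int t), g (int t + 1)}" if "t < a" for t
        using next_nat[OF g that] h0 by (auto simp: \<psi>_def)
      have eq3: "\<psi> ` {(N - 1, t), (N - 1, up t)} = {d 3} \<times> {g (int t), g (int t + 1)}" if "t < a" for t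
        using next_nat[OF g that] hN by (auto simp: \<psi>_def)
      have "vQ YV = {(d 0, t) | t. t < a \<and> odd t} \<union> {(d 3, t) | t. t < a \<and> even t}"
        using N unfolding vQ_def YV_def by force
      then have "(\<lambda>(v, t). {v} \<times> {g (int t), g (int t + 1)}) ` vQ YV =
        {{d 0} \<times> {g (int t), g (int t + 1)} | t. t < a \<and> odd t} \<union> {{d 3} \<times> {g (int t), g (int t + 1)} | t. t < a \<and> even t}"
        by (simp only: image_Un image_Collect1 prod.case)
      also have "{{d 0} \<times> {g (int t), g (int t + 1)} | t. t < a \<and> odd t} = {\<psi> ` {(0, t), (0, up t)} | t. t < a \<and> odd t}"
        by (rule Collect1_cong, rule eq0[symmetric]) simp
      also have "{{d 3} \<times> {g (int t), g (int t + 1)} | t. t < a \<and> even t} = {\<psi> ` {(N - 1, t), (N - 1, up t)} | t. t < a \<and> even t}"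
        by (rule Collect1_cong, rule eq3[symmetric]) simp
      finally show ?thesis by (simp only: image_Collect1)
    qed
    show ?thesis unfolding yellow_def lay_def image_Un 1 2[symmetric] by blast
  qed
  have lay_Un: "lay P Q \<union> lay P' Q' = lay (P \<union> P') (Q \<union> Q')" for P Q P' Q' by (auto simp: lay_def image_Un)
  define R where "R = lay (hP RH \<union> cP even) (vQ RV)"
  define B where "B = lay (hP BH \<union> cP odd) (vQ BV)"
  define Y where "Y = lay yP (vQ YV)"
  have R: "R = (`) \<phi> ` red" and B: "B = (`) \<phi> ` blue" and Y: "Y = (`) \<psi> ` yellow"
    unfolding R_def B_def Y_def red_def blue_def layer_image yellow_image by (rule refl)+
  have cR: "cyc (N * a) R" unfolding R by (rule cyc_image[OF red_cyc(1)]) (simp add: red_cyc(2) \<phi>_inj)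
  have cB: "cyc (N * a) B" unfolding B by (rule cyc_image[OF blue_cyc(1)]) (simp add: blue_cyc(2) \<phi>_inj)
  have cY: "cyc (N * a) Y" unfolding Y by (rule cyc_image[OF yellow_cyc(1)]) (simp add: yellow_cyc(2) \<psi>_inj)
  have edges_nat: "range (\<lambda>i. {x i, x (i + 1)}) = (\<lambda>i. {x (int i), x (int i + 1)}) ` {..<n}" if x: "cycle_map n x"
    for n and x :: "int \<Rightarrow> 'c"
  proof (intro equalityI subsetI)
    fix e assume "e \<in> range (\<lambda>i. {x i, x (i + 1)})"
    then obtain i where i: "e = {x i, x (i + 1)}" by auto
    have "x i \<in> (\<lambda>i. x (int i)) ` {..<n}" unfolding range_nat[OF x, symmetric] by simp
    then obtain k where k: "k < n" "x i = x (int k)" by auto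
    have "x (i + 1) = x (int k + 1)" by (rule cycle_map_shift_eq[OF x k(2)])
    then show "e \<in> (\<lambda>i. {x (int i), x (int i + 1)}) ` {..<n}" using i k by (intro image_eqI[of _ _ k]) simp_all
  qed auto
  have hAll: "hP RH \<union> hP BH = F \<times> {..<a}"
    unfolding F' edges_nat[OF d] hP_def BH_def by (rule Collect_split_Times)
  have yAll: "yP \<union> (cP even \<union> cP odd) = H \<times> {..<a}"
  proof -
    have "h (int (N - 1) + 1) = d 0" using h0 cycle_map_period[OF h, of 0 1] N by (simp add: of_nat_diff)
    moreover have "{..<N} = insert (N - 1) {..<N - 1}" using N by auto
    ultimately have "H = insert {d 3, d 0} ((\<lambda>j. {h (int j), h (int j + 1)}) ` {..<N - 1})"
      unfolding H' edges_nat[OF h] using hN by simp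
    moreover have "Suc j < N \<longleftrightarrow> j < N - 1" for j by auto
    then have "yP = (\<lambda>j. {h (int j), h (int j + 1)}) ` {..<N - 1} \<times> {..<a}" unfolding yP_def by auto
    moreover have "cP even \<union> cP odd = {{d 3, d 0}} \<times> {..<a}" unfolding cP_def by auto
    ultimately show ?thesis by auto
  qed
  have vAll: "vQ RV \<union> vQ BV \<union> vQ YV = \<Union>F \<times> {..<a}"
    unfolding UF range_nat[OF d] vQ_def BV_def by (rule Collect_split3_Times)
  have "R \<union> B \<union> Y = lay (hP RH \<union> cP even \<union> (hP BH \<union> cP odd) \<union> yP) (vQ RV \<union> vQ BV \<union> vQ YV)"
    unfolding R_def B_def Y_def lay_Un ..
  also have "hP RH \<union> cP even \<union> (hP BH \<union> cP odd) \<union> yP = (hP RH \<union> hP BH) \<union> (yP \<union> (cP even \<union> cP odd))" by blast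
  also have "\<dots> = (F \<union> H) \<times> {..<a}" unfolding hAll yAll by blast
  also have "lay ((F \<union> H) \<times> {..<a}) (vQ RV \<union> vQ BV \<union> vQ YV) = prod_edges (\<Union>F) (F \<union> H) (\<Union>C) C"
  proof -
    have 1: "(\<lambda>(e, t). e \<times> {g (int t)}) ` ((F \<union> H) \<times> {..<a}) = {e \<times> {w} | e w. e \<in> F \<union> H \<and> w \<in> \<Union>C}"
      unfolding UC range_nat[OF g] by (rule image_Times_Collect)
    have 2: "(\<lambda>(v, t). {v} \<times> {g (int t), g (int t + 1)}) ` (\<Union>F \<times> {..<a}) = {{v} \<times> f | v f. v \<in> \<Union>F \<and> f \<in> C}"
      unfolding C' edges_nat[OF g] by (rule image_Times_Collect)
    show ?thesis unfolding vAll lay_def prod_edges_def 1 2 ..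
  qed
  finally have RBY: "R \<union> B \<union> Y = prod_edges (\<Union>F) (F \<union> H) (\<Union>C) C" .
  have "card (R \<union> B \<union> Y) = 3 * (N * a)"
  proof -
    have "card (F \<union> H) = 2 * N" using FH cyc_card[OF F] cyc_card[OF H] cyc_finite[OF F] cyc_finite[OF H]
      by (simp add: card_Un_disjoint)
    then show ?thesis unfolding RBY
      using cyc_card_Union[OF F] cyc_card_Union[OF C] cyc_finite[OF F] cyc_finite[OF H] cyc_finite[OF C]
        cyc_card[OF C] cyc_edge_card[OF F] cyc_edge_card[OF H] cyc_edge_card[OF C]
      by (subst card_prod_edges) auto
  qed
  moreover have "card R = N * a" "card B = N * a" "card Y = N * a" by (rule cyc_card[OF cR] cyc_card[OF cB] cyc_card[OF cY])+
  moreover have fin: "finite R" "finite B" "finite Y" by (rule cyc_finite[OF cR] cyc_finite[OF cB] cyc_finite[OF cY])+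
  moreover note card_Un_Int[OF fin(1,2)] card_Un_Int[OF finite_UnI[OF fin(1,2)] fin(3)]
  ultimately have "card (R \<inter> B) = 0" "card ((R \<union> B) \<inter> Y) = 0" by linarith+
  then have "R \<inter> B = {}" "(R \<union> B) \<inter> Y = {}" using fin by simp_all
  then have disj: "R \<inter> B = {}" "R \<inter> Y = {}" "B \<inter> Y = {}" by blast+
  show ?thesis
  proof (rule that[of R B Y])
    show "cyc (N * a) R" "cyc (N * a) B" "cyc (N * a) Y" by (rule cR cB cY)+
    have im: "\<Union>((`) f ` A) = f ` \<Union>A" for f :: "nat \<times> nat \<Rightarrow> 'a \<times> 'b" and A by blast
    show "\<Union>R = \<Union>F \<times> \<Union>C" unfolding R im red_cyc(2) \<phi>_img ..
    show "\<Union>B = \<Union>F \<times> \<Union>C" unfolding B im blue_cyc(2) \<phi>_img ..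
    show "\<Union>Y = \<Union>F \<times> \<Union>C" unfolding Y im yellow_cyc(2) \<psi>_img ..
    show "R \<inter> B = {}" "R \<inter> Y = {}" "B \<inter> Y = {}" by (rule disj)+
    show "R \<union> B \<union> Y = prod_edges (\<Union>F) (F \<union> H) (\<Union>C) C" by (rule RBY)
    show "bent_square B R" unfolding R B
      by (rule bent_square_image[OF bent_square_blue_red]) (simp add: blue_cyc(2) \<phi>_inj)
  qed
qed

section \<open>Hamilton decompositions of cubes\<close>

definition cube :: "nat \<Rightarrow> bool list set" where
  "cube n = {v. length v = n}"

definition cube_edges :: "nat \<Rightarrow> bool list set set" where
  "cube_edges n = edges (hypercube n)"

definition append_pair :: "bool list \<times> bool list \<Rightarrow> bool list" where
  "append_pair = (\<lambda>(u, v). u @ v)"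

lemma finite_cube [simp]: "finite (cube n)" and card_cube [simp]: "card (cube n) = 2 ^ n"
proof -
  have "cube n = {xs. set xs \<subseteq> (UNIV :: bool set) \<and> length xs = n}" by (auto simp: cube_def)
  then show "finite (cube n)" "card (cube n) = 2 ^ n"
    using finite_lists_length_eq[of "UNIV :: bool set" n] card_lists_length_eq[of "UNIV :: bool set" n] by simp_all
qed

lemma append_pair_image: "append_pair ` (cube m \<times> cube n) = cube (m + n)"
proof (intro equalityI subsetI)
  fix v assume "v \<in> cube (m + n)"
  then have "v = append_pair (take m v, drop m v)" "(take m v, drop m v) \<in> cube m \<times> cube n"
    by (auto simp: append_pair_def cube_def)
  then show "v \<in> append_pair ` (cube m \<times> cube n)" by blast
qed (auto simp: append_pair_def cube_def)

lemma append_pair_inj: "inj_on append_pair (cube m \<times> cube n)"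
  by (auto simp: inj_on_def append_pair_def cube_def)

definition diff_set :: "bool list \<Rightarrow> bool list \<Rightarrow> nat set" where
  "diff_set u v = {m. m < length u \<and> u ! m \<noteq> v ! m}"

lemma cube_edges_iff:
  "{u, v} \<in> cube_edges n \<longleftrightarrow> u \<in> cube n \<and> v \<in> cube n \<and> card (diff_set u v) = 1"
proof -
  have sym: "diff_set u v = diff_set v u" if "u \<in> cube n" "v \<in> cube n" for u v
    using that by (auto simp: diff_set_def cube_def)
  have ce: "cube_edges n = {{u, v} | u v. u \<in> cube n \<and> v \<in> cube n \<and> card (diff_set u v) = 1}"
    unfolding cube_edges_def hypercube_def graph.sel cube_def diff_set_def by (rule Collect_cong) auto
  show ?thesis
  proof
    assume "{u, v} \<in> cube_edges n"
    then obtain x y where "{u, v} = {x, y}" "x \<in> cube n" "y \<in> cube n" "card (diff_set x y) = 1" unfolding ce by blast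
    then show "u \<in> cube n \<and> v \<in> cube n \<and> card (diff_set u v) = 1" using sym by (auto simp: doubleton_eq_iff)
  qed (auto simp: ce)
qed

lemma cube_edges_cases:
  assumes "e \<in> cube_edges n"
  obtains u v where "e = {u, v}" "u \<in> cube n" "v \<in> cube n" "card (diff_set u v) = 1"
proof -
  obtain u v where "e = {u, v}" using assms unfolding cube_edges_def hypercube_def by auto
  then show ?thesis using that assms cube_edges_iff by blast
qed

lemma diff_set_append:
  assumes "length u = length v"
  shows "card (diff_set (u @ u') (v @ v')) = card (diff_set u v) + card (diff_set u' v')"
proof -
  have "diff_set (u @ u') (v @ v') = diff_set u v \<union> (\<lambda>m. length u + m) ` diff_set u' v'" (is "?L = ?R")
  proof (intro equalityI subsetI)
    fix m assume m: "m \<in> ?L"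
    show "m \<in> ?R"
    proof (cases "m < length u")
      case False
      then have "m = length u + (m - length u)" "m - length u \<in> diff_set u' v'"
        using m assms by (auto simp: diff_set_def nth_append)
      then show ?thesis by blast
    qed (use m assms in \<open>auto simp: diff_set_def nth_append\<close>)
  qed (use assms in \<open>auto simp: diff_set_def nth_append\<close>)
  moreover have "diff_set u v \<inter> (\<lambda>m. length u + m) ` diff_set u' v' = {}" by (auto simp: diff_set_def)
  moreover have "finite (diff_set x y)" for x y by (simp add: diff_set_def)
  ultimately show ?thesis by (simp add: card_Un_disjoint card_image)
qed

lemma diff_set_0_iff: "length u = length v \<Longrightarrow> card (diff_set u v) = 0 \<longleftrightarrow> u = v"
  by (auto simp: diff_set_def list_eq_iff_nth_eq)

text \<open>If two words differ in one coordinate, exactly one of their two halves changes, and that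
  one in a single coordinate.\<close>

lemma append_pair_edges:
  "(`) append_pair ` prod_edges (cube m) (cube_edges m) (cube n) (cube_edges n) = cube_edges (m + n)"
proof (intro equalityI subsetI)
  fix e assume "e \<in> (`) append_pair ` prod_edges (cube m) (cube_edges m) (cube n) (cube_edges n)"
  then consider (1) f w where "e = append_pair ` (f \<times> {w})" "f \<in> cube_edges m" "w \<in> cube n"
    | (2) v f where "e = append_pair ` ({v} \<times> f)" "f \<in> cube_edges n" "v \<in> cube m"
    unfolding prod_edges_def by auto
  then show "e \<in> cube_edges (m + n)"
  proof cases
    case 1
    then obtain u v where uv: "f = {u, v}" "u \<in> cube m" "v \<in> cube m" "card (diff_set u v) = 1"
      using cube_edges_cases by metis
    then have e: "e = {u @ w, v @ w}" using 1 by (auto simp: append_pair_def)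
    moreover have "card (diff_set (u @ w) (v @ w)) = 1"
      using uv diff_set_append[of u v w w] diff_set_0_iff[of w w] by (simp add: cube_def)
    ultimately show ?thesis using uv 1 unfolding e cube_edges_iff by (auto simp: cube_def)
  next
    case 2
    then obtain u w where uv: "f = {u, w}" "u \<in> cube n" "w \<in> cube n" "card (diff_set u w) = 1"
      using cube_edges_cases by metis
    then have e: "e = {v @ u, v @ w}" using 2 by (auto simp: append_pair_def)
    moreover have "card (diff_set (v @ u) (v @ w)) = 1"
      using uv diff_set_append[of v v u w] diff_set_0_iff[of v v] by (simp add: cube_def)
    ultimately show ?thesis using uv 2 unfolding e cube_edges_iff by (auto simp: cube_def)
  qed
next
  fix e assume "e \<in> cube_edges (m + n)"
  then obtain x y where xy: "e = {x, y}" "x \<in> cube (m + n)" "y \<in> cube (m + n)" "card (diff_set x y) = 1"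
    using cube_edges_cases by metis
  obtain u u' where x: "x = u @ u'" "u \<in> cube m" "u' \<in> cube n"
    using xy(2) that[of "take m x" "drop m x"] by (simp add: cube_def)
  obtain v v' where y: "y = v @ v'" "v \<in> cube m" "v' \<in> cube n"
    using xy(3) that[of "take m y" "drop m y"] by (simp add: cube_def)
  have len: "length u = length v" "length u' = length v'" using x y by (auto simp: cube_def)
  have "card (diff_set u v) + card (diff_set u' v') = 1"
    using xy(4) diff_set_append[OF len(1)] x y by simp
  then consider "card (diff_set u v) = 1" "card (diff_set u' v') = 0" | "card (diff_set u v) = 0" "card (diff_set u' v') = 1"
    by linarith
  then show "e \<in> (`) append_pair ` prod_edges (cube m) (cube_edges m) (cube n) (cube_edges n)"
  proof cases
    case 1
    then have "u' = v'" using diff_set_0_iff len by blast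
    then have "e = append_pair ` ({u, v} \<times> {u'})" using xy x y by (auto simp: append_pair_def)
    moreover have "{u, v} \<in> cube_edges m" unfolding cube_edges_iff using x y 1 by blast
    ultimately show ?thesis unfolding prod_edges_def using x(3) by blast
  next
    case 2
    then have "u = v" using diff_set_0_iff len by blast
    then have "e = append_pair ` ({u} \<times> {u', v'})" using xy x y by (auto simp: append_pair_def)
    moreover have "{u', v'} \<in> cube_edges n" unfolding cube_edges_iff using x y 2 by blast
    ultimately show ?thesis unfolding prod_edges_def using x(2) by blast
  qed
qed

lemma cube_edge_card: "e \<in> cube_edges n \<Longrightarrow> card e = 2"
proof -
  assume "e \<in> cube_edges n"
  then obtain u v where uv: "e = {u, v}" "u \<in> cube n" "v \<in> cube n" "card (diff_set u v) = 1"
    using cube_edges_cases by metis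
  have "u \<noteq> v" using uv diff_set_0_iff[of u v] by (auto simp: cube_def)
  then show "card e = 2" using uv by simp
qed

lemma cube_edge_subset: "e \<in> cube_edges n \<Longrightarrow> e \<subseteq> cube n"
  by (erule cube_edges_cases) auto

lemma finite_cube_edges: "finite (cube_edges n)"
proof (rule finite_subset)
  show "cube_edges n \<subseteq> Pow (cube n)" using cube_edge_subset by blast
qed simp

lemma append_pair_edges_inj: "inj_on ((`) append_pair) (prod_edges (cube m) (cube_edges m) (cube n) (cube_edges n))"
  by (rule image_edges_inj[OF append_pair_inj], rule prod_edges_subset) (auto dest: cube_edge_subset)

lemma card_cube_edges: "2 * card (cube_edges n) = n * 2 ^ n"
proof (induction n)
  case 0
  have "cube_edges 0 = {}" unfolding cube_edges_def hypercube_def by auto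
  then show ?case by simp
next
  case (Suc n)
  have c1: "cube 1 = {[True], [False]}"
  proof -
    have "v \<in> {[True], [False]}" if "length v = 1" for v :: "bool list"
      using that by (cases v) auto
    then show ?thesis by (auto simp: cube_def)
  qed
  have "cube_edges 1 = {{[True], [False]}}"
  proof (intro equalityI subsetI)
    fix e assume "e \<in> cube_edges 1"
    then obtain u v where uv: "e = {u, v}" "u \<in> cube 1" "v \<in> cube 1" "card (diff_set u v) = 1"
      using cube_edges_cases by metis
    then have "u \<noteq> v" using diff_set_0_iff[of u v] by (auto simp: cube_def)
    then show "e \<in> {{[True], [False]}}" using uv c1 by auto
  next
    fix e assume "e \<in> {{[True], [False]}}"
    moreover have "diff_set [True] [False] = {0}" by (auto simp: diff_set_def)
    ultimately show "e \<in> cube_edges 1" using cube_edges_iff[of "[True]" "[False]" 1] c1 by simp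
  qed
  then have "card (cube_edges 1) = 1" by simp
  moreover have "card (cube_edges (n + 1)) = card (prod_edges (cube n) (cube_edges n) (cube 1) (cube_edges 1))"
    unfolding append_pair_edges[symmetric] by (rule card_image[OF append_pair_edges_inj])
  moreover have "\<dots> = card (cube_edges n) * card (cube 1) + card (cube n) * card (cube_edges 1)"
    by (rule card_prod_edges) (auto simp: finite_cube_edges cube_edge_card)
  ultimately have "card (cube_edges (Suc n)) = card (cube_edges n) * 2 + 2 ^ n" by simp
  then show ?case using Suc by simp
qed

section \<open>Hamilton decompositions of Cartesian products\<close>

definition ham_dec :: "'a set \<Rightarrow> 'a set set \<Rightarrow> 'a set set set \<Rightarrow> bool" where
  "ham_dec V E \<G> \<longleftrightarrow> (\<forall>A\<in>\<G>. cyc (card V) A \<and> \<Union>A = V) \<and> pairwise disjnt \<G> \<and> \<Union>\<G> = E"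

text \<open>The invariant of the induction on the dimension that allows the next odd step.\<close>

definition bent :: "'a set set set \<Rightarrow> bool" where
  "bent \<G> \<longleftrightarrow> (\<exists>A\<in>\<G>. \<exists>B\<in>\<G>. A \<noteq> B \<and> bent_square A B)"

lemma ham_pair:
  assumes A: "cyc a A" and B: "cyc b B" and a: "even a" "4 \<le> a" and b: "even b"
  obtains P Q where "cyc (a * b) P" "cyc (a * b) Q" "\<Union>P = \<Union>A \<times> \<Union>B" "\<Union>Q = \<Union>A \<times> \<Union>B" "P \<inter> Q = {}"
    "P \<union> Q = prod_edges (\<Union>A) A (\<Union>B) B" "bent_square P Q"
proof -
  have c: "card (\<Union>A) = a" "card (\<Union>B) = b" and fin: "finite (\<Union>A)" "finite (\<Union>B)"
    using A B cyc_card_Union by auto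
  have "\<exists>K. twisted a b (\<Union>A) A B 2 K"
    by (rule twisted_product[OF A B subset_refl]) (use a b c in simp_all)
  then obtain K where "twisted a b (\<Union>A) A B 2 K" by (rule exE)
  note K = twistedD[OF this]
  \<comment> \<open>The length equals the number of vertices of the product, so both cycles are
    Hamiltonian.\<close>
  have "(a + card (\<Union>A)) * (b div 2) = a * b" using b c by auto
  then have cyc: "cyc (a * b) (K c)" for c using K(1) by simp
  have U: "\<Union>(K c) = \<Union>A \<times> \<Union>B" for c
    by (rule card_subset_eq[OF _ K(2)]) (use fin c cyc_card_Union(1)[OF cyc] in \<open>simp_all add: card_cartesian_product\<close>)
  have "{..<2} = {0, 1 :: nat}" by auto
  then have "K 0 \<union> K 1 = prod_edges (\<Union>A) A (\<Union>B) B" using K(4) by simp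
  then show ?thesis using that[OF cyc cyc U U] K(3)[of 0 1] K(8) a by simp
qed

text \<open>Two decompositions of equal size are matched cycle by cycle; each matched pair splits
  its own share of the product into two Hamilton cycles, which form a bent pair.\<close>

lemma ham_pairs:
  assumes \<beta>: "bij_betw \<beta> \<A> \<B>" and dA: "pairwise disjnt \<A>" and dB: "pairwise disjnt \<B>"
    and A: "\<And>A. A \<in> \<A> \<Longrightarrow> cyc a A \<and> \<Union>A = V" and B: "\<And>B. B \<in> \<B> \<Longrightarrow> cyc b B \<and> \<Union>B = W"
    and a: "even a" "4 \<le> a" and b: "even b"
  shows "\<exists>\<G>. (\<forall>G\<in>\<G>. cyc (a * b) G \<and> \<Union>G = V \<times> W) \<and> pairwise disjnt \<G> \<and>
    \<Union>\<G> = prod_edges V (\<Union>\<A>) W (\<Union>\<B>) \<and> (\<A> \<noteq> {} \<longrightarrow> bent \<G>)"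
proof -
  have "\<exists>P Q. cyc (a * b) P \<and> cyc (a * b) Q \<and> \<Union>P = V \<times> W \<and> \<Union>Q = V \<times> W \<and> P \<inter> Q = {} \<and>
      P \<union> Q = prod_edges V A W (\<beta> A) \<and> bent_square P Q" if "A \<in> \<A>" for A
  proof -
    have "\<beta> A \<in> \<B>" using \<beta> that by (auto simp: bij_betw_def)
    then have 1: "cyc a A" "\<Union>A = V" "cyc b (\<beta> A)" "\<Union>(\<beta> A) = W" using A B that by blast+
    show ?thesis using ham_pair[OF 1(1,3) a b] unfolding 1(2,4) by metis
  qed
  then obtain P Q where PQ: "\<And>A. A \<in> \<A> \<Longrightarrow> cyc (a * b) (P A) \<and> cyc (a * b) (Q A) \<and> \<Union>(P A) = V \<times> W \<and> \<Union>(Q A) = V \<times> W \<and> P A \<inter> Q A = {} \<and>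
      P A \<union> Q A = prod_edges V A W (\<beta> A) \<and> bent_square (P A) (Q A)" by metis
  show ?thesis
  proof (intro exI[of _ "P ` \<A> \<union> Q ` \<A>"] conjI ballI impI)
    show "cyc (a * b) G" "\<Union>G = V \<times> W" if G: "G \<in> P ` \<A> \<union> Q ` \<A>" for G
    proof -
      obtain A where "A \<in> \<A>" "G = P A \<or> G = Q A" using G by auto
      then show "cyc (a * b) G" "\<Union>G = V \<times> W" using PQ[OF \<open>A \<in> \<A>\<close>] by (elim disjE, simp_all)+
    qed
    have cross: "prod_edges V X W (\<beta> X) \<inter> prod_edges V Y W (\<beta> Y) = {}" if "X \<in> \<A>" "Y \<in> \<A>" "X \<noteq> Y" for X Y
    proof (rule prod_edges_disjoint)
      show "X \<inter> Y = {}" using dA that by (auto simp: pairwise_def disjnt_def)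
      have "\<beta> X \<noteq> \<beta> Y" "\<beta> X \<in> \<B>" "\<beta> Y \<in> \<B>" using \<beta> that by (auto simp: bij_betw_def inj_on_def)
      then show "\<beta> X \<inter> \<beta> Y = {}" using dB by (auto simp: pairwise_def disjnt_def)
      show "card e = 2" if "e \<in> X \<union> Y" for e using that A \<open>X \<in> \<A>\<close> \<open>Y \<in> \<A>\<close> cyc_edge_card by blast
      show "card e = 2" if "e \<in> \<beta> X \<union> \<beta> Y" for e using that B \<open>\<beta> X \<in> \<B>\<close> \<open>\<beta> Y \<in> \<B>\<close> cyc_edge_card by blast
    qed
    show "pairwise disjnt (P ` \<A> \<union> Q ` \<A>)"
    proof (rule pairwiseI)
      fix G H assume GH: "G \<in> P ` \<A> \<union> Q ` \<A>" "H \<in> P ` \<A> \<union> Q ` \<A>" "G \<noteq> H"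
      obtain X where X: "X \<in> \<A>" "G = P X \<or> G = Q X" using GH by auto
      obtain Y where Y: "Y \<in> \<A>" "H = P Y \<or> H = Q Y" using GH by auto
      show "disjnt G H"
      proof (cases "X = Y")
        case True
        have "P X \<inter> Q X = {}" using PQ[OF X(1)] by simp
        then show ?thesis using X(2) Y(2) GH(3) True by (auto simp: disjnt_def)
      next
        case False
        have "P X \<union> Q X = prod_edges V X W (\<beta> X)" "P Y \<union> Q Y = prod_edges V Y W (\<beta> Y)"
          using PQ[OF X(1)] PQ[OF Y(1)] by simp_all
        then have "G \<subseteq> prod_edges V X W (\<beta> X)" "H \<subseteq> prod_edges V Y W (\<beta> Y)" using X(2) Y(2) by blast+
        then show ?thesis using cross[OF X(1) Y(1) False] by (auto simp: disjnt_def)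
      qed
    qed
    have "\<Union>(P ` \<A> \<union> Q ` \<A>) = (\<Union>A\<in>\<A>. P A \<union> Q A)" by blast
    also have "\<dots> = (\<Union>A\<in>\<A>. prod_edges V A W (\<beta> A))" using PQ by simp
    also have "\<dots> = prod_edges V (\<Union>\<A>) W (\<Union>\<B>)"
      using prod_edges_Union[of V "\<lambda>A. A" \<A> W \<beta>] bij_betw_imp_surj_on[OF \<beta>] by simp
    finally show "\<Union>(P ` \<A> \<union> Q ` \<A>) = prod_edges V (\<Union>\<A>) W (\<Union>\<B>)" .
    assume "\<A> \<noteq> {}"
    then obtain A where A: "A \<in> \<A>" by auto
    then have "P A \<noteq> {}" using PQ[OF A] cyc_nonempty[of "a * b" "P A"] by simp
    moreover have "P A \<inter> Q A = {}" "bent_square (P A) (Q A)" using PQ[OF A] by simp_all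
    ultimately have "P A \<noteq> Q A" "bent_square (P A) (Q A)" by auto
    then show "bent (P ` \<A> \<union> Q ` \<A>)" unfolding bent_def using A
      by (intro bexI[of _ "P A"] bexI[of _ "Q A"] conjI) simp_all
  qed
qed

lemma card_ham_dec:
  assumes "ham_dec (cube n) (cube_edges n) \<G>" shows "2 * card \<G> = n" "finite \<G>"
proof -
  have d: "pairwise disjnt \<G>" and c: "\<And>A. A \<in> \<G> \<Longrightarrow> cyc (2 ^ n) A" and U: "\<Union>\<G> = cube_edges n"
    using assms by (auto simp: ham_dec_def)
  have "finite (\<Union>\<G>)" using U finite_cube_edges by simp
  then show "finite \<G>" by (rule finite_UnionD)
  have "card (\<Union>\<G>) = (\<Sum>A\<in>\<G>. card A)"
    by (rule card_Union_disjoint[OF d]) (use c cyc_finite in blast)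
  also have "\<dots> = (\<Sum>A\<in>\<G>. 2 ^ n)" by (rule sum.cong) (use c cyc_card in blast)+
  also have "\<dots> = card \<G> * 2 ^ n" by simp
  finally have "2 * card \<G> * 2 ^ n = n * 2 ^ n" using card_cube_edges[of n] U by simp
  then show "2 * card \<G> = n" by simp
qed

lemma ham_append:
  assumes G: "\<And>G. G \<in> \<G> \<Longrightarrow> cyc (2 ^ m * 2 ^ n) G \<and> \<Union>G = cube m \<times> cube n" and d: "pairwise disjnt \<G>"
    and U: "\<Union>\<G> = prod_edges (cube m) (cube_edges m) (cube n) (cube_edges n)"
  shows "ham_dec (cube (m + n)) (cube_edges (m + n)) ((`) ((`) append_pair) ` \<G>)"
    "bent \<G> \<Longrightarrow> bent ((`) ((`) append_pair) ` \<G>)"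
proof -
  let ?f = "(`) append_pair"
  have inj: "inj_on ?f (\<Union>\<G>)" unfolding U by (rule append_pair_edges_inj)
  have "cyc (card (cube (m + n))) (?f ` A) \<and> \<Union>(?f ` A) = cube (m + n)" if "A \<in> \<G>" for A
  proof
    have "inj_on append_pair (\<Union>A)" using G[OF that] append_pair_inj by simp
    then show "cyc (card (cube (m + n))) (?f ` A)" using cyc_image[of "2 ^ m * 2 ^ n" A append_pair] G[OF that] by (simp add: power_add)
    have "\<Union>(?f ` A) = append_pair ` (\<Union>A)" by blast
    then show "\<Union>(?f ` A) = cube (m + n)" using G[OF that] append_pair_image by simp
  qed
  moreover have dj: "?f ` A \<inter> ?f ` B = {}" if "A \<in> \<G>" "B \<in> \<G>" "A \<noteq> B" for A B
  proof -
    have "A \<inter> B = {}" using d that by (auto simp: pairwise_def disjnt_def)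
    moreover have "?f ` (A \<inter> B) = ?f ` A \<inter> ?f ` B"
      by (rule inj_on_image_Int[OF inj]) (use that in auto)
    ultimately show ?thesis by simp
  qed
  have "pairwise disjnt ((`) ?f ` \<G>)"
  proof (rule pairwiseI)
    fix X Y assume "X \<in> (`) ?f ` \<G>" "Y \<in> (`) ?f ` \<G>" "X \<noteq> Y"
    then obtain A B where "A \<in> \<G>" "B \<in> \<G>" "X = ?f ` A" "Y = ?f ` B" "A \<noteq> B" by auto
    then show "disjnt X Y" using dj unfolding disjnt_def by blast
  qed
  moreover have "\<Union>((`) ?f ` \<G>) = cube_edges (m + n)"
  proof -
    have "\<Union>((`) ?f ` \<G>) = ?f ` (\<Union>\<G>)" by blast
    then show ?thesis using U append_pair_edges by simp
  qed
  ultimately show "ham_dec (cube (m + n)) (cube_edges (m + n)) ((`) ?f ` \<G>)"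
    unfolding ham_dec_def by blast
  assume "bent \<G>"
  then obtain A B where AB: "A \<in> \<G>" "B \<in> \<G>" "A \<noteq> B" "bent_square A B" unfolding bent_def by auto
  have "bent_square (?f ` A) (?f ` B)" using bent_square_image[OF AB(4), of append_pair] G[OF AB(1)] append_pair_inj by simp
  moreover have "A \<noteq> {}" using G[OF AB(1)] cyc_nonempty by blast
  then have "?f ` A \<noteq> ?f ` B" using dj[OF AB(1-3)] by auto
  ultimately show "bent ((`) ?f ` \<G>)" unfolding bent_def using AB(1,2)
    by (intro bexI[of _ "?f ` A"] bexI[of _ "?f ` B"] conjI) simp_all
qed

lemma ham_dec_square: "ham_dec (cube 2) (cube_edges 2) {cube_edges 2}"
proof -
  define vs where "vs = [[False, False], [False, True], [True, True], [True, False]]"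
  define d where "d i = vs ! nat (i mod 4)" for i
  have dist: "distinct vs" "length vs = 4" by (auto simp: vs_def)
  have "d i = d j \<longleftrightarrow> i mod 4 = j mod 4" for i j
    unfolding d_def using nth_eq_iff_index_eq[OF dist(1), of "nat (i mod 4)" "nat (j mod 4)"] dist(2)
    by (auto simp: nat_less_iff)
  then have cm: "cycle_map 4 d" by (simp add: cycle_map_def)
  define K where "K = range (\<lambda>i. {d i, d (i + 1)})"
  have K: "cyc 4 K" using cm unfolding cyc_def K_def by blast
  have ds: "card (diff_set [p, q] [r, t]) = of_bool (p \<noteq> r) + of_bool (q \<noteq> t)" for p q r t
  proof -
    have "diff_set [x] [y] = (if x = y then {} else {0})" for x y by (auto simp: diff_set_def)
    then show ?thesis using diff_set_append[of "[p]" "[r]" "[q]" "[t]"] by simp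
  qed
  have "{d i, d (i + 1)} \<in> cube_edges 2" for i
  proof -
    have "i mod 4 \<in> {0, 1, 2, 3}" by auto
    moreover have "(i + 1) mod 4 = (i mod 4 + 1) mod 4" by (simp add: mod_add_left_eq)
    ultimately show ?thesis unfolding d_def vs_def by (auto simp: cube_edges_iff cube_def ds)
  qed
  then have sub: "K \<subseteq> cube_edges 2" by (auto simp: K_def)
  have "card (cube_edges 2) = 4" using card_cube_edges[of 2] by simp
  then have eq: "K = cube_edges 2" using sub K cyc_card card_subset_eq[OF finite_cube_edges sub] by metis
  have "\<Union>K \<subseteq> cube 2" using eq cube_edge_subset by blast
  moreover have "card (\<Union>K) = card (cube 2)" using cyc_card_Union(1)[OF K] by simp
  ultimately have "\<Union>K = cube 2" by (simp add: card_subset_eq)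
  then show ?thesis using K eq by (simp add: ham_dec_def)
qed

text \<open>For \<open>m = 2 * p\<close> two equal cubes are matched. For
  \<open>m = 2 * k + 1\<close> the cubes of dimensions \<open>2 * (k + 1)\<close> and
  \<open>2 * k\<close> have \<open>k + 1\<close> and \<open>k\<close> Hamilton cycles, one too many
  for a matching: a bent pair \<open>F\<close>, \<open>G\<close> is combined with a single cycle
  \<open>C\<close> into three Hamilton cycles, and the remaining \<open>k - 1\<close> cycles on each
  side are matched. The square has only one Hamilton cycle, so \<open>bent\<close> can start at
  \<open>m = 2\<close>; this is enough, as \<open>k + 1\<close> is at least 2.\<close>

theorem ham_dec_cube:
  assumes "1 \<le> m"
  shows "\<exists>\<G>. ham_dec (cube (2 * m)) (cube_edges (2 * m)) \<G> \<and> (2 \<le> m \<longrightarrow> bent \<G>)"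
  using assms
proof (induction m rule: less_induct)
  case (less m)
  have pow: "even ((2 :: nat) ^ (2 * p))" "(4 :: nat) \<le> 2 ^ (2 * p)" if "1 \<le> p" for p
    using that power_increasing[of 2 "2 * p" "2 :: nat"] by auto
  consider "m = 1" | p where "m = 2 * p" "1 \<le> p" | k where "m = 2 * k + 1" "1 \<le> k"
    using less.prems by (metis One_nat_def add_0 evenE less_one linorder_not_le mult_0_right oddE)
  then show ?case
  proof cases
    case 1
    then show ?thesis using ham_dec_square by auto
  next
    case 2
    then obtain \<H> where \<H>: "ham_dec (cube (2 * p)) (cube_edges (2 * p)) \<H>" using less.IH[of p] by auto
    have ne: "\<H> \<noteq> {}" using card_ham_dec(1)[OF \<H>] 2 by auto
    have H: "pairwise disjnt \<H>" "\<And>A. A \<in> \<H> \<Longrightarrow> cyc (2 ^ (2 * p)) A \<and> \<Union>A = cube (2 * p)" "\<Union>\<H> = cube_edges (2 * p)"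
      using \<H> by (auto simp: ham_dec_def)
    have "\<exists>\<G>. (\<forall>G\<in>\<G>. cyc (2 ^ (2 * p) * 2 ^ (2 * p)) G \<and> \<Union>G = cube (2 * p) \<times> cube (2 * p)) \<and> pairwise disjnt \<G> \<and>
      \<Union>\<G> = prod_edges (cube (2 * p)) (\<Union>\<H>) (cube (2 * p)) (\<Union>\<H>) \<and> (\<H> \<noteq> {} \<longrightarrow> bent \<G>)"
    proof (rule ham_pairs[OF bij_betw_id H(1,1)])
      show "cyc (2 ^ (2 * p)) A \<and> \<Union>A = cube (2 * p)" if "A \<in> \<H>" for A using H(2) that .
      then show "cyc (2 ^ (2 * p)) A \<and> \<Union>A = cube (2 * p)" if "A \<in> \<H>" for A using that .
    qed (rule pow[OF 2(2)])+
    then obtain \<G> where \<G>: "\<And>G. G \<in> \<G> \<Longrightarrow> cyc (2 ^ (2 * p) * 2 ^ (2 * p)) G \<and> \<Union>G = cube (2 * p) \<times> cube (2 * p)" "pairwise disjnt \<G>"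
      "\<Union>\<G> = prod_edges (cube (2 * p)) (\<Union>\<H>) (cube (2 * p)) (\<Union>\<H>)" "\<H> \<noteq> {} \<Longrightarrow> bent \<G>" by metis
    have "2 * m = 2 * p + 2 * p" using 2 by simp
    then show ?thesis using ham_append[OF \<G>(1,2) \<G>(3)[unfolded H(3)]] \<G>(4)[OF ne] by metis
  next
    case 3
    obtain \<H> where \<H>: "ham_dec (cube (2 * k)) (cube_edges (2 * k)) \<H>" using less.IH[of k] 3 by auto
    have H: "pairwise disjnt \<H>" "\<And>A. A \<in> \<H> \<Longrightarrow> cyc (2 ^ (2 * k)) A \<and> \<Union>A = cube (2 * k)" "\<Union>\<H> = cube_edges (2 * k)"
      using \<H> by (auto simp: ham_dec_def)
    have cH: "card \<H> = k" "finite \<H>" using card_ham_dec[OF \<H>] by auto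
    define n where "n = 2 * (k + 1)"
    have "\<exists>\<A>. ham_dec (cube n) (cube_edges n) \<A> \<and> bent \<A>" using less.IH[of "k + 1"] 3 unfolding n_def by auto
    then obtain \<A> where \<A>: "ham_dec (cube n) (cube_edges n) \<A>" "bent \<A>" by blast
    have A: "pairwise disjnt \<A>" "\<And>A. A \<in> \<A> \<Longrightarrow> cyc (2 ^ n) A \<and> \<Union>A = cube n" "\<Union>\<A> = cube_edges n"
      using \<A> by (auto simp: ham_dec_def)
    have cA: "card \<A> = k + 1" "finite \<A>" using card_ham_dec[OF \<A>(1)] n_def by auto
    obtain C where C: "C \<in> \<H>" using cH 3 by (metis card.empty ex_in_conv not_one_le_zero)
    obtain F G where FG: "F \<in> \<A>" "G \<in> \<A>" "F \<noteq> G" "bent_square F G" using \<A>(2) by (auto simp: bent_def)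
    have FGd: "F \<inter> G = {}" using A(1) FG by (auto simp: pairwise_def disjnt_def)
    have pn: "even ((2 :: nat) ^ n)" "(6 :: nat) \<le> 2 ^ n" "(4 :: nat) \<le> 2 ^ n"
      using power_increasing[of 4 n "2 :: nat"] 3 by (auto simp: n_def)
    obtain R B Y where T: "cyc (2 ^ n * 2 ^ (2 * k)) R" "cyc (2 ^ n * 2 ^ (2 * k)) B" "cyc (2 ^ n * 2 ^ (2 * k)) Y"
      "\<Union>R = \<Union>F \<times> \<Union>C" "\<Union>B = \<Union>F \<times> \<Union>C" "\<Union>Y = \<Union>F \<times> \<Union>C"
      "R \<inter> B = {}" "R \<inter> Y = {}" "B \<inter> Y = {}"
      "R \<union> B \<union> Y = prod_edges (\<Union>F) (F \<union> G) (\<Union>C) C"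
      "bent_square B R"
    proof (rule triple_product)
      show "cyc (2 ^ (2 * k)) C" "cyc (2 ^ n) F" "cyc (2 ^ n) G" "\<Union>F = \<Union>G"
        using H(2)[OF C] A(2)[OF FG(1)] A(2)[OF FG(2)] by simp_all
    qed ((rule FGd FG(4) pn pow[OF 3(2)])+, (rule that; assumption))
    have UF: "\<Union>F = cube n" and UC: "\<Union>C = cube (2 * k)" using A(2)[OF FG(1)] H(2)[OF C] by auto
    have TE: "R \<union> B \<union> Y = prod_edges (cube n) (F \<union> G) (cube (2 * k)) C"
      using T(10) unfolding UF UC .
    have "card (\<A> - {F, G}) = card (\<H> - {C})" using cA cH FG C by (simp add: card_Diff_subset)
    then obtain \<beta> where \<beta>: "bij_betw \<beta> (\<A> - {F, G}) (\<H> - {C})"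
      using finite_same_card_bij cA(2) cH(2) by (metis finite_Diff)
    have d': "pairwise disjnt (\<A> - {F, G})" "pairwise disjnt (\<H> - {C})" using A(1) H(1) by (auto simp: pairwise_def)
    have "\<exists>\<G>. (\<forall>G\<in>\<G>. cyc (2 ^ n * 2 ^ (2 * k)) G \<and> \<Union>G = cube n \<times> cube (2 * k)) \<and> pairwise disjnt \<G> \<and>
      \<Union>\<G> = prod_edges (cube n) (\<Union>(\<A> - {F, G})) (cube (2 * k)) (\<Union>(\<H> - {C})) \<and> (\<A> - {F, G} \<noteq> {} \<longrightarrow> bent \<G>)"
    proof (rule ham_pairs[OF \<beta> d'])
      show "cyc (2 ^ n) A \<and> \<Union>A = cube n" if "A \<in> \<A> - {F, G}" for A using A(2) that by simp
      show "cyc (2 ^ (2 * k)) A \<and> \<Union>A = cube (2 * k)" if "A \<in> \<H> - {C}" for A using H(2) that by simp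
    qed (rule pn pow(1)[OF 3(2)])+
    then obtain \<G> where \<G>: "\<And>G. G \<in> \<G> \<Longrightarrow> cyc (2 ^ n * 2 ^ (2 * k)) G \<and> \<Union>G = cube n \<times> cube (2 * k)" "pairwise disjnt \<G>"
      "\<Union>\<G> = prod_edges (cube n) (\<Union>(\<A> - {F, G})) (cube (2 * k)) (\<Union>(\<H> - {C}))" by metis
    have ts: "prod_edges (cube n) (\<Union>(\<A> - {F, G})) (cube (2 * k)) (\<Union>(\<H> - {C})) \<inter> prod_edges (cube n) (F \<union> G) (cube (2 * k)) C = {}"
    proof (rule prod_edges_disjoint)
      show "\<Union>(\<A> - {F, G}) \<inter> (F \<union> G) = {}" using A(1) FG unfolding pairwise_def disjnt_def by blast
      show "\<Union>(\<H> - {C}) \<inter> C = {}" using H(1) C unfolding pairwise_def disjnt_def by blast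
      show "card e = 2" if "e \<in> \<Union>(\<A> - {F, G}) \<union> (F \<union> G)" for e
        by (rule cube_edge_card[of _ n]) (use that A(3) FG in blast)
      show "card e = 2" if "e \<in> \<Union>(\<H> - {C}) \<union> C" for e
        by (rule cube_edge_card[of _ "2 * k"]) (use that H(3) C in blast)
    qed
    have far: "X \<inter> Z = {}" if "X \<in> \<G>" "Z \<in> {R, B, Y}" for X Z
    proof -
      have "X \<subseteq> \<Union>\<G>" "Z \<subseteq> R \<union> B \<union> Y" using that by auto
      then show ?thesis using ts unfolding \<G>(3)[symmetric] TE[symmetric] by blast
    qed
    define \<K> where "\<K> = \<G> \<union> {R, B, Y}"
    have K1: "cyc (2 ^ n * 2 ^ (2 * k)) X \<and> \<Union>X = cube n \<times> cube (2 * k)" if "X \<in> \<K>" for X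
      using that \<G>(1) T(1-6) UF UC unfolding \<K>_def by auto
    have K2: "pairwise disjnt \<K>"
    proof (rule pairwiseI)
      fix X Z assume XZ: "X \<in> \<K>" "Z \<in> \<K>" "X \<noteq> Z"
      then consider "X \<in> \<G>" "Z \<in> \<G>" | "X \<in> \<G>" "Z \<in> {R, B, Y}" | "X \<in> {R, B, Y}" "Z \<in> \<G>" | "X \<in> {R, B, Y}" "Z \<in> {R, B, Y}"
        unfolding \<K>_def by blast
      then show "disjnt X Z"
      proof cases
        case 1 then show ?thesis using \<G>(2) XZ by (auto simp: pairwise_def)
      next
        case 2 then show ?thesis using far unfolding disjnt_def by blast
      next
        case 3 then show ?thesis using far[of Z X] unfolding disjnt_def by blast
      next
        case 4 then show ?thesis using T(7-9) XZ(3) unfolding disjnt_def by (elim insertE emptyE) (simp_all add: Int_commute)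
      qed
    qed
    have "\<Union>\<K> = \<Union>\<G> \<union> (R \<union> B \<union> Y)" unfolding \<K>_def by blast
    also have "\<dots> = prod_edges (cube n) (\<Union>(\<A> - {F, G}) \<union> (F \<union> G)) (cube (2 * k)) (\<Union>(\<H> - {C}) \<union> C)"
      unfolding \<G>(3) TE prod_edges_Un ..
    also have "\<Union>(\<A> - {F, G}) \<union> (F \<union> G) = cube_edges n" using A(3) FG by blast
    also have "\<Union>(\<H> - {C}) \<union> C = cube_edges (2 * k)" using H(3) C by blast
    finally have K3: "\<Union>\<K> = prod_edges (cube n) (cube_edges n) (cube (2 * k)) (cube_edges (2 * k))" .
    have "B \<noteq> {}" using T(2) cyc_nonempty by blast
    then have "B \<noteq> R" using T(7) by auto
    then have "bent \<K>" using T(11) unfolding bent_def \<K>_def by blast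
    moreover have "2 * m = n + 2 * k" using 3 n_def by simp
    ultimately show ?thesis using ham_append[OF K1 K2 K3] by metis
  qed
qed

section \<open>Equitably coloured 2-factorizations\<close>

definition two_factor :: "'a set \<Rightarrow> nat \<Rightarrow> 'a set set set \<Rightarrow> bool" where
  "two_factor V l \<K> \<longleftrightarrow> (\<forall>K\<in>\<K>. cyc l K \<and> \<Union>K \<subseteq> V) \<and> (\<forall>v\<in>V. \<exists>!K. K \<in> \<K> \<and> v \<in> \<Union>K)"

definition equitable :: "nat \<Rightarrow> ('a \<Rightarrow> nat) \<Rightarrow> 'a set \<Rightarrow> bool" where
  "equitable M \<phi> U \<longleftrightarrow> (\<forall>u\<in>U. \<phi> u < M) \<and> (\<forall>r<M. card {u \<in> U. \<phi> u = r} * M = card U)"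

text \<open>The \<open>h\<close> 2-factors \<open>F 0, \<dots>, F (h - 1)\<close> consist of cycles of length \<open>l\<close> and partition the edge set \<open>E\<close>.\<close>

definition factorization :: "'a set \<Rightarrow> 'a set set \<Rightarrow> nat \<Rightarrow> nat \<Rightarrow> nat \<Rightarrow> ('a \<Rightarrow> nat) \<Rightarrow> (nat \<Rightarrow> 'a set set set) \<Rightarrow> bool" where
  "factorization V E h l M \<phi> F \<longleftrightarrow>
     (\<forall>f<h. two_factor V l (F f) \<and> (\<forall>K\<in>F f. equitable M \<phi> (\<Union>K))) \<and>
     (\<forall>f<h. \<forall>f'<h. f \<noteq> f' \<longrightarrow> \<Union>(F f) \<inter> \<Union>(F f') = {}) \<and> (\<Union>f<h. \<Union>(F f)) = E"

lemma equitable_inj_image: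
  assumes "inj_on f U" "equitable M (\<lambda>u. \<phi> (f u)) U"
  shows "equitable M \<phi> (f ` U)"
proof -
  have "{v \<in> f ` U. \<phi> v = r} = f ` {u \<in> U. \<phi> (f u) = r}" for r by auto
  moreover have "inj_on f {u \<in> U. \<phi> (f u) = r}" for r using assms(1) by (rule inj_on_subset) auto
  ultimately show ?thesis using assms by (simp add: equitable_def card_image)
qed

lemma equitable_cong: "(\<And>u. u \<in> U \<Longrightarrow> \<phi> u = \<psi> u) \<Longrightarrow> equitable M \<phi> U \<longleftrightarrow> equitable M \<psi> U"
proof -
  assume *: "\<And>u. u \<in> U \<Longrightarrow> \<phi> u = \<psi> u"
  then have "{u \<in> U. \<phi> u = r} = {u \<in> U. \<psi> u = r}" for r by auto
  then show ?thesis using * by (simp add: equitable_def)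
qed

lemma equitable_shift:
  assumes "equitable M \<phi> U" "0 < M"
  shows "equitable M (\<lambda>u. (\<phi> u + c) mod M) U"
  unfolding equitable_def
proof (intro conjI ballI allI impI)
  fix r assume r: "r < M"
  \<comment> \<open>The colour that the shift moves to \<open>r\<close>; the term
    \<open>M - c mod M\<close> is the additive inverse of \<open>c\<close> modulo
    \<open>M\<close>.\<close>
  define r' where "r' = (r + (M - c mod M)) mod M"
  have "(a + c) mod M = r \<longleftrightarrow> a = r'" if "a < M" for a
  proof -
    have c: "c mod M < M" using assms(2) by simp
    have cM: "c + (M - c mod M) = M * (c div M + 1)" using c mult_div_mod_eq[of M c] by (simp only: distrib_left mult_1_right)
    have 1: "(r' + c) mod M = r"
    proof -
      have "(r' + c) mod M = (r + (M - c mod M) + c) mod M" unfolding r'_def by (rule mod_add_left_eq)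
      also have "r + (M - c mod M) + c = r + M * (c div M + 1)" using cM by simp
      finally show ?thesis using r by (simp only: mod_mult_self2 mod_less)
    qed
    have "a = r'" if "(a + c) mod M = r"
    proof -
      have "r' = ((a + c) mod M + (M - c mod M)) mod M" unfolding r'_def that ..
      also have "\<dots> = (a + c + (M - c mod M)) mod M" by (rule mod_add_left_eq)
      also have "a + c + (M - c mod M) = a + M * (c div M + 1)" using cM by simp
      finally show ?thesis using \<open>a < M\<close> by (simp only: mod_mult_self2 mod_less)
    qed
    then show ?thesis using 1 by blast
  qed
  then have "{u \<in> U. (\<phi> u + c) mod M = r} = {u \<in> U. \<phi> u = r'}" using assms(1) by (auto simp: equitable_def)
  moreover have "r' < M" using assms(2) by (simp add: r'_def)
  ultimately show "card {u \<in> U. (\<phi> u + c) mod M = r} * M = card U" using assms(1) by (simp add: equitable_def)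
qed (use assms in auto)

lemma equitable_Times:
  assumes "equitable M \<phi> U" "equitable N \<psi> W"
  shows "equitable (M * N) (\<lambda>(u, w). \<phi> u + M * \<psi> w) (U \<times> W)"
  unfolding equitable_def
proof (intro conjI ballI allI impI)
  fix x assume "x \<in> U \<times> W"
  then obtain u w where x: "x = (u, w)" "\<phi> u < M" "\<psi> w < N" using assms by (auto simp: equitable_def)
  then have "\<phi> u + M * \<psi> w < M * Suc (\<psi> w)" by simp
  also have "\<dots> \<le> M * N" using x by (intro mult_le_mono2) simp
  finally show "(case x of (u, w) \<Rightarrow> \<phi> u + M * \<psi> w) < M * N" using x by simp
next
  fix r assume r: "r < M * N"
  then have M: "0 < M" by (metis gr0I mult_0 not_less_zero)
  have "\<phi> u + M * \<psi> w = r \<longleftrightarrow> \<phi> u = r mod M \<and> \<psi> w = r div M" if "u \<in> U" for u w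
  proof -
    have "\<phi> u < M" using assms(1) that by (auto simp: equitable_def)
    then show ?thesis using M by auto
  qed
  then have "{x \<in> U \<times> W. (case x of (u, w) \<Rightarrow> \<phi> u + M * \<psi> w) = r} = {u \<in> U. \<phi> u = r mod M} \<times> {w \<in> W. \<psi> w = r div M}"
    by auto
  moreover have "r mod M < M" "r div M < N" using M r by (simp_all add: div_less_iff_less_mult mult.commute)
  moreover from this have "card U = card {u \<in> U. \<phi> u = r mod M} * M" "card W = card {w \<in> W. \<psi> w = r div M} * N"
    using assms by (simp_all add: equitable_def)
  ultimately show "card {x \<in> U \<times> W. (case x of (u, w) \<Rightarrow> \<phi> u + M * \<psi> w) = r} * (M * N) = card (U \<times> W)"
    by (simp only: card_cartesian_product mult_ac)
qed

text \<open>Any numbering of a finite set gives equitable colourings for all divisors of its size.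
  Since Hamilton cycles share one vertex set, a single numbering serves all of them.\<close>

lemma equitable_mod:
  assumes "bij_betw \<beta> U {..<n}" "s dvd n" "0 < s"
  shows "equitable s (\<lambda>u. \<beta> u mod s) U"
  unfolding equitable_def
proof (intro conjI ballI allI impI)
  fix r assume r: "r < s"
  have "card {u \<in> U. \<beta> u mod s = r} = card {k \<in> {..<n}. k mod s = r}"
  proof (rule bij_betw_same_card)
    show "bij_betw \<beta> {u \<in> U. \<beta> u mod s = r} {k \<in> {..<n}. k mod s = r}"
      using assms(1) unfolding bij_betw_def by (auto simp: inj_on_def)
  qed
  also have "\<dots> = card (int ` {k \<in> {..<n}. k mod s = r})" by (simp add: card_image)
  also have "int ` {k \<in> {..<n}. k mod s = r} = {w \<in> {0..<int n}. int s dvd w - int r}"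
  proof -
    have "k mod s = r \<longleftrightarrow> int s dvd int k - int r" for k
      using r by (metis mod_eq_dvd_iff mod_less of_nat_eq_iff zmod_int)
    then show ?thesis by (auto simp: image_iff Bex_def) (metis nat_less_iff int_nat_eq)
  qed
  also have "card \<dots> = n div s" using card_residue_class assms by blast
  finally show "card {u \<in> U. \<beta> u mod s = r} * s = card U"
    using assms bij_betw_same_card[OF assms(1)] by simp
qed (use assms in auto)

lemma lessThan_add_split: "{..<h + k} = {..<h} \<union> (+) h ` {..<k :: nat}"
proof -
  have *: "x \<in> (+) h ` {..<k}" if "h \<le> x" "x < h + k" for x
    using that by (intro image_eqI[of _ _ "x - h"]) auto
  then show ?thesis
  proof (intro equalityI subsetI)
    fix x assume "x \<in> {..<h + k}"
    then show "x \<in> {..<h} \<union> (+) h ` {..<k}" using * by (cases "x < h") auto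
  qed auto
qed

lemma factorizationD:
  assumes "factorization V E h l M \<phi> F"
  shows "f < h \<Longrightarrow> two_factor V l (F f)" "f < h \<Longrightarrow> K \<in> F f \<Longrightarrow> equitable M \<phi> (\<Union>K)"
    "f < h \<Longrightarrow> f' < h \<Longrightarrow> f \<noteq> f' \<Longrightarrow> \<Union>(F f) \<inter> \<Union>(F f') = {}" "(\<Union>f<h. \<Union>(F f)) = E"
proof -
  note A = assms[unfolded factorization_def]
  show "f < h \<Longrightarrow> two_factor V l (F f)" "f < h \<Longrightarrow> K \<in> F f \<Longrightarrow> equitable M \<phi> (\<Union>K)"
    using conjunct1[OF A] by simp_all
  show "f < h \<Longrightarrow> f' < h \<Longrightarrow> f \<noteq> f' \<Longrightarrow> \<Union>(F f) \<inter> \<Union>(F f') = {}"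
    using conjunct1[OF conjunct2[OF A]] by blast
  show "(\<Union>f<h. \<Union>(F f)) = E" by (rule conjunct2[OF conjunct2[OF A]])
qed

lemma two_factorD:
  assumes "two_factor V l \<K>"
  shows "K \<in> \<K> \<Longrightarrow> cyc l K" "K \<in> \<K> \<Longrightarrow> \<Union>K \<subseteq> V" "v \<in> V \<Longrightarrow> \<exists>K. K \<in> \<K> \<and> v \<in> \<Union>K"
    "K \<in> \<K> \<Longrightarrow> K' \<in> \<K> \<Longrightarrow> v \<in> \<Union>K \<Longrightarrow> v \<in> \<Union>K' \<Longrightarrow> K = K'"
proof -
  have 1: "\<And>K. K \<in> \<K> \<Longrightarrow> cyc l K \<and> \<Union>K \<subseteq> V" and 2: "\<And>v. v \<in> V \<Longrightarrow> \<exists>!K. K \<in> \<K> \<and> v \<in> \<Union>K"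
    by (rule bspec[OF conjunct1[OF assms[unfolded two_factor_def]]] bspec[OF conjunct2[OF assms[unfolded two_factor_def]]]; assumption)+
  show "K \<in> \<K> \<Longrightarrow> cyc l K" "K \<in> \<K> \<Longrightarrow> \<Union>K \<subseteq> V" using 1[of K] by simp_all
  show "v \<in> V \<Longrightarrow> \<exists>K. K \<in> \<K> \<and> v \<in> \<Union>K" using 2 by (rule ex1_implies_ex)
  show "K = K'" if a: "K \<in> \<K>" "K' \<in> \<K>" "v \<in> \<Union>K" "v \<in> \<Union>K'"
  proof -
    have "v \<in> V" by (rule subsetD[OF conjunct2[OF 1[OF a(1)]] a(3)])
    then obtain X where "\<And>Y. Y \<in> \<K> \<and> v \<in> \<Union>Y \<Longrightarrow> Y = X" using 2 by (metis (no_types, lifting))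
    then show ?thesis using a by metis
  qed
qed

lemma two_factorI:
  assumes "\<And>K. K \<in> \<K> \<Longrightarrow> cyc l K" "\<And>K. K \<in> \<K> \<Longrightarrow> \<Union>K \<subseteq> V" "\<And>v. v \<in> V \<Longrightarrow> \<exists>K. K \<in> \<K> \<and> v \<in> \<Union>K"
    "\<And>K K' v. K \<in> \<K> \<Longrightarrow> K' \<in> \<K> \<Longrightarrow> v \<in> \<Union>K \<Longrightarrow> v \<in> \<Union>K' \<Longrightarrow> K = K'"
  shows "two_factor V l \<K>"
  unfolding two_factor_def
proof (intro conjI ballI)
  fix v assume "v \<in> V"
  then obtain K where K: "K \<in> \<K> \<and> v \<in> \<Union>K" using assms(3) by blast
  then show "\<exists>!K. K \<in> \<K> \<and> v \<in> \<Union>K"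
  proof (rule ex1I)
    fix K' assume "K' \<in> \<K> \<and> v \<in> \<Union>K'"
    then show "K' = K" using assms(4)[of K' K v] K by blast
  qed
qed (rule assms; assumption)+

lemma factorization_card_edge:
  assumes "factorization V E h l M \<phi> F" "f < h" "e \<in> \<Union>(F f)"
  shows "card e = 2"
  using assms cyc_edge_card factorizationD(1) two_factorD(1) by (metis UnionE)

text \<open>Every 2-factor of one side is repeated at all vertices of the other side, so cycle
  lengths stay the same. On each copy one coordinate is constant, hence the colour
  \<open>(\<phi> u + \<psi> w) mod M\<close> is there a rotation of \<open>\<phi>\<close> or of
  \<open>\<psi>\<close> and remains equitable.\<close>

lemma factorization_copies:
  fixes V :: "'a set" and W :: "'b set"
  assumes F: "factorization V E h l M \<phi> F" and G: "factorization W E' k l M \<psi> G" and M: "0 < M"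
  shows "\<exists>H. factorization (V \<times> W) (prod_edges V E W E') (h + k) l M (\<lambda>(u, w). (\<phi> u + \<psi> w) mod M) H"
proof -
  define H where "H f = (if f < h then {(\<lambda>e. e \<times> {w}) ` K | K w. K \<in> F f \<and> w \<in> W}
    else {(\<lambda>e. {v} \<times> e) ` K | K v. K \<in> G (f - h) \<and> v \<in> V})" for f
  have im1: "(\<lambda>e. e \<times> {w}) = (`) (\<lambda>u. (u, w))" for w :: 'b and dummy :: 'a by (rule ext) auto
  have im2: "(\<lambda>e. {v} \<times> e) = (`) (\<lambda>w. (v, w))" for v :: 'a and dummy :: 'b by (rule ext) auto
  have UK1: "\<Union>((\<lambda>e. e \<times> {w}) ` K) = (\<lambda>u. (u, w)) ` (\<Union>K)" for K :: "'a set set" and w :: 'b by auto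
  have UK2: "\<Union>((\<lambda>e. {v} \<times> e) ` K) = (\<lambda>w. (v, w)) ` (\<Union>K)" for K :: "'b set set" and v :: 'a by auto
  have tf: "two_factor (V \<times> W) l (H f)" if "f < h + k" for f
  proof (cases "f < h")
    case True
    have HF: "H f = {(\<lambda>e. e \<times> {w}) ` K | K w. K \<in> F f \<and> w \<in> W}" using True by (simp add: H_def)
    note D = two_factorD[OF factorizationD(1)[OF F True]]
    show ?thesis
    proof (rule two_factorI)
      fix X assume "X \<in> H f"
      then obtain K w where X: "X = (\<lambda>e. e \<times> {w}) ` K" "K \<in> F f" "w \<in> W" unfolding HF by blast
      show "cyc l X" unfolding X(1) im1 by (rule cyc_image[OF D(1)[OF X(2)]]) (simp add: inj_on_def)
      show "\<Union>X \<subseteq> V \<times> W" unfolding X(1) UK1 using D(2)[OF X(2)] X(3) by auto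
    next
      fix x assume "x \<in> V \<times> W"
      then obtain v w where x: "x = (v, w)" "v \<in> V" "w \<in> W" by auto
      obtain K where "K \<in> F f" "v \<in> \<Union>K" using D(3)[OF x(2)] by blast
      then have "(\<lambda>e. e \<times> {w}) ` K \<in> H f" "x \<in> \<Union>((\<lambda>e. e \<times> {w}) ` K)"
        unfolding HF UK1 using x by auto
      then show "\<exists>X. X \<in> H f \<and> x \<in> \<Union>X" by blast
    next
      fix X Y x assume XY: "X \<in> H f" "Y \<in> H f" and x: "x \<in> \<Union>X" "x \<in> \<Union>Y"
      obtain K w where X: "X = (\<lambda>e. e \<times> {w}) ` K" "K \<in> F f" using XY(1) unfolding HF by blast
      obtain K' w' where Y: "Y = (\<lambda>e. e \<times> {w'}) ` K'" "K' \<in> F f" using XY(2) unfolding HF by blast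
      obtain u where "x = (u, w)" "u \<in> \<Union>K" using x(1) unfolding X UK1 by auto
      moreover obtain u' where "x = (u', w')" "u' \<in> \<Union>K'" using x(2) unfolding Y UK1 by auto
      ultimately have "w = w'" "K = K'" using D(4)[OF X(2) Y(2)] by auto
      then show "X = Y" using X Y by simp
    qed
  next
    case False
    then have fk: "f - h < k" using that by simp
    have HF: "H f = {(\<lambda>e. {v} \<times> e) ` K | K v. K \<in> G (f - h) \<and> v \<in> V}" using False by (simp add: H_def)
    note D = two_factorD[OF factorizationD(1)[OF G fk]]
    show ?thesis
    proof (rule two_factorI)
      fix X assume "X \<in> H f"
      then obtain K v where X: "X = (\<lambda>e. {v} \<times> e) ` K" "K \<in> G (f - h)" "v \<in> V" unfolding HF by blast
      show "cyc l X" unfolding X(1) im2 by (rule cyc_image[OF D(1)[OF X(2)]]) (simp add: inj_on_def)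
      show "\<Union>X \<subseteq> V \<times> W" unfolding X(1) UK2 using D(2)[OF X(2)] X(3) by auto
    next
      fix x assume "x \<in> V \<times> W"
      then obtain v w where x: "x = (v, w)" "v \<in> V" "w \<in> W" by auto
      obtain K where "K \<in> G (f - h)" "w \<in> \<Union>K" using D(3)[OF x(3)] by blast
      then have "(\<lambda>e. {v} \<times> e) ` K \<in> H f" "x \<in> \<Union>((\<lambda>e. {v} \<times> e) ` K)"
        unfolding HF UK2 using x by auto
      then show "\<exists>X. X \<in> H f \<and> x \<in> \<Union>X" by blast
    next
      fix X Y x assume XY: "X \<in> H f" "Y \<in> H f" and x: "x \<in> \<Union>X" "x \<in> \<Union>Y"
      obtain K w where X: "X = (\<lambda>e. {w} \<times> e) ` K" "K \<in> G (f - h)" using XY(1) unfolding HF by blast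
      obtain K' w' where Y: "Y = (\<lambda>e. {w'} \<times> e) ` K'" "K' \<in> G (f - h)" using XY(2) unfolding HF by blast
      obtain u where "x = (w, u)" "u \<in> \<Union>K" using x(1) unfolding X UK2 by auto
      moreover obtain u' where "x = (w', u')" "u' \<in> \<Union>K'" using x(2) unfolding Y UK2 by auto
      ultimately have "w = w'" "K = K'" using D(4)[OF X(2) Y(2)] by auto
      then show "X = Y" using X Y by simp
    qed
  qed
  have eq: "equitable M (\<lambda>(u, w). (\<phi> u + \<psi> w) mod M) (\<Union>X)" if "f < h + k" "X \<in> H f" for f X
  proof (cases "f < h")
    case True
    then obtain K w where X: "X = (\<lambda>e. e \<times> {w}) ` K" "K \<in> F f" using \<open>X \<in> H f\<close> by (auto simp: H_def)
    show ?thesis unfolding X(1) UK1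
      by (rule equitable_inj_image) (use equitable_shift[OF factorizationD(2)[OF F True X(2)] M] in \<open>auto simp: inj_on_def\<close>)
  next
    case False
    then have fk: "f - h < k" using that by simp
    obtain K v where X: "X = (\<lambda>e. {v} \<times> e) ` K" "K \<in> G (f - h)" using False \<open>X \<in> H f\<close> by (auto simp: H_def)
    show ?thesis unfolding X(1) UK2
      by (rule equitable_inj_image) (use equitable_shift[OF factorizationD(2)[OF G fk X(2)] M, of "\<phi> v"] in \<open>auto simp: inj_on_def add.commute\<close>)
  qed
  \<comment> \<open>Each new 2-factor comes from one side only. With the empty set on the other
    side, all of them have the form \<open>prod_edges\<close>, and its lemmas on unions and
    disjointness apply uniformly.\<close>
  define A where "A f = (if f < h then \<Union>(F f) else {})" for f
  define B where "B f = (if f < h then {} else \<Union>(G (f - h)))" for f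
  have UH: "\<Union>(H f) = prod_edges V (A f) W (B f)" for f
  proof (cases "f < h")
    case True
    have "\<Union>(H f) = {e \<times> {w} | e w. e \<in> \<Union>(F f) \<and> w \<in> W}" using True unfolding H_def by auto
    then show ?thesis using True unfolding prod_edges_def A_def B_def by simp
  next
    case False
    have "\<Union>(H f) = {{v} \<times> e | v e. v \<in> V \<and> e \<in> \<Union>(G (f - h))}" using False unfolding H_def by auto
    then show ?thesis using False unfolding prod_edges_def A_def B_def by simp
  qed
  have disj: "\<Union>(H f) \<inter> \<Union>(H f') = {}" if "f < h + k" "f' < h + k" "f \<noteq> f'" for f f'
    unfolding UH
  proof (rule prod_edges_disjoint)
    show "A f \<inter> A f' = {}" using factorizationD(3)[OF F, of f f'] that by (auto simp: A_def)
    have "f - h < k" if "f < h + k" "\<not> f < h" for f using that by simp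
    moreover have "f - h \<noteq> f' - h" if "\<not> f < h" "\<not> f' < h" using that \<open>f \<noteq> f'\<close> by simp
    ultimately show "B f \<inter> B f' = {}" using factorizationD(3)[OF G, of "f - h" "f' - h"] that by (auto simp: B_def)
    show "card e = 2" if "e \<in> A f \<union> A f'" for e
      using that factorization_card_edge[OF F] by (auto simp: A_def split: if_splits)
    show "card e = 2" if eB: "e \<in> B f \<union> B f'" for e
    proof -
      obtain i where "i < h + k" "e \<in> B i" using eB \<open>f < h + k\<close> \<open>f' < h + k\<close> by auto
      then have "i - h < k" "e \<in> \<Union>(G (i - h))" by (auto simp: B_def split: if_splits)
      then show ?thesis by (rule factorization_card_edge[OF G])
    qed
  qed
  have "(\<Union>f<h + k. \<Union>(H f)) = prod_edges V (\<Union>f<h + k. A f) W (\<Union>f<h + k. B f)"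
    unfolding UH prod_edges_Union ..
  moreover have "(\<Union>f<h + k. A f) = E" unfolding factorizationD(4)[OF F, symmetric] A_def lessThan_add_split by auto
  moreover have "(\<Union>f<h + k. B f) = E'"
  proof -
    have "(\<Union>f<h + k. B f) = (\<Union>f<h. B f) \<union> (\<Union>f<k. B (h + f))" unfolding lessThan_add_split by auto
    also have "(\<Union>f<h. B f) = {}" by (simp add: B_def)
    also have "(\<Union>f<k. B (h + f)) = E'" unfolding factorizationD(4)[OF G, symmetric] by (simp add: B_def)
    finally show ?thesis by simp
  qed
  ultimately have "(\<Union>f<h + k. \<Union>(H f)) = prod_edges V E W E'" by simp
  then show ?thesis unfolding factorization_def
    by (intro exI[of _ H] conjI allI impI ballI tf eq disj; assumption?)
qed

text \<open>The cycles with even and those with odd index form one 2-factor each.\<close>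

lemma factorization_product:
  fixes V :: "'a set" and W :: "'b set"
  assumes F: "factorization V E h l1 M1 \<phi> F" and G: "factorization W E' h l2 M2 \<psi> G"
    and s: "even s" "2 \<le> s" "s dvd l2" "s \<le> l1" "even l1"
    and col: "\<And>f K L U. f < h \<Longrightarrow> K \<in> F f \<Longrightarrow> L \<in> G f \<Longrightarrow> U \<subseteq> \<Union>K \<times> \<Union>L \<Longrightarrow> card U = 2 * l1 * (l2 div s) \<Longrightarrow>
      (\<And>T. T \<subseteq> \<Union>K \<Longrightarrow> card (U \<inter> T \<times> UNIV) = 2 * card T * (l2 div s)) \<Longrightarrow> equitable M \<theta> U"
  shows "\<exists>H. factorization (V \<times> W) (prod_edges V E W E') (h + h) (2 * l1 * (l2 div s)) M \<theta> H"
proof -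
  let ?l = "2 * l1 * (l2 div s)"
  define P where "P K L = (SOME P. twisted l1 l2 (\<Union>K) K L s P)" for K :: "'a set set" and L :: "'b set set"
  have tw: "twisted l1 l2 (\<Union>K) K L s (P K L)" and cK: "card (\<Union>K) = l1" if KL: "cyc l1 K" "cyc l2 L" for K L
  proof -
    show c: "card (\<Union>K) = l1" using cyc_card_Union KL by blast
    show "twisted l1 l2 (\<Union>K) K L s (P K L)" unfolding P_def
      by (rule someI_ex[OF twisted_product[OF KL subset_refl s(2,3)]]) (use s c in auto)
  qed
  have P1: "cyc ?l (P K L c)" "\<Union>(P K L c) \<subseteq> \<Union>K \<times> \<Union>L" "(\<Union>c<s. P K L c) = prod_edges (\<Union>K) K (\<Union>L) L"
    if KL: "cyc l1 K" "cyc l2 L" for K L c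
  proof -
    show "cyc ?l (P K L c)" using twistedD(1)[OF tw[OF KL], of c] cK[OF KL] by (simp add: mult_2)
  qed (rule twistedD[OF tw[OF KL]])+
  have Pc: "card (\<Union>(P K L c) \<inter> T \<times> UNIV) = 2 * card T * (l2 div s)" if "cyc l1 K" "cyc l2 L" "T \<subseteq> \<Union>K" for K L c T
    using twistedD(7)[OF tw[OF that(1,2)] that(3), of c] that(3) by (simp add: Int_absorb2)
  have P2: "P K L c \<inter> P K L c' = {}" if "cyc l1 K" "cyc l2 L" "c < s" "c' < s" "c \<noteq> c'" for K L c c'
    by (rule twistedD(3)[OF tw[OF that(1,2)] that(3-5)])
  have P3: "\<exists>!c. c < s \<and> (even c \<longleftrightarrow> p) \<and> (u, w) \<in> \<Union>(P K L c)" if "cyc l1 K" "cyc l2 L" "u \<in> \<Union>K" "w \<in> \<Union>L" for K L u w p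
    by (rule twistedD(6)[OF tw[OF that(1,2)] that(3,4) s(1)])
  \<comment> \<open>The pair of 2-factors with index \<open>f\<close> yields two new ones,
    \<open>f\<close> for the even and \<open>h + f\<close> for the odd cycles; \<open>fi\<close>
    recovers the index of the pair.\<close>
  define fi where "fi f = (if f < h then f else f - h)" for f
  have fi: "fi f < h" if "f < h + h" for f using that by (auto simp: fi_def)
  define H where "H f = {P K L c | K L c. K \<in> F (fi f) \<and> L \<in> G (fi f) \<and> c < s \<and> (even c \<longleftrightarrow> f < h)}" for f
  have cF: "cyc l1 K" if "f < h" "K \<in> F f" for f K using two_factorD(1)[OF factorizationD(1)[OF F that(1)] that(2)] .
  have cG: "cyc l2 K" if "f < h" "K \<in> G f" for f K using two_factorD(1)[OF factorizationD(1)[OF G that(1)] that(2)] .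
  have HE: "\<exists>K L c. X = P K L c \<and> K \<in> F (fi f) \<and> L \<in> G (fi f) \<and> c < s \<and> (even c \<longleftrightarrow> f < h) \<and> cyc l1 K \<and> cyc l2 L"
    if "X \<in> H f" "f < h + h" for X f
    using that(1) cF[OF fi[OF that(2)]] cG[OF fi[OF that(2)]] unfolding H_def by blast
  have tf: "two_factor (V \<times> W) (2 * l1 * (l2 div s)) (H f)" if f: "f < h + h" for f
  proof (rule two_factorI)
    note DF = two_factorD[OF factorizationD(1)[OF F fi[OF f]]]
    note DG = two_factorD[OF factorizationD(1)[OF G fi[OF f]]]
    fix X assume "X \<in> H f"
    then obtain K L c where X: "X = P K L c" "K \<in> F (fi f)" "L \<in> G (fi f)" "cyc l1 K" "cyc l2 L" using HE f by blast
    show "cyc (2 * l1 * (l2 div s)) X" using P1(1) X by simp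
    have "\<Union>K \<times> \<Union>L \<subseteq> V \<times> W" using DF(2)[OF X(2)] DG(2)[OF X(3)] by (rule Sigma_mono)
    then show "\<Union>X \<subseteq> V \<times> W" using P1(2)[OF X(4,5), of c] unfolding X(1) by (rule subset_trans[rotated])
  next
    note DF = two_factorD[OF factorizationD(1)[OF F fi[OF f]]]
    note DG = two_factorD[OF factorizationD(1)[OF G fi[OF f]]]
    fix x assume "x \<in> V \<times> W"
    then obtain u w where x: "x = (u, w)" "u \<in> V" "w \<in> W" by auto
    obtain K where K: "K \<in> F (fi f)" "u \<in> \<Union>K" using DF(3)[OF x(2)] by blast
    obtain L where L: "L \<in> G (fi f)" "w \<in> \<Union>L" using DG(3)[OF x(3)] by blast
    obtain c where "c < s" "even c \<longleftrightarrow> f < h" "x \<in> \<Union>(P K L c)"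
      using P3[OF DF(1)[OF K(1)] DG(1)[OF L(1)] K(2) L(2), of "f < h"] unfolding x(1) by (auto elim: ex1E)
    then show "\<exists>X. X \<in> H f \<and> x \<in> \<Union>X" unfolding H_def using K(1) L(1) by (intro exI[of _ "P K L c"]) blast
  next
    note DF = two_factorD[OF factorizationD(1)[OF F fi[OF f]]]
    note DG = two_factorD[OF factorizationD(1)[OF G fi[OF f]]]
    fix X Y x assume XY: "X \<in> H f" "Y \<in> H f" and x: "x \<in> \<Union>X" "x \<in> \<Union>Y"
    obtain K L c where X: "X = P K L c" "K \<in> F (fi f)" "L \<in> G (fi f)" "c < s" "even c \<longleftrightarrow> f < h" "cyc l1 K" "cyc l2 L" using HE XY f by blast
    obtain K' L' c' where Y: "Y = P K' L' c'" "K' \<in> F (fi f)" "L' \<in> G (fi f)" "c' < s" "even c' \<longleftrightarrow> f < h" "cyc l1 K'" "cyc l2 L'" using HE XY f by blast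
    obtain u w where uw: "x = (u, w)" by (cases x)
    have "(u, w) \<in> \<Union>K \<times> \<Union>L" "(u, w) \<in> \<Union>K' \<times> \<Union>L'"
      using subsetD[OF P1(2)[OF X(6,7), of c]] subsetD[OF P1(2)[OF Y(6,7), of c']] x unfolding X(1) Y(1) uw by blast+
    then have uK: "u \<in> \<Union>K" "w \<in> \<Union>L" "u \<in> \<Union>K'" "w \<in> \<Union>L'" by (simp_all only: mem_Times_iff fst_conv snd_conv)
    then have eq: "K' = K" "L' = L" using DF(4)[OF Y(2) X(2)] DG(4)[OF Y(3) X(3)] by blast+
    have "c = c'" using P3[OF X(6,7) uK(1,2), of "f < h"] X(4,5) Y(4,5) x unfolding X(1) Y(1) eq uw by (metis (no_types))
    then show "X = Y" using X(1) Y(1) eq by simp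
  qed
  have eq: "equitable M \<theta> (\<Union>X)" if fX: "f < h + h" "X \<in> H f" for f X
  proof -
    obtain K L c where X: "X = P K L c" "K \<in> F (fi f)" "L \<in> G (fi f)" "cyc l1 K" "cyc l2 L" using HE[OF fX(2,1)] by blast
    show ?thesis unfolding X(1)
      by (rule col[OF fi[OF fX(1)] X(2,3) P1(2)[OF X(4,5)] cyc_card_Union(1)[OF P1(1)[OF X(4,5)]] Pc[OF X(4,5)]])
  qed
  have PE: "P K L c \<subseteq> prod_edges V (\<Union>(F (fi f))) W (\<Union>(G (fi f)))" if "K \<in> F (fi f)" "L \<in> G (fi f)" "f < h + h" "c < s" for K L c f
  proof -
    have "P K L c \<subseteq> prod_edges (\<Union>K) K (\<Union>L) L" using P1(3)[OF cF[OF fi[OF that(3)] that(1)] cG[OF fi[OF that(3)] that(2)]] that(4) by blast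
    also have "\<dots> \<subseteq> prod_edges V (\<Union>(F (fi f))) W (\<Union>(G (fi f)))"
      by (rule prod_edges_mono[OF two_factorD(2)[OF factorizationD(1)[OF F fi[OF that(3)]] that(1)] Union_upper[OF that(1)]
        two_factorD(2)[OF factorizationD(1)[OF G fi[OF that(3)]] that(2)] Union_upper[OF that(2)]])
    finally show ?thesis .
  qed
  have disj: "\<Union>(H f) \<inter> \<Union>(H f') = {}" if f: "f < h + h" "f' < h + h" "f \<noteq> f'" for f f'
  proof (rule ccontr)
    assume "\<Union>(H f) \<inter> \<Union>(H f') \<noteq> {}"
    then obtain e X Y where e: "X \<in> H f" "Y \<in> H f'" "e \<in> X" "e \<in> Y" by blast
    obtain K L c where X: "X = P K L c" "K \<in> F (fi f)" "L \<in> G (fi f)" "c < s" "even c \<longleftrightarrow> f < h" "cyc l1 K" "cyc l2 L" using HE e(1) f by blast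
    obtain K' L' c' where Y: "Y = P K' L' c'" "K' \<in> F (fi f')" "L' \<in> G (fi f')" "c' < s" "even c' \<longleftrightarrow> f' < h" "cyc l1 K'" "cyc l2 L'" using HE e(2) f by blast
    have fi_eq: "fi f = fi f'"
    proof (rule ccontr)
      assume ne: "fi f \<noteq> fi f'"
      have "prod_edges V (\<Union>(F (fi f))) W (\<Union>(G (fi f))) \<inter> prod_edges V (\<Union>(F (fi f'))) W (\<Union>(G (fi f'))) = {}"
      proof (rule prod_edges_disjoint)
        show "\<Union>(F (fi f)) \<inter> \<Union>(F (fi f')) = {}" by (rule factorizationD(3)[OF F fi[OF f(1)] fi[OF f(2)] ne])
        show "\<Union>(G (fi f)) \<inter> \<Union>(G (fi f')) = {}" by (rule factorizationD(3)[OF G fi[OF f(1)] fi[OF f(2)] ne])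
        show "card e = 2" if "e \<in> \<Union>(F (fi f)) \<union> \<Union>(F (fi f'))" for e
          using that factorization_card_edge[OF F fi[OF f(1)]] factorization_card_edge[OF F fi[OF f(2)]] by blast
        show "card e = 2" if "e \<in> \<Union>(G (fi f)) \<union> \<Union>(G (fi f'))" for e
          using that factorization_card_edge[OF G fi[OF f(1)]] factorization_card_edge[OF G fi[OF f(2)]] by blast
      qed
      moreover have "e \<in> prod_edges V (\<Union>(F (fi f))) W (\<Union>(G (fi f)))" using subsetD[OF PE[OF X(2,3) f(1) X(4)]] e(3) X(1) by simp
      moreover have "e \<in> prod_edges V (\<Union>(F (fi f'))) W (\<Union>(G (fi f')))" using subsetD[OF PE[OF Y(2,3) f(2) Y(4)]] e(4) Y(1) by simp
      ultimately show False by blast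
    qed
    \<comment> \<open>Different indices with the same underlying pair are the even and the odd class
      of this pair.\<close>
    then have par: "f < h \<longleftrightarrow> \<not> f' < h" using f by (auto simp: fi_def split: if_splits)
    have "card e = 2" using cyc_edge_card P1(1)[OF X(6,7)] e(3) X(1) by blast
    then have "e \<noteq> {}" by auto
    then obtain x where x: "x \<in> e" by blast
    obtain u w where uw: "x = (u, w)" by (cases x)
    have "x \<in> \<Union>X" "x \<in> \<Union>Y" using x e by blast+
    then have "(u, w) \<in> \<Union>K \<times> \<Union>L" "(u, w) \<in> \<Union>K' \<times> \<Union>L'"
      using subsetD[OF P1(2)[OF X(6,7), of c]] subsetD[OF P1(2)[OF Y(6,7), of c']] unfolding X(1) Y(1) uw by blast+
    then have uK: "u \<in> \<Union>K" "w \<in> \<Union>L" "u \<in> \<Union>K'" "w \<in> \<Union>L'" by (simp_all only: mem_Times_iff fst_conv snd_conv)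
    have K: "K = K'" by (rule two_factorD(4)[OF factorizationD(1)[OF F fi[OF f(1)]] X(2) _ uK(1,3)]) (use Y(2) fi_eq in simp)
    have L: "L = L'" by (rule two_factorD(4)[OF factorizationD(1)[OF G fi[OF f(1)]] X(3) _ uK(2,4)]) (use Y(3) fi_eq in simp)
    have "c \<noteq> c'" using X(5) Y(5) par by auto
    then have "P K L c \<inter> P K L c' = {}" by (rule P2[OF X(6,7,4) Y(4)])
    then show False using e(3,4) X(1) Y(1) K L by blast
  qed
  have un: "(\<Union>f<h + h. \<Union>(H f)) = prod_edges V E W E'"
  proof (intro equalityI subsetI)
    fix e assume "e \<in> (\<Union>f<h + h. \<Union>(H f))"
    then obtain f X where e: "f < h + h" "X \<in> H f" "e \<in> X" by blast
    obtain K L c where X: "X = P K L c" "K \<in> F (fi f)" "L \<in> G (fi f)" "c < s" using HE e by blast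
    have "e \<in> prod_edges V (\<Union>(F (fi f))) W (\<Union>(G (fi f)))" using subsetD[OF PE[OF X(2,3) e(1) X(4)]] e(3) X(1) by simp
    moreover have "\<Union>(F (fi f)) \<subseteq> E" "\<Union>(G (fi f)) \<subseteq> E'"
      using factorizationD(4)[OF F] factorizationD(4)[OF G] fi[OF e(1)] by blast+
    ultimately show "e \<in> prod_edges V E W E'"
      using prod_edges_mono[OF subset_refl _ subset_refl, of "\<Union>(F (fi f))" E "\<Union>(G (fi f))" E' V W] by (metis (no_types) subsetD)
  next
    fix e assume eP: "e \<in> prod_edges V E W E'"
    have "\<exists>f K L. f < h \<and> K \<in> F f \<and> L \<in> G f \<and> e \<in> prod_edges (\<Union>K) K (\<Union>L) L"
      using eP[unfolded prod_edges_def]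
    proof (elim UnE CollectE exE conjE)
      fix d w assume e: "e = d \<times> {w}" "d \<in> E" "w \<in> W"
      then obtain f K where f: "f < h" "K \<in> F f" "d \<in> K" using factorizationD(4)[OF F] by blast
      then obtain L where L: "L \<in> G f" "w \<in> \<Union>L" using two_factorD(3)[OF factorizationD(1)[OF G f(1)] e(3)] by blast
      have "e \<in> prod_edges (\<Union>K) K (\<Union>L) L"
        unfolding prod_edges_def e(1) by (intro UnI1 CollectI exI conjI) (rule refl f L)+
      then show ?thesis using f(1,2) L(1) by blast
    next
      fix v d assume e: "e = {v} \<times> d" "v \<in> V" "d \<in> E'"
      then obtain f L where f: "f < h" "L \<in> G f" "d \<in> L" using factorizationD(4)[OF G] by blast
      then obtain K where K: "K \<in> F f" "v \<in> \<Union>K" using two_factorD(3)[OF factorizationD(1)[OF F f(1)] e(2)] by blast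
      have "e \<in> prod_edges (\<Union>K) K (\<Union>L) L"
        unfolding prod_edges_def e(1) by (intro UnI2 CollectI exI conjI) (rule refl f K)+
      then show ?thesis using f(1,2) K(1) by blast
    qed
    then obtain f K L where f: "f < h" "K \<in> F f" "L \<in> G f" "e \<in> prod_edges (\<Union>K) K (\<Union>L) L" by blast
    then obtain c where c: "c < s" "e \<in> P K L c" using P1(3)[OF cF[OF f(1,2)] cG[OF f(1,3)]] by blast
    define f' where "f' = (if even c then f else h + f)"
    have f': "f' < h + h" "fi f' = f" "even c \<longleftrightarrow> f' < h" using f(1) by (auto simp: f'_def fi_def)
    then have "P K L c \<in> H f'" unfolding H_def using f(2,3) c(1) by blast
    then show "e \<in> (\<Union>f<h + h. \<Union>(H f))" using f'(1) c(2) by blast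
  qed
  show ?thesis unfolding factorization_def
    by (intro exI[of _ H] conjI allI impI ballI tf eq disj un; assumption?)
qed

lemma factorization_image:
  assumes F: "factorization V E h l M \<theta> F" and f: "inj_on f V" and E: "\<And>e. e \<in> E \<Longrightarrow> e \<subseteq> V"
  shows "factorization (f ` V) ((`) f ` E) h l M (\<theta> \<circ> inv_into V f) (\<lambda>i. (`) ((`) f) ` F i)"
proof -
  note D = factorizationD[OF F]
  have UF: "\<Union>((`) f ` K) = f ` (\<Union>K)" for K :: "'a set set" by blast
  have UK: "\<Union>((`) ((`) f) ` \<K>) = (`) f ` (\<Union>\<K>)" for \<K> :: "'a set set set" by blast
  have sub: "\<Union>K \<subseteq> V" if "i < h" "K \<in> F i" for i K using two_factorD(2)[OF D(1)[OF that(1)] that(2)] .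
  have inv: "inv_into V f (f v) = v" if "v \<in> V" for v by (rule inv_into_f_f[OF f that])
  have mem: "x \<in> f ` \<Union>K \<longleftrightarrow> inv_into V f x \<in> \<Union>K" if x: "x \<in> f ` V" and K: "\<Union>K \<subseteq> V" for x and K :: "'a set set"
  proof -
    obtain v where v: "x = f v" "v \<in> V" using x by (rule imageE)
    show ?thesis unfolding v(1) inv[OF v(2)] by (rule inj_on_image_mem_iff[OF f v(2) K])
  qed
  have inF: "inj_on ((`) f) E" by (rule image_edges_inj[OF f E])
  show ?thesis unfolding factorization_def
  proof (intro conjI allI impI ballI)
    fix i assume i: "i < h"
    note T = two_factorD[OF D(1)[OF i]]
    show "two_factor (f ` V) l ((`) ((`) f) ` F i)"
    proof (rule two_factorI)
      fix X assume "X \<in> (`) ((`) f) ` F i"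
      then obtain K where K: "X = (`) f ` K" "K \<in> F i" by (rule imageE)
      show "cyc l X" unfolding K(1) by (rule cyc_image[OF T(1)[OF K(2)] inj_on_subset[OF f T(2)[OF K(2)]]])
      show "\<Union>X \<subseteq> f ` V" unfolding K(1) UF using T(2)[OF K(2)] by (rule image_mono)
    next
      fix x assume x: "x \<in> f ` V"
      then have "inv_into V f x \<in> V" by (rule inv_into_into)
      then obtain K where "K \<in> F i" "inv_into V f x \<in> \<Union>K" using T(3) by blast
      then have "(`) f ` K \<in> (`) ((`) f) ` F i" "x \<in> \<Union>((`) f ` K)"
        unfolding UF using mem[OF x T(2)] by simp_all
      then show "\<exists>X. X \<in> (`) ((`) f) ` F i \<and> x \<in> \<Union>X" by blast
    next
      fix X Y x assume XY: "X \<in> (`) ((`) f) ` F i" "Y \<in> (`) ((`) f) ` F i" and x: "x \<in> \<Union>X" "x \<in> \<Union>Y"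
      obtain K where K: "X = (`) f ` K" "K \<in> F i" using XY(1) by (rule imageE)
      obtain L where L: "Y = (`) f ` L" "L \<in> F i" using XY(2) by (rule imageE)
      have xV: "x \<in> f ` V" using x(1) image_mono[OF T(2)[OF K(2)], of f] unfolding K(1) UF by (rule subsetD[rotated])
      have "K = L"
        by (rule T(4)[OF K(2) L(2)]) (use x mem[OF xV T(2)[OF K(2)]] mem[OF xV T(2)[OF L(2)]] in \<open>simp_all only: K(1) L(1) UF\<close>)
      then show "X = Y" using K L by simp
    qed
    fix X assume "X \<in> (`) ((`) f) ` F i"
    then obtain K where K: "X = (`) f ` K" "K \<in> F i" by (rule imageE)
    have "equitable M (\<lambda>u. (\<theta> \<circ> inv_into V f) (f u)) (\<Union>K)"
      using D(2)[OF i K(2)] by (subst equitable_cong[of _ _ \<theta>]) (use inv sub[OF i K(2)] in auto)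
    then show "equitable M (\<theta> \<circ> inv_into V f) (\<Union>X)"
      unfolding K(1) UF by (rule equitable_inj_image[OF inj_on_subset[OF f sub[OF i K(2)]]])
  next
    fix i j assume ij: "i < h" "j < h" "i \<noteq> j"
    have "\<Union>(F i) \<subseteq> E" "\<Union>(F j) \<subseteq> E" using D(4) ij by blast+
    then have "(`) f ` (\<Union>(F i) \<inter> \<Union>(F j)) = (`) f ` \<Union>(F i) \<inter> (`) f ` \<Union>(F j)"
      by (rule inj_on_image_Int[OF inF])
    then show "\<Union>((`) ((`) f) ` F i) \<inter> \<Union>((`) ((`) f) ` F j) = {}" unfolding UK using D(3)[OF ij] by simp
  next
    show "(\<Union>i<h. \<Union>((`) ((`) f) ` F i)) = (`) f ` E" unfolding UK D(4)[symmetric] by blast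
  qed
qed

section \<open>Factorizations of cubes into cycles of prescribed length\<close>

definition cube_fac :: "nat \<Rightarrow> nat \<Rightarrow> nat \<Rightarrow> bool" where
  "cube_fac n l M \<longleftrightarrow> (\<exists>\<phi> F. factorization (cube n) (cube_edges n) (n div 2) l M \<phi> F)"

lemma cube_fac_append:
  assumes "factorization (cube m \<times> cube n) (prod_edges (cube m) (cube_edges m) (cube n) (cube_edges n)) h l M \<theta> F"
    "h = (m + n) div 2"
  shows "cube_fac (m + n) l M"
proof -
  have sub: "e \<subseteq> cube m \<times> cube n" if "e \<in> prod_edges (cube m) (cube_edges m) (cube n) (cube_edges n)" for e
    by (rule prod_edges_subset[OF that]) (rule cube_edge_subset; assumption)+
  show ?thesis using factorization_image[OF assms(1) append_pair_inj sub]
    unfolding append_pair_image append_pair_edges cube_fac_def assms(2) by blast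
qed

lemma factorization_recolour:
  assumes "factorization V E h l M \<phi> F" "\<And>f K. f < h \<Longrightarrow> K \<in> F f \<Longrightarrow> equitable M' \<psi> (\<Union>K)"
  shows "factorization V E h l M' \<psi> F"
  unfolding factorization_def
  by (intro conjI allI impI ballI factorizationD[OF assms(1)] assms(2); assumption)

lemma cube_fac_base:
  assumes "1 \<le> x" shows "cube_fac (2 * x) (2 ^ (2 * x)) 1"
proof -
  obtain \<G> where G: "ham_dec (cube (2 * x)) (cube_edges (2 * x)) \<G>" using ham_dec_cube[OF assms] by blast
  have c: "finite \<G>" "card \<G> = x" using card_ham_dec[OF G] by auto
  obtain b where b: "bij_betw b {0..<x} \<G>" using ex_bij_betw_nat_finite[OF c(1)] c(2) by auto
  have bG: "b f \<in> \<G>" if "f < x" for f using b that by (auto simp: bij_betw_def)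
  have GD: "cyc (2 ^ (2 * x)) A \<and> \<Union>A = cube (2 * x)" if "A \<in> \<G>" for A
    using G that unfolding ham_dec_def by simp
  have "factorization (cube (2 * x)) (cube_edges (2 * x)) x (2 ^ (2 * x)) 1 (\<lambda>_. 0) (\<lambda>f. {b f})"
    unfolding factorization_def
  proof (intro conjI allI impI ballI)
    fix f assume f: "f < x"
    show "two_factor (cube (2 * x)) (2 ^ (2 * x)) {b f}"
      by (rule two_factorI) (use GD[OF bG[OF f]] in auto)
    show "equitable 1 (\<lambda>_. 0) (\<Union>K)" for K :: "bool list set set"
      unfolding equitable_def
    proof (intro conjI ballI allI impI)
      fix r :: nat assume "r < 1"
      then have r: "r = 0" by simp
      have U: "{u \<in> \<Union>K. (0 :: nat) = 0} = \<Union>K" by (rule Collect_mem_eq[of "\<Union>K", THEN subst[where P = "\<lambda>X. {u \<in> \<Union>K. (0 :: nat) = 0} = X"]]) (simp only: simp_thms)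
      show "card {u \<in> \<Union>K. 0 = r} * 1 = card (\<Union>K)" unfolding r U by (rule mult_1_right)
    qed simp
  next
    fix f f' assume f: "f < x" "f' < x" "f \<noteq> f'"
    have "b f \<noteq> b f'" using b f by (auto simp: bij_betw_def inj_on_def)
    moreover have "pairwise disjnt \<G>" using G by (simp add: ham_dec_def)
    ultimately have "disjnt (b f) (b f')" using pairwiseD bG[OF f(1)] bG[OF f(2)] by metis
    then show "\<Union>{b f} \<inter> \<Union>{b f'} = {}" by (simp add: disjnt_def)
  next
    have "(\<Union>f<x. \<Union>{b f}) = \<Union>(b ` {0..<x})" by auto
    also have "b ` {0..<x} = \<G>" using b by (simp add: bij_betw_def)
    finally show "(\<Union>f<x. \<Union>{b f}) = cube_edges (2 * x)" using G by (simp add: ham_dec_def)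
  qed
  then show ?thesis unfolding cube_fac_def by auto
qed

lemma pow2_sum: "a + b = c \<Longrightarrow> (2 :: nat) ^ a * 2 ^ b = 2 ^ c"
  by (auto simp: power_add)

text \<open>The cube is a product of two cubes of dimension \<open>n = 2 * x * 2^t\<close>. For
  \<open>L \<le> n\<close> copies of a factorization of one half suffice. For
  \<open>n + 2 * x \<le> L\<close> a Hamilton decomposition of the first half is wound with cycles
  of length \<open>2^(L - n)\<close> in the second. In between, \<open>L - n\<close> is too small
  for the induction hypothesis; there two Hamilton decompositions are wound with each other, and the
  length is reduced by a larger winding number.\<close>

theorem cube_fac_pow:
  assumes x: "1 \<le> x" and L: "2 * x \<le> L" "L \<le> 2 * x * 2 ^ t"
  shows "cube_fac (2 * x * 2 ^ t) (2 ^ L) (2 ^ (L - 2 * x))"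
  using L
proof (induction t arbitrary: L)
  case 0
  then show ?case using cube_fac_base[OF x] by simp
next
  case (Suc t)
  define n where "n = 2 * x * 2 ^ t"
  have n: "even n" "2 * x \<le> n" "2 * x * 2 ^ Suc t = n + n" "(n + n) div 2 = n" by (auto simp: n_def)
  have L2: "L \<le> n + n" using Suc.prems n by simp
  have h: "n div 2 + n div 2 = (n + n) div 2" using n by auto
  \<comment> \<open>The induction hypothesis for exponent \<open>n\<close>, that is, a Hamilton
    decomposition of one half.\<close>
  obtain \<phi> F where F: "factorization (cube n) (cube_edges n) (n div 2) (2 ^ n) (2 ^ (n - 2 * x)) \<phi> F"
    using Suc.IH[of n] n unfolding cube_fac_def n_def by auto
  \<comment> \<open>As all cycles of \<open>F\<close> are Hamiltonian, a numbering modulo any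
    \<open>2^i\<close> with \<open>i \<le> n\<close> colours them equitably, so \<open>F\<close> can
    be recoloured with as many colours as each case requires.\<close>
  obtain \<beta> :: "bool list \<Rightarrow> nat" where \<beta>: "bij_betw \<beta> (cube n) {..<2 ^ n}"
    using ex_bij_betw_finite_nat[OF finite_cube[of n]] by (auto simp: atLeast0LessThan)
  have UK: "\<Union>K = cube n" if "f < n div 2" "K \<in> F f" for f K
  proof (rule card_subset_eq)
    note T = two_factorD[OF factorizationD(1)[OF F that(1)]]
    show "\<Union>K \<subseteq> cube n" by (rule T(2)[OF that(2)])
    show "card (\<Union>K) = card (cube n)" using cyc_card_Union(1)[OF T(1)[OF that(2)]] by simp
  qed simp
  have F\<beta>: "factorization (cube n) (cube_edges n) (n div 2) (2 ^ n) (2 ^ i) (\<lambda>v. \<beta> v mod 2 ^ i) F" if "i \<le> n" for i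
  proof (rule factorization_recolour[OF F])
    fix f K assume "f < n div 2" "K \<in> F f"
    then have "\<Union>K = cube n" by (rule UK)
    then show "equitable (2 ^ i) (\<lambda>v. \<beta> v mod 2 ^ i) (\<Union>K)"
      using equitable_mod[OF \<beta>, of "2 ^ i"] that by (simp add: le_imp_power_dvd)
  qed
  have pow: "even ((2 :: nat) ^ n)" "(2 :: nat) \<le> 2 ^ n" using n x power_increasing[of 1 n "2 :: nat"] by auto
  consider "L \<le> n" | "n < L" "L < n + 2 * x" | "n + 2 * x \<le> L" by linarith
  then have "cube_fac (n + n) (2 ^ L) (2 ^ (L - 2 * x))"
  proof cases
    case 1
    then obtain \<phi> G where G: "factorization (cube n) (cube_edges n) (n div 2) (2 ^ L) (2 ^ (L - 2 * x)) \<phi> G"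
      using Suc.IH[of L] Suc.prems unfolding cube_fac_def n_def by auto
    obtain H where "factorization (cube n \<times> cube n) (prod_edges (cube n) (cube_edges n) (cube n) (cube_edges n)) (n div 2 + n div 2) (2 ^ L)
        (2 ^ (L - 2 * x)) (\<lambda>(u, w). (\<phi> u + \<phi> w) mod 2 ^ (L - 2 * x)) H"
      using factorization_copies[OF G G] by auto
    then show ?thesis by (rule cube_fac_append[OF _ h])
  next
    case 2
    define i where "i = L - 2 * x"
    have i: "i \<le> n" using 2 by (simp add: i_def)
    \<comment> \<open>The solution of \<open>2 * 2^n * (2^n div s) = 2^L\<close>.\<close>
    define s where "s = (2 :: nat) ^ (n + n + 1 - L)"
    have e: "1 \<le> n + n + 1 - L" "n + n + 1 - L \<le> n" using 2 L2 by auto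
    have s: "even s" "2 \<le> s" "s dvd 2 ^ n" "s \<le> 2 ^ n"
      using e power_increasing[OF e(1), of "2 :: nat"] power_increasing[OF e(2), of "2 :: nat"] unfolding s_def by (auto simp: le_imp_power_dvd)
    have "(2 :: nat) ^ n div s = 2 ^ (n - (n + n + 1 - L))" unfolding s_def by (rule power_diff[symmetric]) (use e in auto)
    then have len: "2 * 2 ^ n * (2 ^ n div s) = 2 ^ L" using pow2_sum[of "n + 1" "n - (n + n + 1 - L)" L] e by simp
    have "\<exists>H. factorization (cube n \<times> cube n) (prod_edges (cube n) (cube_edges n) (cube n) (cube_edges n)) (n div 2 + n div 2)
      (2 * 2 ^ n * (2 ^ n div s)) (2 ^ i) (\<lambda>x. \<beta> (fst x) mod 2 ^ i) H"
    proof (rule factorization_product[OF F F s pow(1)])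
      fix f K L U
      assume fK: "f < n div 2" "K \<in> F f" and U: "U \<subseteq> \<Union>K \<times> \<Union>L" "card U = 2 * 2 ^ n * (2 ^ n div s)"
        and T: "\<And>T. T \<subseteq> \<Union>K \<Longrightarrow> card (U \<inter> T \<times> UNIV) = 2 * card T * (2 ^ n div s)"
      have eq: "equitable (2 ^ i) (\<lambda>v. \<beta> v mod 2 ^ i) (\<Union>K)" by (rule factorizationD(2)[OF F\<beta>[OF i] fK])
      have cK: "card (\<Union>K) = 2 ^ n" using UK[OF fK] by simp
      show "equitable (2 ^ i) (\<lambda>x. \<beta> (fst x) mod 2 ^ i) U"
        unfolding equitable_def
      proof (intro conjI ballI allI impI)
        \<comment> \<open>Only the first coordinate is coloured. Every column contains the same
          number of vertices of \<open>U\<close>, so the colour classes of \<open>U\<close> inherit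
          their proportions from \<open>\<Union>K\<close>.\<close>
        fix r assume r: "r < (2 :: nat) ^ i"
        define T' where "T' = {u \<in> \<Union>K. \<beta> u mod 2 ^ i = r}"
        have "{x \<in> U. \<beta> (fst x) mod 2 ^ i = r} = U \<inter> T' \<times> UNIV"
          using U(1) unfolding T'_def by fastforce
        moreover have "card (U \<inter> T' \<times> UNIV) = 2 * card T' * (2 ^ n div s)" by (rule T) (auto simp: T'_def)
        moreover have "card T' * 2 ^ i = 2 ^ n" using eq r cK unfolding equitable_def T'_def by simp
        ultimately show "card {x \<in> U. \<beta> (fst x) mod 2 ^ i = r} * 2 ^ i = card U" unfolding U(2)
          by (metis (no_types, lifting) mult.assoc mult.commute)
      qed simp
    qed
    then show ?thesis unfolding len i_def using cube_fac_append[OF _ h] by blast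
  next
    case 3
    then have Ln: "2 * x \<le> L - n" "L - n \<le> n" using L2 by auto
    then obtain \<psi> G where G: "factorization (cube n) (cube_edges n) (n div 2) (2 ^ (L - n)) (2 ^ (L - n - 2 * x)) \<psi> G"
      using Suc.IH[of "L - n"] unfolding cube_fac_def n_def by auto
    have s: "(2 :: nat) dvd 2 ^ (L - n)" using Ln x by auto
    obtain m where m: "L - n = Suc m" using Ln x by (cases "L - n") auto
    have "2 * (2 ^ (L - n) div 2) = (2 :: nat) ^ (L - n)" using s by (rule dvd_mult_div_cancel)
    then have "2 * 2 ^ n * (2 ^ (L - n) div 2) = (2 :: nat) ^ n * 2 ^ (L - n)" by (metis mult.assoc mult.commute)
    then have len: "2 * 2 ^ n * (2 ^ (L - n) div 2) = (2 :: nat) ^ L" using pow2_sum[of n "L - n" L] 3 by simp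
    have M: "(2 :: nat) ^ n * 2 ^ (L - n - 2 * x) = 2 ^ (L - 2 * x)" by (rule pow2_sum) (use 3 in auto)
    have "\<exists>H. factorization (cube n \<times> cube n) (prod_edges (cube n) (cube_edges n) (cube n) (cube_edges n)) (n div 2 + n div 2)
      (2 * 2 ^ n * (2 ^ (L - n) div 2)) (2 ^ n * 2 ^ (L - n - 2 * x)) (\<lambda>(u, w). \<beta> u mod 2 ^ n + 2 ^ n * \<psi> w) H"
    proof (rule factorization_product[OF F G _ _ s pow(2,1)])
      fix f K C U
      assume fK: "f < n div 2" "K \<in> F f" "C \<in> G f" and U: "U \<subseteq> \<Union>K \<times> \<Union>C" "card U = 2 * 2 ^ n * (2 ^ (L - n) div 2)"
      have cC: "cyc (2 ^ (L - n)) C" using two_factorD(1)[OF factorizationD(1)[OF G fK(1)] fK(3)] .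
      \<comment> \<open>With winding number 2 the cycle passes through all vertices of the product,
        so the numbers of colours of the two halves multiply.\<close>
      have "card (\<Union>K \<times> \<Union>C) = card U"
        using UK[OF fK(1,2)] cyc_card_Union(1)[OF cC] U(2) m by (simp add: card_cartesian_product)
      then have "U = \<Union>K \<times> \<Union>C" using U(1) UK[OF fK(1,2)] cyc_card_Union(2)[OF cC]
        by (metis card_subset_eq finite_SigmaI finite_cube)
      then show "equitable (2 ^ n * 2 ^ (L - n - 2 * x)) (\<lambda>(u, w). \<beta> u mod 2 ^ n + 2 ^ n * \<psi> w) U"
        using equitable_Times[OF factorizationD(2)[OF F\<beta>[OF le_refl] fK(1,2)] factorizationD(2)[OF G fK(1,3)]] by simp
    qed auto
    then show ?thesis unfolding len M using cube_fac_append[OF _ h] by blast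
  qed
  then show ?case unfolding n(3) .
qed

section \<open>Combining the blocks\<close>

text \<open>\<open>rel M f r\<close> is the position of colour \<open>r\<close> when colours are counted cyclically from \<open>f\<close>, and \<open>slot M B f\<close> is the 2-factor of the
current block (of size \<open>B\<close>) assigned to index \<open>f\<close>. The indices with a given slot form a residue class
modulo \<open>B\<close> inside a block of \<open>M\<close> consecutive indices, so their windows of \<open>B\<close> consecutive positions partition the colours:
at each vertex the edges of the 2-factor are used exactly once.\<close>

definition rel :: "nat \<Rightarrow> nat \<Rightarrow> nat \<Rightarrow> nat" where
  "rel M f r = nat ((int r - int f) mod int M)"

definition slot :: "nat \<Rightarrow> nat \<Rightarrow> nat \<Rightarrow> nat" where
  "slot M B f = (f div M) * B + f mod B"

lemma int_rel: "0 < M \<Longrightarrow> int (rel M f r) = (int r - int f) mod int M"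
  by (simp add: rel_def)

lemma rel_inj:
  assumes "0 < M" "r < M" "r' < M" "rel M f r = rel M f r'" shows "r = r'"
proof -
  have "(int r - int f) mod int M = (int r' - int f) mod int M" using int_rel[OF assms(1)] assms(4) by metis
  then have "int r mod int M = int r' mod int M" by (simp add: mod_eq_dvd_iff)
  then show ?thesis using assms(2,3) by simp
qed

lemma rel_surj:
  assumes "0 < M" "p < M" shows "\<exists>r<M. rel M f r = p"
proof -
  define r where "r = nat ((int p + int f) mod int M)"
  have r: "int r = (int p + int f) mod int M" using assms by (simp add: r_def)
  then have "(int r - int f) mod int M = int p mod int M" by (simp add: mod_diff_left_eq)
  then have "int (rel M f r) = int p" using int_rel[OF assms(1)] assms(2) by simp
  moreover have "r < M" using assms by (simp add: r_def nat_less_iff)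
  ultimately show ?thesis by auto
qed

lemma slot_less:
  assumes "f < N * M" "0 < B" shows "slot M B f < N * B"
proof -
  have "f div M < N" using assms by (simp add: less_mult_imp_div_less)
  then have "(f div M + 1) * B \<le> N * B" by (intro mult_le_mono1) simp
  moreover have "f mod B < B" using assms by simp
  ultimately show ?thesis by (simp add: slot_def)
qed

text \<open>The slot reveals \<open>f div M\<close> and \<open>f mod B\<close>. The latter
  determines \<open>rel M f r\<close> modulo \<open>B\<close>, since \<open>B\<close> divides
  \<open>M\<close>, and the window is its quotient by \<open>B\<close>. So \<open>rel M f r\<close>
  is known, and with it \<open>f mod M\<close>.\<close>

lemma slot_inj:
  assumes M: "0 < M" "B dvd M" "0 < B" and s: "slot M B f = slot M B f'"
    and r: "rel M f r div B = rel M f' r div B"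
  shows "f = f'"
proof -
  have m: "f mod B < B" "f' mod B < B" using M by auto
  have A: "f div M = f' div M" "f mod B = f' mod B"
    using arg_cong[OF s, of "\<lambda>x. x div B"] arg_cong[OF s, of "\<lambda>x. x mod B"] m M(3) by (simp_all add: slot_def)
  have B: "int (rel M f r) mod int B = (int r - int f) mod int B" for f
    using int_rel[OF M(1)] M(2) by (simp add: mod_mod_cancel)
  have "int f mod int B = int f' mod int B" using A(2) by (metis of_nat_mod)
  then have "(int r - int f) mod int B = (int r - int f') mod int B" by (metis mod_diff_right_eq)
  then have "int (rel M f r mod B) = int (rel M f' r mod B)" using B by (simp add: of_nat_mod)
  then have "rel M f r = rel M f' r" using r by (metis of_nat_eq_iff div_mult_mod_eq)
  then have "(int r - int f) mod int M = (int r - int f') mod int M" using int_rel[OF M(1)] by metis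
  then have "int M dvd int f' - int f" by (simp add: mod_eq_dvd_iff)
  then have "int f' mod int M = int f mod int M" by (simp add: mod_eq_dvd_iff)
  then have "f mod M = f' mod M" by (metis of_nat_eq_iff of_nat_mod)
  then show ?thesis using A(1) by (metis div_mult_mod_eq)
qed

lemma slot_surj:
  assumes M: "0 < M" "B dvd M" "0 < B" and g: "g < N * B" and q: "(q + 1) * B \<le> M"
  shows "\<exists>f<N * M. slot M B f = g \<and> rel M f r div B = q"
proof -
  define A where "A = g div B"
  \<comment> \<open>The position in window \<open>q\<close> that is congruent to
    \<open>r - g\<close> modulo \<open>B\<close>. Placing colour \<open>r\<close> at position
    \<open>p\<close> prescribes \<open>f\<close> modulo \<open>M\<close>, and the congruence turns
    this into \<open>f mod B = g mod B\<close>.\<close>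
  define p where "p = int (q * B) + (int r - int g) mod int B"
  define t where "t = nat ((int r - p) mod int M)"
  have t: "int t = (int r - p) mod int M" "t < M" using M by (simp_all add: t_def nat_less_iff)
  have AN: "A < N" using g M(3) by (simp add: A_def less_mult_imp_div_less)
  have pB: "0 \<le> (int r - int g) mod int B" "(int r - int g) mod int B < int B" using M by auto
  have "p < int ((q + 1) * B)" using pB by (simp add: p_def)
  moreover have "int ((q + 1) * B) \<le> int M" using q by (simp only: of_nat_le_iff)
  ultimately have p: "0 \<le> p" "p < int M" using pB by (simp_all add: p_def del: of_nat_mult of_nat_add)
  define f where "f = A * M + t"
  have dm: "f div M = A" using t(2) by (simp add: f_def)
  have "int f mod int B = int t mod int B"
  proof -
    obtain k where "M = B * k" using M(2) by (rule dvdE)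
    then have "int f = int t + int B * (int A * int k)" by (simp add: f_def)
    then show ?thesis by (simp only: mod_mult_self2)
  qed
  also have "\<dots> = (int r - p) mod int B" using M(2) by (simp add: t(1) mod_mod_cancel)
  also have "\<dots> = (int r - (int r - int g) mod int B - int q * int B) mod int B" by (simp add: p_def algebra_simps)
  also have "\<dots> = (int r - (int r - int g) mod int B) mod int B"
    using mod_mult_self2[of "int r - (int r - int g) mod int B" "int B" "- int q"] by (simp add: mult.commute)
  also have "\<dots> = int g mod int B" by (simp add: mod_diff_right_eq)
  finally have "f mod B = g mod B" by (metis of_nat_eq_iff of_nat_mod)
  then have 1: "slot M B f = g" using dm by (simp add: slot_def A_def)
  have "(int r - int f) mod int M = (int r - int t) mod int M"
  proof -
    have "int r - int f = int r - int t + int M * (- int A)" by (simp add: f_def)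
    then show ?thesis by (simp only: mod_mult_self2)
  qed
  also have "\<dots> = p mod int M" by (simp add: t(1) mod_diff_right_eq)
  also have "\<dots> = p" using p by simp
  finally have "int (rel M f r) = p" using int_rel[OF M(1)] by simp
  then have "int (rel M f r) div int B = int q" using pB M(3) by (simp add: p_def)
  then have 2: "rel M f r div B = q" by (metis of_nat_eq_iff zdiv_int)
  have "A * M + M \<le> N * M" using AN by (metis Suc_leI add.commute mult_Suc mult_le_mono1)
  then have "f < N * M" using t(2) by (simp add: f_def)
  then show ?thesis using 1 2 by blast
qed

text \<open>The positions below \<open>o'\<close> are used up: relative to index \<open>f\<close>, a cycle in \<open>D f\<close> meets every other colour exactly \<open>s\<close> times, and the cycles
in \<open>D f\<close> partition the vertices of these colours.\<close>

definition stage :: "nat \<Rightarrow> nat \<Rightarrow> 'a set \<Rightarrow> 'a set set \<Rightarrow> nat \<Rightarrow> nat \<Rightarrow> ('a \<Rightarrow> nat) \<Rightarrow> (nat \<Rightarrow> 'a set set set) \<Rightarrow> bool" where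
  "stage M h V E s o' \<theta> D \<longleftrightarrow>
     (\<forall>f<h. \<forall>K\<in>D f. cyc (s * (M + o')) K \<and> \<Union>K \<subseteq> V) \<and>
     (\<Union>f<h. \<Union>(D f)) = E \<and>
     (\<forall>f<h. \<forall>f'<h. \<forall>K\<in>D f. \<forall>K'\<in>D f'. K \<inter> K' \<noteq> {} \<longrightarrow> f = f' \<and> K = K') \<and>
     (\<forall>v\<in>V. \<theta> v < M) \<and>
     (\<forall>f<h. \<forall>v\<in>V. o' \<le> rel M f (\<theta> v) \<longrightarrow> (\<exists>!K. K \<in> D f \<and> v \<in> \<Union>K)) \<and>
     (\<forall>f<h. \<forall>K\<in>D f. \<forall>r<M. o' \<le> rel M f r \<longrightarrow> card {v \<in> \<Union>K. \<theta> v = r} = s)"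

lemma stageD:
  assumes "stage M h V E s o' \<theta> D"
  shows "f < h \<Longrightarrow> K \<in> D f \<Longrightarrow> cyc (s * (M + o')) K" "f < h \<Longrightarrow> K \<in> D f \<Longrightarrow> \<Union>K \<subseteq> V"
    "(\<Union>f<h. \<Union>(D f)) = E"
    "f < h \<Longrightarrow> f' < h \<Longrightarrow> K \<in> D f \<Longrightarrow> K' \<in> D f' \<Longrightarrow> e \<in> K \<Longrightarrow> e \<in> K' \<Longrightarrow> f = f' \<and> K = K'"
    "v \<in> V \<Longrightarrow> \<theta> v < M"
    "f < h \<Longrightarrow> v \<in> V \<Longrightarrow> o' \<le> rel M f (\<theta> v) \<Longrightarrow> \<exists>!K. K \<in> D f \<and> v \<in> \<Union>K"
    "f < h \<Longrightarrow> K \<in> D f \<Longrightarrow> r < M \<Longrightarrow> o' \<le> rel M f r \<Longrightarrow> card {v \<in> \<Union>K. \<theta> v = r} = s"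
proof -
  note a = assms[unfolded stage_def]
  note b = conjunct2[OF a]
  note c = conjunct2[OF b]
  note d = conjunct2[OF c]
  note e = conjunct2[OF d]
  show "f < h \<Longrightarrow> K \<in> D f \<Longrightarrow> cyc (s * (M + o')) K" "f < h \<Longrightarrow> K \<in> D f \<Longrightarrow> \<Union>K \<subseteq> V" using conjunct1[OF a] by simp_all
  show "(\<Union>f<h. \<Union>(D f)) = E" by (rule conjunct1[OF b])
  show "f = f' \<and> K = K'" if "f < h" "f' < h" "K \<in> D f" "K' \<in> D f'" "e \<in> K" "e \<in> K'"
  proof -
    have "K \<inter> K' \<noteq> {}" using that(5,6) by blast
    then show ?thesis using conjunct1[OF c] that(1-4) by simp
  qed
  show "v \<in> V \<Longrightarrow> \<theta> v < M" using conjunct1[OF d] by simp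
  show "f < h \<Longrightarrow> v \<in> V \<Longrightarrow> o' \<le> rel M f (\<theta> v) \<Longrightarrow> \<exists>!K. K \<in> D f \<and> v \<in> \<Union>K" using conjunct1[OF e] by simp
  show "f < h \<Longrightarrow> K \<in> D f \<Longrightarrow> r < M \<Longrightarrow> o' \<le> rel M f r \<Longrightarrow> card {v \<in> \<Union>K. \<theta> v = r} = s" using conjunct2[OF e] by simp
qed

lemma stageI:
  assumes "\<And>f K. f < h \<Longrightarrow> K \<in> D f \<Longrightarrow> cyc (s * (M + o')) K" "\<And>f K. f < h \<Longrightarrow> K \<in> D f \<Longrightarrow> \<Union>K \<subseteq> V"
    "(\<Union>f<h. \<Union>(D f)) = E"
    "\<And>f f' K K' e. f < h \<Longrightarrow> f' < h \<Longrightarrow> K \<in> D f \<Longrightarrow> K' \<in> D f' \<Longrightarrow> e \<in> K \<Longrightarrow> e \<in> K' \<Longrightarrow> f = f' \<and> K = K'"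
    "\<And>v. v \<in> V \<Longrightarrow> \<theta> v < M"
    "\<And>f v. f < h \<Longrightarrow> v \<in> V \<Longrightarrow> o' \<le> rel M f (\<theta> v) \<Longrightarrow> \<exists>!K. K \<in> D f \<and> v \<in> \<Union>K"
    "\<And>f K r. f < h \<Longrightarrow> K \<in> D f \<Longrightarrow> r < M \<Longrightarrow> o' \<le> rel M f r \<Longrightarrow> card {v \<in> \<Union>K. \<theta> v = r} = s"
  shows "stage M h V E s o' \<theta> D"
  unfolding stage_def
proof (intro conjI allI ballI impI)
  fix f f' K K' assume "f < h" "f' < h" "K \<in> D f" "K' \<in> D f'" "K \<inter> K' \<noteq> {}"
  then obtain e where "e \<in> K" "e \<in> K'" by blast
  then have "f = f' \<and> K = K'" by (rule assms(4)[OF \<open>f < h\<close> \<open>f' < h\<close> \<open>K \<in> D f\<close> \<open>K' \<in> D f'\<close>])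
  then show "f = f'" "K = K'" by simp_all
qed (rule assms; assumption)+

lemma stage_image:
  assumes st: "stage M h V E s o' \<theta> D" and f: "inj_on f V" and E: "\<And>e. e \<in> E \<Longrightarrow> e \<subseteq> V"
  shows "stage M h (f ` V) ((`) f ` E) s o' (\<theta> \<circ> inv_into V f) (\<lambda>i. (`) ((`) f) ` D i)"
proof -
  note D = stageD[OF st]
  have UF: "\<Union>((`) f ` K) = f ` (\<Union>K)" for K :: "'a set set" by blast
  have UK: "\<Union>((`) ((`) f) ` \<K>) = (`) f ` (\<Union>\<K>)" for \<K> :: "'a set set set" by blast
  have inv: "inv_into V f (f v) = v" if "v \<in> V" for v by (rule inv_into_f_f[OF f that])
  have inF: "inj_on ((`) f) E" by (rule image_edges_inj[OF f E])
  have sE: "e \<in> E" if "i < h" "K \<in> D i" "e \<in> K" for e i K using D(3) that by blast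
  show ?thesis
  proof (rule stageI)
    fix i X assume i: "i < h" and "X \<in> (`) ((`) f) ` D i"
    then obtain K where K: "X = (`) f ` K" "K \<in> D i" by (elim imageE)
    show "cyc (s * (M + o')) X" unfolding K(1) by (rule cyc_image[OF D(1)[OF i K(2)] inj_on_subset[OF f D(2)[OF i K(2)]]])
    show "\<Union>X \<subseteq> f ` V" unfolding K(1) UF using D(2)[OF i K(2)] by (rule image_mono)
    fix r assume r: "r < M" "o' \<le> rel M i r"
    have "{v \<in> \<Union>X. (\<theta> \<circ> inv_into V f) v = r} = f ` {v \<in> \<Union>K. \<theta> v = r}"
      unfolding K(1) UF using inv D(2)[OF i K(2)] by (force simp: subset_iff)
    moreover have "inj_on f {v \<in> \<Union>K. \<theta> v = r}" using D(2)[OF i K(2)] by (intro inj_on_subset[OF f]) auto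
    ultimately show "card {v \<in> \<Union>X. (\<theta> \<circ> inv_into V f) v = r} = s" using D(7)[OF i K(2) r] by (simp add: card_image)
  next
    show "(\<Union>i<h. \<Union>((`) ((`) f) ` D i)) = (`) f ` E" unfolding UK D(3)[symmetric] by blast
  next
    fix i j X Y e assume i: "i < h" "j < h" and XY: "X \<in> (`) ((`) f) ` D i" "Y \<in> (`) ((`) f) ` D j" and e: "e \<in> X" "e \<in> Y"
    obtain K where K: "X = (`) f ` K" "K \<in> D i" using XY(1) by (rule imageE)
    obtain L where L: "Y = (`) f ` L" "L \<in> D j" using XY(2) by (rule imageE)
    obtain a where a: "e = f ` a" "a \<in> K" using e(1) unfolding K(1) by (rule imageE)
    obtain b where b: "e = f ` b" "b \<in> L" using e(2) unfolding L(1) by (rule imageE)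
    have "a = b" using inj_onD[OF inF, of a b] a b sE[OF i(1) K(2)] sE[OF i(2) L(2)] by simp
    then have "i = j \<and> K = L" using D(4)[OF i K(2) L(2) a(2)] b(2) by simp
    then show "i = j \<and> X = Y" using K(1) L(1) by simp
  next
    show "(\<theta> \<circ> inv_into V f) v < M" if "v \<in> f ` V" for v using D(5)[OF inv_into_into[OF that]] by simp
  next
    fix i x assume i: "i < h" and x: "x \<in> f ` V" and r: "o' \<le> rel M i ((\<theta> \<circ> inv_into V f) x)"
    obtain v where v: "x = f v" "v \<in> V" using x by (rule imageE)
    have "o' \<le> rel M i (\<theta> v)" using r inv[OF v(2)] v(1) by simp
    then have ex: "\<exists>!K. K \<in> D i \<and> v \<in> \<Union>K" by (rule D(6)[OF i v(2)])
    then obtain K where K: "K \<in> D i" "v \<in> \<Union>K" by (elim ex1E conjE)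
    show "\<exists>!X. X \<in> (`) ((`) f) ` D i \<and> x \<in> \<Union>X"
    proof (rule ex1I)
      show "(`) f ` K \<in> (`) ((`) f) ` D i \<and> x \<in> \<Union>((`) f ` K)" unfolding UF v(1) using K by simp
      fix X assume X: "X \<in> (`) ((`) f) ` D i \<and> x \<in> \<Union>X"
      then obtain L where L: "X = (`) f ` L" "L \<in> D i" by (elim conjE imageE)
      have "f v \<in> f ` \<Union>L" using X unfolding L(1) UF v(1) by simp
      then have "v \<in> \<Union>L" using inj_on_image_mem_iff[OF f v(2) D(2)[OF i L(2)]] by simp
      then have "L = K" using ex K L(2) by (metis (no_types))
      then show "X = (`) f ` K" using L(1) by simp
    qed
  qed
qed

lemma card_rel_block:
  assumes "0 < M" "(q + 1) * B \<le> M" "0 < B"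
  shows "card {r. r < M \<and> rel M f r div B = q} = B"
proof -
  have "bij_betw (rel M f) {r. r < M \<and> rel M f r div B = q} {q * B..<(q + 1) * B}"
    unfolding bij_betw_def
  proof
    show "inj_on (rel M f) {r. r < M \<and> rel M f r div B = q}" using rel_inj[OF assms(1)] by (auto simp: inj_on_def)
    have div: "p div B = q \<longleftrightarrow> q * B \<le> p \<and> p < (q + 1) * B" for p
      using assms(3) by (metis Suc_eq_plus1 div_nat_eqI dividend_less_div_times mult.commute mult_Suc div_times_less_eq_dividend)
    show "rel M f ` {r. r < M \<and> rel M f r div B = q} = {q * B..<(q + 1) * B}"
    proof (intro equalityI subsetI)
      fix p assume "p \<in> rel M f ` {r. r < M \<and> rel M f r div B = q}"
      then show "p \<in> {q * B..<(q + 1) * B}" using div by auto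
    next
      fix p assume p: "p \<in> {q * B..<(q + 1) * B}"
      then have "p < M" using assms(2) by simp
      then obtain r where "r < M" "rel M f r = p" using rel_surj[OF assms(1)] by blast
      moreover have "p div B = q" using div p by simp
      ultimately show "p \<in> rel M f ` {r. r < M \<and> rel M f r div B = q}" by blast
    qed
  qed
  then show ?thesis using bij_betw_same_card by fastforce
qed

text \<open>The vertices of a cycle in \<open>D f\<close> whose colours lie in the next window
  number \<open>B * s\<close>. Winding with number 2 over them gives the length
  \<open>(s * (M + q * B) + B * s) * (b div 2)\<close>, and every colour beyond the window is met
  \<open>b div 2\<close> times as often as before. A vertical edge over \<open>v\<close> belongs to
  some 2-factor \<open>F g\<close>; among the indices with slot \<open>g\<close> exactly one has the
  colour of \<open>v\<close> in its window, so the edge is used exactly once.\<close>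

lemma stage_product:
  fixes V :: "'a set" and W :: "'b set"
  assumes st: "stage M (N * M) V E s (q * B) \<theta> D" and F: "factorization W E' (N * B) b M' \<psi> F"
    and M: "0 < M" "B dvd M" "0 < B" "(q + 1) * B \<le> M" and s: "even s" "2 \<le> s" and b: "even b"
  shows "\<exists>D'. stage M (N * M) (V \<times> W) (prod_edges V E W E') (s * (b div 2)) ((q + 1) * B) (\<lambda>(v, w). \<theta> v) D'"
proof -
  note D = stageD[OF st]
  define S where "S f K = {v \<in> \<Union>K. rel M f (\<theta> v) div B = q}" for f and K :: "'a set set"
  have finK: "finite (\<Union>K)" if "f < N * M" "K \<in> D f" for f K using cyc_card_Union(2)[OF D(1)[OF that]] .
  have lo: "q * B \<le> p" if "p div B = q" for p using that div_times_less_eq_dividend[of p B] by simp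
  have cS: "card (S f K) = B * s" if fK: "f < N * M" "K \<in> D f" for f K
  proof -
    let ?R = "{r. r < M \<and> rel M f r div B = q}"
    have "S f K = (\<Union>r\<in>?R. {v \<in> \<Union>K. \<theta> v = r})" using D(5) D(2)[OF fK] unfolding S_def by blast
    also have "card \<dots> = (\<Sum>r\<in>?R. card {v \<in> \<Union>K. \<theta> v = r})"
      by (rule card_UN_disjoint) (auto intro: finite_subset[OF _ finK[OF fK]])
    also have "\<dots> = (\<Sum>r\<in>?R. s)" by (rule sum.cong) (use D(7)[OF fK] lo in auto)
    finally show ?thesis using card_rel_block[OF M(1,4,3), of f] by simp
  qed
  have fac: "\<And>g. g < N * B \<Longrightarrow> two_factor W b (F g)" by (rule factorizationD(1)[OF F])
  have sl: "slot M B f < N * B" if "f < N * M" for f using slot_less[OF that M(3)] .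
  define P where "P f K C = (SOME P. twisted (s * (M + q * B)) b (S f K) K C 2 P)" for f K and C :: "'b set set"
  have tw: "twisted (s * (M + q * B)) b (S f K) K C 2 (P f K C)"
    if f: "f < N * M" "K \<in> D f" "C \<in> F (slot M B f)" for f K C
  proof -
    have C: "cyc b C" by (rule two_factorD(1)[OF fac[OF sl[OF f(1)]] f(3)])
    have "2 \<le> B * s" using s(2) M(3) by (metis Suc_leI One_nat_def mult_le_mono nat_mult_1)
    then have p: "2 dvd b" "2 \<le> card (S f K)" "even (card (S f K) + 2)" using b s cS[OF f(1,2)] by auto
    have "S f K \<subseteq> \<Union>K" unfolding S_def by blast
    then show ?thesis unfolding P_def by (rule someI_ex[OF twisted_product[OF D(1)[OF f(1,2)] C _ order.refl p]])
  qed
  note P2 = twistedD(2)[OF tw] and P5 = twistedD(5)[OF tw] and P6 = twistedD(7)[OF tw]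
  have P1: "cyc ((s * (M + q * B) + B * s) * (b div 2)) (P f K C c)" if "f < N * M" "K \<in> D f" "C \<in> F (slot M B f)" for f K C c
    using twistedD(1)[OF tw[OF that], of c] unfolding cS[OF that(1,2)] .
  have P3: "P f K C 0 \<inter> P f K C 1 = {}" if "f < N * M" "K \<in> D f" "C \<in> F (slot M B f)" for f K C
    by (rule twistedD(3)[OF tw[OF that]]) simp_all
  have two: "{..<2} = {0, 1 :: nat}" by auto
  have P4: "P f K C 0 \<union> P f K C 1 = prod_edges (S f K) K (\<Union>C) C" if "f < N * M" "K \<in> D f" "C \<in> F (slot M B f)" for f K C
    using twistedD(4)[OF tw[OF that]] unfolding two by simp
  have P4': "(\<exists>d w. e = d \<times> {w} \<and> d \<in> K \<and> w \<in> \<Union>C) \<or> (\<exists>v g. e = {v} \<times> g \<and> v \<in> S f K \<and> g \<in> C)"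
    if "f < N * M" "K \<in> D f" "C \<in> F (slot M B f)" "c < 2" "e \<in> P f K C c" for f K C c e
  proof -
    have "c = 0 \<or> c = 1" using that(4) by auto
    then have "e \<in> P f K C 0 \<union> P f K C 1" using that(5) by auto
    then show ?thesis unfolding P4[OF that(1-3)] prod_edges_def by (elim UnE CollectE) simp_all
  qed
  define D' where "D' f = {P f K C c | K C c. K \<in> D f \<and> C \<in> F (slot M B f) \<and> c < 2}" for f
  have len: "(s * (M + q * B) + B * s) * (b div 2) = s * (b div 2) * (M + (q + 1) * B)" by (simp add: algebra_simps)
  have DE: "\<exists>K C c. X = P f K C c \<and> K \<in> D f \<and> C \<in> F (slot M B f) \<and> c < 2" if "X \<in> D' f" for X f
    using that unfolding D'_def by (rule CollectD)
  have cardK: "card d = 2" if "f < N * M" "K \<in> D f" "d \<in> K" for f K d using cyc_edge_card[OF D(1)[OF that(1,2)] that(3)] .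
  have Suniq: "f = f' \<and> K = K'" if "f < N * M" "f' < N * M" "K \<in> D f" "K' \<in> D f'" "slot M B f = slot M B f'" "v \<in> S f K" "v \<in> S f' K'" for f f' K K' v
  proof -
    have v: "rel M f (\<theta> v) div B = q" "rel M f' (\<theta> v) div B = q" "v \<in> \<Union>K" "v \<in> \<Union>K'" using that(6,7) unfolding S_def by (simp_all only: mem_Collect_eq)
    have ff: "f = f'" by (rule slot_inj[OF M(1-3) that(5), of "\<theta> v"]) (simp add: v)
    have "v \<in> V" using D(2)[OF that(1,3)] v(3) by (rule subsetD)
    then have ex: "\<exists>!K. K \<in> D f \<and> v \<in> \<Union>K" by (rule D(6)[OF that(1) _ lo[OF v(1)]])
    have "K' \<in> D f" using that(4) ff by simp
    then have "K = K'" using ex that(3) v(3,4) by (metis (no_types))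
    then show ?thesis using ff by simp
  qed
  show ?thesis
  proof (intro exI[of _ D'] stageI)
    fix f X assume f: "f < N * M" and "X \<in> D' f"
    then obtain K C c where X: "X = P f K C c" "K \<in> D f" "C \<in> F (slot M B f)" "c < 2" using DE by blast
    show "cyc (s * (b div 2) * (M + (q + 1) * B)) X" using P1[OF f X(2,3)] unfolding X(1) len .
    have "\<Union>K \<times> \<Union>C \<subseteq> V \<times> W" by (rule Sigma_mono[OF D(2)[OF f X(2)] two_factorD(2)[OF fac[OF sl[OF f]] X(3)]])
    then show "\<Union>X \<subseteq> V \<times> W" unfolding X(1) by (rule subset_trans[OF P2[OF f X(2,3)]])
    fix r assume r: "r < M" "(q + 1) * B \<le> rel M f r"
    define T where "T = {v \<in> \<Union>K. \<theta> v = r}"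
    have "rel M f r div B \<ge> q + 1" using r(2) M(3) by (metis less_eq_div_iff_mult_less_eq)
    then have TS: "T \<inter> S f K = {}" unfolding T_def S_def by auto
    have "card T = s" unfolding T_def by (rule D(7)[OF f X(2) r(1)]) (use r(2) in simp)
    moreover have "{x \<in> \<Union>X. (case x of (v, w) \<Rightarrow> \<theta> v) = r} = \<Union>(P f K C c) \<inter> T \<times> UNIV"
    proof (intro equalityI subsetI)
      fix x assume x: "x \<in> {x \<in> \<Union>X. (case x of (v, w) \<Rightarrow> \<theta> v) = r}"
      obtain v w where vw: "x = (v, w)" by (cases x)
      have "x \<in> \<Union>(P f K C c)" "\<theta> v = r" using x unfolding X(1) vw by simp_all
      moreover from this have "v \<in> \<Union>K" using subsetD[OF P2[OF f X(2,3)]] unfolding vw by (metis mem_Times_iff fst_conv)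
      ultimately show "x \<in> \<Union>(P f K C c) \<inter> T \<times> UNIV" unfolding T_def vw by simp
    qed (auto simp: T_def X(1))
    moreover have "T \<subseteq> \<Union>K" unfolding T_def by blast
    ultimately show "card {x \<in> \<Union>X. (case x of (v, w) \<Rightarrow> \<theta> v) = r} = s * (b div 2)"
      using P6[OF f X(2,3), of T c] TS by simp
  next
    show "(\<Union>f<N * M. \<Union>(D' f)) = prod_edges V E W E'"
    proof (intro equalityI subsetI)
      fix e assume "e \<in> (\<Union>f<N * M. \<Union>(D' f))"
      then obtain f X where f: "f < N * M" "X \<in> D' f" "e \<in> X" by blast
      obtain K C c where X: "X = P f K C c" "K \<in> D f" "C \<in> F (slot M B f)" "c < 2" using DE[OF f(2)] by blast
      have KV: "\<Union>K \<subseteq> V" "\<Union>C \<subseteq> W" by (rule D(2)[OF f(1) X(2)], rule two_factorD(2)[OF fac[OF sl[OF f(1)]] X(3)])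
      have KE: "K \<subseteq> E" using D(3) f(1) X(2) by blast
      have CE: "C \<subseteq> E'" using factorizationD(4)[OF F] sl[OF f(1)] X(3) by blast
      from P4'[OF f(1) X(2,3,4)] f(3) X(1)
      have "(\<exists>d w. e = d \<times> {w} \<and> d \<in> K \<and> w \<in> \<Union>C) \<or> (\<exists>v g. e = {v} \<times> g \<and> v \<in> S f K \<and> g \<in> C)" by simp
      then show "e \<in> prod_edges V E W E'" unfolding prod_edges_def
      proof (elim disjE exE conjE)
        fix d w assume "e = d \<times> {w}" "d \<in> K" "w \<in> \<Union>C"
        then show "e \<in> {e \<times> {w} | e w. e \<in> E \<and> w \<in> W} \<union> {{v} \<times> f | v f. v \<in> V \<and> f \<in> E'}"
          by (intro UnI1 CollectI exI[of _ d] exI[of _ w] conjI) (use KE KV in blast)+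
      next
        fix v g assume a: "e = {v} \<times> g" "v \<in> S f K" "g \<in> C"
        have "v \<in> V" using a(2) KV(1) unfolding S_def by blast
        then show "e \<in> {e \<times> {w} | e w. e \<in> E \<and> w \<in> W} \<union> {{v} \<times> f | v f. v \<in> V \<and> f \<in> E'}"
          by (intro UnI2 CollectI exI[of _ v] exI[of _ g] conjI) (use CE a in blast)+
      qed
    next
      fix e assume eP: "e \<in> prod_edges V E W E'"
      have "\<exists>f K C. f < N * M \<and> K \<in> D f \<and> C \<in> F (slot M B f) \<and> e \<in> P f K C 0 \<union> P f K C 1"
        using eP[unfolded prod_edges_def]
      proof (elim UnE CollectE exE conjE)
        fix d w assume e: "e = d \<times> {w}" "d \<in> E" "w \<in> W"
        obtain f K where f: "f < N * M" "K \<in> D f" "d \<in> K" using e(2) D(3) by blast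
        obtain C where C: "C \<in> F (slot M B f)" "w \<in> \<Union>C" using two_factorD(3)[OF fac[OF sl[OF f(1)]] e(3)] by blast
        have "e \<in> P f K C 0 \<union> P f K C 1" unfolding P4[OF f(1,2) C(1)] prod_edges_def e(1)
          by (intro UnI1 CollectI exI conjI) (rule refl f C)+
        then show ?thesis using f(1,2) C(1) by blast
      next
        fix v d assume e: "e = {v} \<times> d" "v \<in> V" "d \<in> E'"
        obtain g C where g: "g < N * B" "C \<in> F g" "d \<in> C" using e(3) factorizationD(4)[OF F] by blast
        obtain f where f: "f < N * M" "slot M B f = g" "rel M f (\<theta> v) div B = q" using slot_surj[OF M(1-3) g(1) M(4)] by blast
        obtain K where K: "K \<in> D f" "v \<in> \<Union>K" using D(6)[OF f(1) e(2) lo[OF f(3)]] by (elim ex1E conjE)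
        have C: "C \<in> F (slot M B f)" using g(2) f(2) by simp
        have v: "v \<in> S f K" using K(2) f(3) unfolding S_def by (intro CollectI conjI)
        have "e \<in> P f K C 0 \<union> P f K C 1" unfolding P4[OF f(1) K(1) C] prod_edges_def e(1)
          by (intro UnI2 CollectI exI conjI) (rule refl v g)+
        then show ?thesis using f(1) K(1) C by blast
      qed
      then obtain f K C c where f: "f < N * M" "K \<in> D f" "C \<in> F (slot M B f)" "e \<in> P f K C c" "c < 2"
        by (metis UnE less_2_cases_iff One_nat_def)
      then have "P f K C c \<in> D' f" unfolding D'_def by blast
      then show "e \<in> (\<Union>f<N * M. \<Union>(D' f))" using f(1,4) by blast
    qed
  next
    fix f f' X X' e assume f: "f < N * M" "f' < N * M" and X: "X \<in> D' f" "X' \<in> D' f'" and e: "e \<in> X" "e \<in> X'"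
    obtain K C c where X1: "X = P f K C c" "K \<in> D f" "C \<in> F (slot M B f)" "c < 2" using DE[OF X(1)] by blast
    obtain K' C' c' where X2: "X' = P f' K' C' c'" "K' \<in> D f'" "C' \<in> F (slot M B f')" "c' < 2" using DE[OF X(2)] by blast
    have a: "(\<exists>d w. e = d \<times> {w} \<and> d \<in> K \<and> w \<in> \<Union>C) \<or> (\<exists>v g. e = {v} \<times> g \<and> v \<in> S f K \<and> g \<in> C)"
      using P4'[OF f(1) X1(2-4)] e(1) X1(1) by simp
    have b: "(\<exists>d w. e = d \<times> {w} \<and> d \<in> K' \<and> w \<in> \<Union>C') \<or> (\<exists>v g. e = {v} \<times> g \<and> v \<in> S f' K' \<and> g \<in> C')"
      using P4'[OF f(2) X2(2-4)] e(2) X2(1) by simp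
    \<comment> \<open>A horizontal edge determines \<open>f\<close> and \<open>K\<close> by its
      first projection and then \<open>C\<close> by its row. A vertical edge determines the slot by
      its second projection, then \<open>f\<close> and \<open>K\<close> by \<open>slot_inj\<close>,
      and finally \<open>C\<close>.\<close>
    have main: "f = f' \<and> K = K' \<and> C = C'"
      using a b
    proof (elim disjE exE conjE)
      fix d w d' w' assume h: "e = d \<times> {w}" "d \<in> K" "w \<in> \<Union>C" "e = d' \<times> {w'}" "d' \<in> K'" "w' \<in> \<Union>C'"
      have "d \<noteq> {}" using cardK[OF f(1) X1(2) h(2)] by auto
      then have dw: "d' = d" "w' = w" using h(1,4) by (auto simp: times_eq_iff)
      have fK: "f = f' \<and> K = K'" using D(4)[OF f X1(2) X2(2) h(2)] h(5) dw by simp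
      moreover have "C = C'" by (rule two_factorD(4)[OF fac[OF sl[OF f(1)]] X1(3) _ h(3)]) (use X2(3) fK h(6) dw in simp_all)
      ultimately show ?thesis by simp
    next
      fix v g v' g' assume h: "e = {v} \<times> g" "v \<in> S f K" "g \<in> C" "e = {v'} \<times> g'" "v' \<in> S f' K'" "g' \<in> C'"
      have "card g = 2" by (rule factorization_card_edge[OF F sl[OF f(1)]]) (use h(3) X1(3) in blast)
      then obtain w where w: "w \<in> g" by fastforce
      then have vg: "v' = v" "g' = g" using h(1,4) by (auto simp: times_eq_iff)
      have sl_eq: "slot M B f = slot M B f'"
      proof (rule ccontr)
        assume "slot M B f \<noteq> slot M B f'"
        then have "\<Union>(F (slot M B f)) \<inter> \<Union>(F (slot M B f')) = {}" by (rule factorizationD(3)[OF F sl[OF f(1)] sl[OF f(2)]])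
        moreover have "g \<in> \<Union>(F (slot M B f))" "g \<in> \<Union>(F (slot M B f'))" using h(3,6) X1(3) X2(3) vg by auto
        ultimately show False by blast
      qed
      have "f = f' \<and> K = K'" by (rule Suniq[OF f X1(2) X2(2) sl_eq h(2)]) (use h(5) vg in simp)
      moreover have "C = C'" by (rule two_factorD(4)[OF fac[OF sl[OF f(1)]] X1(3), of _ w]) (use X2(3) sl_eq h(3,6) vg w in auto)
      ultimately show ?thesis by simp
    next
      fix d w v g assume h: "e = d \<times> {w}" "d \<in> K" "e = {v} \<times> g"
      then show ?thesis using times_edge_neq[OF cardK[OF f(1) X1(2) h(2)], of w v g] by simp
    next
      fix d w v g assume h: "e = d \<times> {w}" "d \<in> K'" "e = {v} \<times> g"
      then show ?thesis using times_edge_neq[OF cardK[OF f(2) X2(2) h(2)], of w v g] by simp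
    qed
    have "c = c'"
    proof (rule ccontr)
      assume "c \<noteq> c'"
      then have "e \<in> P f K C 0 \<inter> P f K C 1" using e X1(1,4) X2(1,4) main by (auto simp: less_2_cases_iff)
      then show False unfolding P3[OF f(1) X1(2,3)] by (rule emptyE)
    qed
    then show "f = f' \<and> X = X'" using main X1(1) X2(1) by simp
  next
    show "(case x of (v, w) \<Rightarrow> \<theta> v) < M" if "x \<in> V \<times> W" for x using D(5) that by auto
  next
    fix f x assume f: "f < N * M" and x: "x \<in> V \<times> W" and r: "(q + 1) * B \<le> rel M f (case x of (v, w) \<Rightarrow> \<theta> v)"
    obtain v w where vw: "x = (v, w)" "v \<in> V" "w \<in> W" using x by auto
    have r': "(q + 1) * B \<le> rel M f (\<theta> v)" using r vw(1) by simp
    then have ge: "rel M f (\<theta> v) div B \<ge> q + 1" using M(3) by (metis less_eq_div_iff_mult_less_eq)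
    have exK: "\<exists>!K. K \<in> D f \<and> v \<in> \<Union>K" by (rule D(6)[OF f vw(2)]) (use r' in simp)
    then obtain K where K: "K \<in> D f" "v \<in> \<Union>K" by (elim ex1E conjE)
    obtain C where C: "C \<in> F (slot M B f)" "w \<in> \<Union>C" using two_factorD(3)[OF fac[OF sl[OF f]] vw(3)] by blast
    \<comment> \<open>Beyond the window the column of \<open>v\<close> has no turn, so exactly one
      of the two cycles from \<open>K\<close> and \<open>C\<close> passes through
      \<open>(v, w)\<close>.\<close>
    have nS: "v \<notin> S f K" using ge unfolding S_def by auto
    obtain c where c: "c < 2" "(v, w) \<in> \<Union>(P f K C c)" and cu: "\<And>c'. c' < 2 \<and> (v, w) \<in> \<Union>(P f K C c') \<Longrightarrow> c' = c"
      using P5[OF f K(1) C(1) K(2) C(2) nS] by (elim ex1E conjE) metis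
    show "\<exists>!X. X \<in> D' f \<and> x \<in> \<Union>X"
    proof (rule ex1I)
      have "P f K C c \<in> D' f" using K(1) C(1) c(1) unfolding D'_def by blast
      then show "P f K C c \<in> D' f \<and> x \<in> \<Union>(P f K C c)" using c(2) vw(1) by simp
      fix X assume X: "X \<in> D' f \<and> x \<in> \<Union>X"
      then obtain K' C' c' where X': "X = P f K' C' c'" "K' \<in> D f" "C' \<in> F (slot M B f)" "c' < 2" using DE by blast
      have "(v, w) \<in> \<Union>K' \<times> \<Union>C'" using X subsetD[OF P2[OF f X'(2,3)]] unfolding X'(1) vw(1) by blast
      then have "v \<in> \<Union>K'" "w \<in> \<Union>C'" by (simp_all only: mem_Times_iff fst_conv snd_conv)
      then have "K' = K" "C' = C" using exK K X'(2) two_factorD(4)[OF fac[OF sl[OF f]] X'(3) C(1) _ C(2)] by (metis (no_types))+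
      then show "X = P f K C c" using X X'(1,4) cu[of c'] unfolding vw(1) by simp
    qed
  qed
qed

section \<open>Choice of the exponents and assembly of the blocks\<close>

lemma interval_sum:
  fixes l u :: "'a \<Rightarrow> nat"
  assumes "finite A" "\<And>a. a \<in> A \<Longrightarrow> l a \<le> u a" "sum l A \<le> T" "T \<le> sum u A"
  shows "\<exists>L. (\<forall>a\<in>A. l a \<le> L a \<and> L a \<le> u a) \<and> sum L A = T"
  using assms
proof (induction A arbitrary: T rule: finite_induct)
  case empty
  then show ?case by simp
next
  case (insert a A)
  \<comment> \<open>The smallest admissible value at \<open>a\<close> that leaves at most
    \<open>sum u A\<close> for the rest; truncated subtraction handles
    \<open>T < sum u A\<close>.\<close>
  define t where "t = max (l a) (T - sum u A)"
  have lu: "sum l A \<le> sum u A" by (rule sum_mono) (use insert.prems(1) in simp)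
  have t: "l a \<le> t" "t \<le> u a" "t \<le> T" "sum l A \<le> T - t" "T - t \<le> sum u A"
    using insert.prems insert.hyps lu by (auto simp: t_def)
  obtain L where L: "\<forall>b\<in>A. l b \<le> L b \<and> L b \<le> u b" "sum L A = T - t"
    using insert.IH[OF _ t(4,5)] insert.prems(1) by blast
  have "sum (L(a := t)) A = sum L A" by (rule sum.cong) (use insert.hyps(2) in auto)
  then have "sum (L(a := t)) (insert a A) = T" using L(2) t(3) insert.hyps by simp
  moreover have "\<forall>b\<in>insert a A. l b \<le> (L(a := t)) b \<and> (L(a := t)) b \<le> u b" using L(1) t(1,2) by simp
  ultimately show ?case by blast
qed

text \<open>A colour modulo \<open>M\<close> collects \<open>c\<close> of the original colours, all
  equally frequent. The first cube usually has more than \<open>M\<close> colours and is reduced to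
  \<open>M\<close> in this way.\<close>

lemma equitable_coarsen:
  assumes eq: "equitable (M * c) \<phi> U" and U: "finite U" and pos: "0 < M" "0 < c"
  shows "equitable M (\<lambda>u. \<phi> u mod M) U"
  unfolding equitable_def
proof (intro conjI ballI allI impI)
  show "\<phi> u mod M < M" for u using pos by simp
  fix r assume r: "r < M"
  have "{u \<in> U. \<phi> u mod M = r} = (\<Union>k<c. {u \<in> U. \<phi> u = k * M + r})"
  proof (intro equalityI subsetI)
    fix u assume u: "u \<in> {u \<in> U. \<phi> u mod M = r}"
    then have "\<phi> u < M * c" using eq by (auto simp: equitable_def)
    then have "\<phi> u div M < c" by (simp add: less_mult_imp_div_less mult.commute)
    moreover have "\<phi> u = (\<phi> u div M) * M + r" using u by auto
    ultimately show "u \<in> (\<Union>k<c. {u \<in> U. \<phi> u = k * M + r})" using u by blast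
  qed (use r in auto)
  also have "card \<dots> = (\<Sum>k<c. card {u \<in> U. \<phi> u = k * M + r})"
    by (rule card_UN_disjoint) (use U pos in auto)
  finally have "card {u \<in> U. \<phi> u mod M = r} * (M * c) = (\<Sum>k<c. card {u \<in> U. \<phi> u = k * M + r} * (M * c))"
    by (simp add: sum_distrib_right)
  also have "\<dots> = (\<Sum>k<c. card U)"
  proof (rule sum.cong[OF refl])
    fix k assume "k \<in> {..<c}"
    then have "k * M + M \<le> c * M" by (metis Suc_leI add.commute lessThan_iff mult_Suc mult_le_mono1)
    then have "k * M + r < M * c" using r by (simp add: mult.commute)
    then show "card {u \<in> U. \<phi> u = k * M + r} * (M * c) = card U" using eq by (simp add: equitable_def)
  qed
  finally show "card {u \<in> U. \<phi> u mod M = r} * M = card U" using pos by simp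
qed

lemma stage_start:
  assumes F: "factorization V E h (s * M) (M * c) \<phi> F" and pos: "0 < M" "0 < c" "0 < h"
  shows "stage M h V E s 0 (\<lambda>v. \<phi> v mod M) F"
proof (rule stageI)
  have tf: "two_factor V (s * M) (F f)" if "f < h" for f by (rule factorizationD(1)[OF F that])
  fix f K assume f: "f < h" "K \<in> F f"
  show K: "cyc (s * (M + 0)) K" "\<Union>K \<subseteq> V" using two_factorD(1,2)[OF tf[OF f(1)] f(2)] by simp_all
  fix r assume r: "r < M"
  have "equitable M (\<lambda>v. \<phi> v mod M) (\<Union>K)"
    using equitable_coarsen[OF factorizationD(2)[OF F f] cyc_card_Union(2)[OF K(1)] pos(1,2)] .
  then have "card {v \<in> \<Union>K. \<phi> v mod M = r} * M = s * M"
    using r cyc_card_Union(1)[OF K(1)] by (simp add: equitable_def)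
  then show "card {v \<in> \<Union>K. \<phi> v mod M = r} = s" using pos by simp
next
  show "(\<Union>f<h. \<Union>(F f)) = E" by (rule factorizationD(4)[OF F])
next
  fix f f' K K' e assume a: "f < h" "f' < h" "K \<in> F f" "K' \<in> F f'" "e \<in> K" "e \<in> K'"
  have ff: "f = f'" using factorizationD(3)[OF F a(1,2)] a(3-6) by blast
  have t: "two_factor V (s * M) (F f)" by (rule factorizationD(1)[OF F a(1)])
  have "card e = 2" by (rule cyc_edge_card[OF two_factorD(1)[OF t a(3)] a(5)])
  then obtain v where "v \<in> e" by fastforce
  then have "v \<in> \<Union>K" "v \<in> \<Union>K'" using a(5,6) by auto
  then show "f = f' \<and> K = K'" using two_factorD(4)[OF t a(3)] a(4) ff by simp
next
  show "\<phi> v mod M < M" for v using pos by simp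
next
  fix f v assume f: "f < h" and v: "v \<in> V"
  note t = factorizationD(1)[OF F f]
  obtain K where "K \<in> F f" "v \<in> \<Union>K" using two_factorD(3)[OF t v] by blast
  then show "\<exists>!K. K \<in> F f \<and> v \<in> \<Union>K" using two_factorD(4)[OF t] by (intro ex1I[of _ K]) auto
qed

lemma stage_cube_step:
  assumes st: "stage M (N * M) (cube m) (cube_edges m) s (q * B) \<theta> D"
    and F: "cube_fac (2 * (N * B)) b M'"
    and M: "0 < M" "B dvd M" "0 < B" "(q + 1) * B \<le> M" and s: "even s" "2 \<le> s" and b: "even b"
  shows "\<exists>\<theta>' D'. stage M (N * M) (cube (m + 2 * (N * B))) (cube_edges (m + 2 * (N * B))) (s * (b div 2)) ((q + 1) * B) \<theta>' D'"
proof -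
  let ?n = "2 * (N * B)"
  obtain \<psi> F' where "factorization (cube ?n) (cube_edges ?n) (N * B) b M' \<psi> F'"
    using F unfolding cube_fac_def by auto
  then obtain D' where D': "stage M (N * M) (cube m \<times> cube ?n) (prod_edges (cube m) (cube_edges m) (cube ?n) (cube_edges ?n))
      (s * (b div 2)) ((q + 1) * B) (\<lambda>(v, w). \<theta> v) D'"
    using stage_product[OF st _ M s b] by blast
  have "e \<subseteq> cube m \<times> cube ?n" if "e \<in> prod_edges (cube m) (cube_edges m) (cube ?n) (cube_edges ?n)" for e
    by (rule prod_edges_subset[OF that]) (auto dest: cube_edge_subset)
  from stage_image[OF D' append_pair_inj this] show ?thesis
    unfolding append_pair_image append_pair_edges by blast
qed

text \<open>As the exponents decrease, \<open>2 * 2^i (k + 1) \<le> 2^i k\<close>, so the room left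
  after window \<open>k\<close> is never smaller than that window. The second part makes the offset
  of each window a multiple of its size.\<close>

lemma offset_bound:
  fixes i :: "nat \<Rightarrow> nat"
  assumes dec: "\<forall>k\<in>{1..<j}. i (k + 1) < i k" and k: "1 \<le> k" "k \<le> j"
  shows "(\<Sum>l=2..k. 2 ^ i l) + 2 ^ i k \<le> (2::nat) ^ i 1 \<and> (\<forall>l\<in>{1..k}. i k \<le> i l)"
  using k
proof (induction k rule: dec_induct)
  case base
  then show ?case by simp
next
  case (step k)
  have lt: "i (Suc k) < i k" using dec step by auto
  then have "2 * 2 ^ i (Suc k) \<le> (2::nat) ^ i k" using power_increasing[of "Suc (i (Suc k))" "i k" "2::nat"] by simp
  moreover have "(\<Sum>l=2..Suc k. 2 ^ i l) = (\<Sum>l=2..k. 2 ^ i l) + (2::nat) ^ i (Suc k)"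
    using step.hyps by simp
  ultimately have "(\<Sum>l=2..Suc k. 2 ^ i l) + 2 ^ i (Suc k) \<le> (2::nat) ^ i 1" using step by simp
  moreover have "\<forall>l\<in>{1..Suc k}. i (Suc k) \<le> i l" using step lt by (auto simp: le_Suc_eq) (metis less_imp_le_nat le_trans atLeastAtMost_iff Suc_leI)
  ultimately show ?case by blast
qed

text \<open>An \<open>edge_decomposition\<close> has to cover the vertices as well as the edges,
  which follows because the cube of positive dimension has no isolated vertex.\<close>

lemma cube_vertex_edge:
  assumes "1 \<le> n" "v \<in> cube n"
  shows "v \<in> \<Union>(cube_edges n)"
proof -
  let ?w = "v[0 := \<not> v ! 0]"
  have "{m. m < n \<and> v ! m \<noteq> ?w ! m} = {0}" using assms by (auto simp: cube_def nth_list_update)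
  then have "card {m. m < n \<and> v ! m \<noteq> ?w ! m} = 1" by simp
  then have "{v, ?w} \<in> cube_edges n"
    using assms(2) unfolding cube_edges_def hypercube_def cube_def graph.sel by (intro CollectI exI conjI) (rule refl | simp)+
  then show ?thesis by blast
qed

lemma hypercube_edge_decomposition:
  assumes n: "1 \<le> n" and fin: "finite \<C>" and cyc: "\<And>K. K \<in> \<C> \<Longrightarrow> cyc \<l> K"
    and disj: "\<And>K K' e. K \<in> \<C> \<Longrightarrow> K' \<in> \<C> \<Longrightarrow> e \<in> K \<Longrightarrow> e \<in> K' \<Longrightarrow> K = K'" and E: "\<Union>\<C> = cube_edges n"
  shows "\<exists>C. edge_decomposition (hypercube n) (card \<C>) C \<and> (\<forall>c<card \<C>. cycle_graph \<l> (C c))"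
proof -
  obtain b where b: "bij_betw b {..<card \<C>} \<C>"
    using ex_bij_betw_nat_finite[OF fin] by (auto simp: atLeast0LessThan)
  define C where "C c = Graph (\<Union>(b c)) (b c)" for c
  have bC: "b c \<in> \<C>" if "c < card \<C>" for c using b that by (auto simp: bij_betw_def)
  have im: "\<C> = b ` {..<card \<C>}" using b by (simp add: bij_betw_def)
  have UE: "\<Union>(cube_edges n) = cube n" using cube_vertex_edge[OF n] cube_edge_subset by blast
  have "edge_decomposition (hypercube n) (card \<C>) C"
    unfolding edge_decomposition_def
  proof (intro conjI allI impI)
    fix c assume c: "c < card \<C>"
    have "b c \<subseteq> cube_edges n" using bC[OF c] E by blast
    then have "\<Union>(b c) \<subseteq> cube n" "b c \<subseteq> cube_edges n" using UE by blast+
    then show "subgraph (C c) (hypercube n)"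
      using cyc_edge_card[OF cyc[OF bC[OF c]]]
      unfolding subgraph_def wf_graph_def C_def cube_def cube_edges_def by (auto simp: hypercube_def)
  next
    fix c d assume cd: "c < card \<C>" "d < card \<C>" "c \<noteq> d"
    have "b c \<noteq> b d" using b cd by (auto simp: bij_betw_def inj_on_def)
    then show "edges (C c) \<inter> edges (C d) = {}" using disj[OF bC[OF cd(1)] bC[OF cd(2)]] by (auto simp: C_def)
  next
    have "(\<Union>c<card \<C>. verts (C c)) = \<Union>(\<Union>\<C>)" unfolding C_def graph.sel by (subst (2) im) blast
    then show "(\<Union>c<card \<C>. verts (C c)) = verts (hypercube n)" using E UE by (simp add: cube_def hypercube_def)
    have "(\<Union>c<card \<C>. edges (C c)) = \<Union>\<C>" unfolding C_def graph.sel by (subst (2) im) blast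
    then show "(\<Union>c<card \<C>. edges (C c)) = edges (hypercube n)" using E by (simp add: cube_edges_def)
  qed
  moreover have "\<forall>c<card \<C>. cycle_graph \<l> (C c)" using cyc_cycle_graph[OF cyc[OF bC]] by (simp add: C_def)
  ultimately show ?thesis by blast
qed

text \<open>The number of cycles is not tracked through the stages; it is recovered from the number
  of edges, \<open>n * 2^n div 2\<close>.\<close>

lemma stage_hypercube:
  assumes st: "stage M h (cube n) (cube_edges n) s o' \<theta> D" and n: "1 \<le> n"
  shows "\<exists>C k. edge_decomposition (hypercube n) k C \<and> (\<forall>c<k. cycle_graph (s * (M + o')) (C c)) \<and>
    2 * (k * (s * (M + o'))) = n * 2 ^ n"
proof -
  note D = stageD[OF st]
  define \<C> where "\<C> = (\<Union>f<h. D f)"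
  have U: "\<Union>\<C> = cube_edges n" unfolding \<C>_def D(3)[symmetric] by blast
  have cyc: "cyc (s * (M + o')) K" if "K \<in> \<C>" for K using that D(1) by (auto simp: \<C>_def)
  have disj: "K = K'" if K: "K \<in> \<C>" "K' \<in> \<C>" "e \<in> K" "e \<in> K'" for K K' e
  proof -
    obtain f f' where "f < h" "K \<in> D f" "f' < h" "K' \<in> D f'" using K(1,2) unfolding \<C>_def by blast
    then show ?thesis using D(4) K(3,4) by blast
  qed
  have fin: "finite \<C>" by (rule finite_UnionD) (simp add: U finite_cube_edges)
  have "card (\<Union>\<C>) = (\<Sum>K\<in>\<C>. card K)"
    by (rule card_Union_disjoint) (use disj cyc_finite[OF cyc] in \<open>auto simp: pairwise_def disjnt_def\<close>)
  also have "\<dots> = card \<C> * (s * (M + o'))" using cyc_card[OF cyc] by simp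
  finally have "2 * (card \<C> * (s * (M + o'))) = n * 2 ^ n" using card_cube_edges[of n] by (simp add: U)
  moreover have "\<exists>C. edge_decomposition (hypercube n) (card \<C>) C \<and> (\<forall>c<card \<C>. cycle_graph (s * (M + o')) (C c))"
    by (rule hypercube_edge_decomposition[OF n fin _ _ U]) (fact cyc, fact disj)
  ultimately show ?thesis by blast
qed

theorem theorem1:
  fixes n x y \<alpha> j q :: nat and i :: "nat \<Rightarrow> nat"
  assumes "odd x" and "x \<ge> 1" and "odd y" and "y \<ge> 1" and "\<alpha> \<ge> 1"
    and "n = x * y * 2 ^ \<alpha>"
    and "j \<ge> 1"
    and "y = (\<Sum>k=1..j. 2 ^ i k)"
    and "\<forall>k\<in>{1..<j}. i k > i (k + 1)"
    and "i j = 0"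
    and "int q \<le> int n - int (i 1) - 2 * int x * int j"
  shows "\<exists>C. edge_decomposition (hypercube n) (x * 2 ^ (i 1 + \<alpha> + j + q - 2)) C \<and>
    (\<forall>c < x * 2 ^ (i 1 + \<alpha> + j + q - 2).
       cycle_graph (y * 2 ^ (n + 1 - i 1 - j - q)) (C c))"
proof -
  \<comment> \<open>Half of \<open>x * 2^\<alpha>\<close>: block \<open>k\<close> has dimension
    \<open>2 * (N * 2^i k)\<close> and therefore \<open>N * 2^i k\<close> 2-factors.\<close>
  define N where "N = x * 2 ^ (\<alpha> - 1)"
  define M :: nat where "M = 2 ^ i 1"
  define d where "d k = 2 * x * 2 ^ (\<alpha> - 1 + i k)" for k
  define off :: "nat \<Rightarrow> nat" where "off k = (\<Sum>l=2..k. 2 ^ i l)" for k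
  have dN: "d k = 2 * (N * 2 ^ i k)" for k by (simp add: d_def N_def power_add)
  have split1: "{1..k} = insert 1 {2..k}" if "1 \<le> k" for k :: nat using that by auto
  have y: "y = M + off j" using assms(7,8) split1[OF assms(7)] by (simp add: M_def off_def)
  have al: "(2::nat) ^ \<alpha> = 2 * 2 ^ (\<alpha> - 1)" using assms(5) by (cases \<alpha>) auto
  have n: "n = (\<Sum>k=1..j. d k)"
    by (simp add: assms(6,8) dN N_def al sum_distrib_left sum_distrib_right mult_ac)
  have M0: "0 < M" by (simp add: M_def)
  have N0: "0 < N" using assms(2) by (simp add: N_def)
  have low: "2 * x \<le> d k" for k by (simp add: d_def)
  \<comment> \<open>The raised lower bound \<open>2 * x + i 1\<close> for the first block must not
    exceed its dimension.\<close>
  have "i 1 + 1 \<le> 2 ^ i 1" by (simp add: Suc_leI)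
  also have "\<dots> \<le> 2 ^ (\<alpha> - 1 + i 1)" by (rule power_increasing) simp_all
  finally have "2 * x * (i 1 + 1) \<le> d 1" unfolding d_def by (rule mult_le_mono2)
  moreover have "2 * x + i 1 \<le> 2 * x * (i 1 + 1)" using assms(2) by (simp add: algebra_simps)
  ultimately have low1: "2 * x + i 1 \<le> d 1" by linarith
  have q: "q + i 1 + 2 * x * j \<le> n"
  proof -
    have "int (q + i 1 + 2 * x * j) \<le> int n" using assms(11) by simp
    then show ?thesis by (simp only: of_nat_le_iff)
  qed
  \<comment> \<open>Cycles in block \<open>k\<close> will have length \<open>2^L k\<close>. The
    bound \<open>2 * x\<close> comes from \<open>cube_fac_pow\<close>; the additional
    \<open>i 1\<close> makes the number of colours of the first block a multiple of
    \<open>M\<close>. The sum of the lower bounds is at most \<open>n - q\<close> precisely by the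
    hypothesis on \<open>q\<close>.\<close>
  have "\<exists>L. (\<forall>k\<in>{1..j}. (if k = 1 then 2 * x + i 1 else 2 * x) \<le> L k \<and> L k \<le> d k) \<and> sum L {1..j} = n - q"
  proof (rule interval_sum)
    show "(if k = 1 then 2 * x + i 1 else 2 * x) \<le> d k" for k using low low1 by simp
    have "(\<Sum>k=1..j. if k = 1 then 2 * x + i 1 else 2 * x) = (\<Sum>k=1..j. 2 * x + (if k = 1 then i 1 else 0))"
      by (rule sum.cong) auto
    also have "\<dots> = 2 * x * j + i 1" using assms(7) by (simp add: sum.distrib mult_ac)
    finally show "(\<Sum>k=1..j. if k = 1 then 2 * x + i 1 else 2 * x) \<le> n - q" using q by simp
    show "n - q \<le> sum d {1..j}" using n by simp
  qed simp
  then obtain L where L0: "\<forall>k\<in>{1..j}. (if k = 1 then 2 * x + i 1 else 2 * x) \<le> L k \<and> L k \<le> d k"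
    and LT: "sum L {1..j} = n - q" by blast
  have L: "\<And>k. 1 \<le> k \<Longrightarrow> k \<le> j \<Longrightarrow> 2 * x \<le> L k \<and> L k \<le> d k" "2 * x + i 1 \<le> L 1"
    using bspec[OF L0] assms(7) by (force split: if_splits)+
  have fac: "cube_fac (2 * (N * 2 ^ i k)) (2 ^ L k) (2 ^ (L k - 2 * x))" if "1 \<le> k" "k \<le> j" for k
    using cube_fac_pow[OF assms(2), of "L k" "\<alpha> - 1 + i k"] L(1)[OF that] unfolding dN[symmetric] d_def by simp
  \<comment> \<open>The first length is split as \<open>2^L 1 = 2^e 1 * M\<close>, and each later
    block multiplies by \<open>2^L l div 2\<close>; hence the corrections \<open>i 1\<close> and
    1.\<close>
  define e where "e k = L 1 - i 1 + (\<Sum>l=2..k. L l - 1)" for k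
  have e2: "2 \<le> e k" for k using L(2) assms(2) by (simp add: e_def)
  have main: "\<exists>\<theta> D. stage M (N * M) (cube (\<Sum>l=1..k. d l)) (cube_edges (\<Sum>l=1..k. d l)) (2 ^ e k) (off k) \<theta> D"
    if "1 \<le> k" "k \<le> j" for k
    using that
  proof (induction k rule: dec_induct)
    case base
    define c :: nat where "c = 2 ^ (L 1 - 2 * x - i 1)"
    have c: "(2::nat) ^ (L 1 - 2 * x) = M * c" "0 < c" using L(2) by (simp_all add: c_def M_def flip: power_add)
    have l: "(2::nat) ^ L 1 = 2 ^ e 1 * M" using L(2) by (simp add: e_def M_def flip: power_add)
    obtain \<phi> F where "factorization (cube (d 1)) (cube_edges (d 1)) (N * M) (2 ^ e 1 * M) (M * c) \<phi> F"
      using fac[OF order.refl assms(7)] unfolding cube_fac_def c(1) l dN by (auto simp: M_def)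
    then have "stage M (N * M) (cube (d 1)) (cube_edges (d 1)) (2 ^ e 1) 0 (\<lambda>v. \<phi> v mod M) F"
      by (rule stage_start) (use M0 N0 c(2) in simp_all)
    then show ?case by (auto simp: off_def)
  next
    case (step k)
    define B :: nat where "B = 2 ^ i (Suc k)"
    obtain \<theta> D where st: "stage M (N * M) (cube (\<Sum>l=1..k. d l)) (cube_edges (\<Sum>l=1..k. d l)) (2 ^ e k) (off k) \<theta> D"
      using step by auto
    have ob: "off (Suc k) + B \<le> M \<and> (\<forall>l\<in>{1..Suc k}. i (Suc k) \<le> i l)"
      unfolding off_def B_def M_def by (rule offset_bound[OF _ _ step.prems]) (use assms(9) in simp_all)
    \<comment> \<open>A window must start at a multiple of its size; the offset is a sum of powers
      of two with exponents at least \<open>i (Suc k)\<close>.\<close>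
    have "B dvd off k" unfolding off_def B_def using ob by (intro dvd_sum) (auto intro!: le_imp_power_dvd)
    then obtain p where p: "off k = p * B" by (metis dvdE mult.commute)
    have offS: "off (Suc k) = (p + 1) * B" using step.hyps p by (simp add: off_def B_def)
    have "(2 ^ L (Suc k) :: nat) div 2 = 2 ^ (L (Suc k) - 1)" "even ((2::nat) ^ L (Suc k))"
      using L(1)[of "Suc k"] assms(2) step.prems by (cases "L (Suc k)"; simp)+
    note Lk = this
    have "\<exists>\<theta>' D'. stage M (N * M) (cube ((\<Sum>l=1..k. d l) + 2 * (N * B))) (cube_edges ((\<Sum>l=1..k. d l) + 2 * (N * B)))
        (2 ^ e k * (2 ^ L (Suc k) div 2)) ((p + 1) * B) \<theta>' D'"
    proof (rule stage_cube_step[OF st[unfolded p]])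
      show "cube_fac (2 * (N * B)) (2 ^ L (Suc k)) (2 ^ (L (Suc k) - 2 * x))" unfolding B_def by (rule fac) (use step in simp_all)
      show "B dvd M" unfolding B_def M_def using ob by (intro le_imp_power_dvd) simp
      show "(p + 1) * B \<le> M" using ob offS by simp
      show "even ((2::nat) ^ e k)" "(2::nat) \<le> 2 ^ e k" using e2[of k] power_increasing[of 1 "e k" "2::nat"] by simp_all
    qed (use M0 Lk in \<open>simp_all add: B_def\<close>)
    moreover have "2 ^ e k * (2 ^ L (Suc k) div 2) = (2::nat) ^ e (Suc k)"
      using step.hyps unfolding Lk(1) by (simp add: e_def power_add)
    moreover have "(\<Sum>l=1..Suc k. d l) = (\<Sum>l=1..k. d l) + 2 * (N * B)" by (simp add: B_def dN)
    ultimately show ?case using offS by simp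
  qed
  then obtain \<theta> D where st: "stage M (N * M) (cube n) (cube_edges n) (2 ^ e j) (off j) \<theta> D"
    using assms(7) unfolding n by blast
  have n1: "1 \<le> n" using assms(2,4,6) by simp
  obtain C k where C: "edge_decomposition (hypercube n) k C" "\<forall>c<k. cycle_graph (2 ^ e j * (M + off j)) (C c)"
    and k: "2 * (k * (2 ^ e j * (M + off j))) = n * 2 ^ n"
    using stage_hypercube[OF st n1] by blast
  have "(\<Sum>l=2..j. L l) = (\<Sum>l=2..j. (L l - 1) + 1)"
  proof (rule sum.cong[OF refl])
    fix l assume "l \<in> {2..j}"
    then show "L l = L l - 1 + 1" using L(1)[of l] assms(2) by auto
  qed
  also have "\<dots> = (\<Sum>l=2..j. L l - 1) + (j - 1)" unfolding sum.distrib by simp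
  \<comment> \<open>Compared with the sum \<open>n - q\<close> of all exponents, \<open>i 1\<close>
    is lost to the factor \<open>M\<close> and one to each of the \<open>j - 1\<close>
    halvings.\<close>
  finally have "e j + i 1 + (j - 1) + q = n"
    using LT L(2) q split1[OF assms(7)] by (simp add: e_def)
  then have ej: "e j = n + 1 - i 1 - j - q" "\<alpha> + n = e j + (i 1 + \<alpha> + j + q - 2) + 1"
    using assms(5,7) by linarith+
  \<comment> \<open>Cancelling \<open>y\<close> and then the powers of two in the edge count leaves
    the number of cycles.\<close>
  have "2 * (k * 2 ^ e j) * y = (x * 2 ^ (\<alpha> + n)) * y" using k y assms(6) by (simp add: power_add mult_ac)
  then have "2 * (k * 2 ^ e j) = x * 2 ^ (\<alpha> + n)" using assms(4) by simp
  also have "\<dots> = 2 * (x * 2 ^ (i 1 + \<alpha> + j + q - 2) * 2 ^ e j)" unfolding ej(2) by (simp add: power_add)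
  finally have "k = x * 2 ^ (i 1 + \<alpha> + j + q - 2)" by simp
  then show ?thesis using C unfolding y[symmetric] ej(1) by (auto simp: mult.commute)
qed

end
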